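(* For each $i\in\mathbb{N}$ let $G_i$ be a finite group, with $|G_i|\to\infty$ as $i\to\infty$, let $S_i\subseteq G_i$ be a symmetric subset ($S_i=S_i^{-1}$), let $\mathcal{G}_i=\mathrm{Cay}(G_i,S_i)$, and let $t_i>0$ be a real number. Let $M_i\in\mathbb{N}$ be such that $$2M_i\sum_{(\pi,V)\in\hat{G_i}\setminus\{\mathrm{triv}\}}(\dim V)^2\left(6e^{-\frac{t_i\sqrt{\dim V}}{64}}+2e^{-\frac{\dim V}{12}}\right)<1,$$ and let $f_i^j:G_i\to\mathbb{R}$, for $j=1,\dots,M_i$ and $i\in\mathbb{N}$, be any collection of functions. Then there exist orthonormal bases $\mathcal{B}_i$ of $\ell^2(G_i)$ consisting of real-valued eigenfunctions of (the adjacency operator of) $\mathcal{G}_i$ such that for every $i$, every $\varphi\in\mathcal{B}_i$ and every $j=1,\dots,M_i$, $$\left|\mu_\varphi[f_i^j]-\frac{\sum_{g\in G_i}f_i^j(g)}{|G_i|}\right|\le t_i\frac{\|f_i^j\|_{\ell^2}}{\sqrt{|G_i|}}.$$ If $f_i^j=\mathbf{1}_{A_i^j}$ for some subsets $A_i^j\subseteq G_i$, then $$\left|\mu_\varphi[A_i^j]-\frac{|A_i^j|}{|G_i|}\right|\le t_i\frac{\sqrt{|A_i^j|}}{\sqrt{|G_i|}}$$ for every $\varphi\in\mathcal{B}_i$ and $j=1,\dots,M_i$; in particular, $\mu_\varphi[A_i^j]$ is asymptotic to $\frac{|A_i^j|}{|G_i|}$ as $i\to\infty$ (i.e. the ratio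 tends to $1$, for any choice of $\varphi=\varphi_i\in\mathcal{B}_i$ and $j=j_i\in\{1,\dots,M_i\}$) whenever $\frac{t_i^2|G_i|}{|A_i^j|}\to 0$ as $i\to\infty$.
   Context: For a finite group $G$, $\hat{G}$ is the set of equivalence classes of irreducible complex (unitary) representations $(\pi,V)$ of $G$, and $\mathrm{triv}$ is the trivial representation. $\ell^2(G)$ is the space of complex-valued functions on $G$ with inner product $\langle f_1,f_2\rangle=\sum_{g\in G}f_1(g)\overline{f_2(g)}$ (counting measure), and $\|\cdot\|_{\ell^2}$ is the associated norm. For a symmetric subset $S\subseteq G$, $\mathrm{Cay}(G,S)$ is the Cayley graph with vertex set $G$ and edges joining $g$ to $gs$ for $s\in S$; its adjacency operator on $\ell^2(G)$ is $\mathcal{A}[f](g)=\sum_{s\in S}f(gs)$. An eigenfunction of the graph means an eigenfunction of $\mathcal{A}$. For $\varphi\in\ell^2(G)$ with $\|\varphi\|_{\ell^2}=1$, the quantum probability measure is $\mu_\varphi=\sum_{g\in G}|\varphi(g)|^2\delta_g$, so $\mu_\varphi[f]=\sum_{g\in G}f(g)|\varphi(g)|^2$ for a function $f$ and $\mu_\varphi[A]=\sum_{g\in A}|\varphi(g)|^2$ for a subset $A$. *)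

theory Defs
  imports
    "HOL-Analysis.Analysis"
    "HOL-Algebra.Coset"
    "Jordan_Normal_Form.Schur_Decomposition"
begin

text \<open>
  A finite-dimensional unitary representation is taken on the standard Hilbert space
  \<open>\<complex>\<^sup>n\<close>, as a matrix representation together with its dimension; every finite-dimensional
  unitary representation is equivalent to one of this form.
\<close>

definition unitary_mat :: "complex mat \<Rightarrow> nat \<Rightarrow> bool" where
  "unitary_mat U n \<longleftrightarrow> U \<in> carrier_mat n n \<and> mat_adjoint U * U = 1\<^sub>m n"

definition unitary_rep :: "('a, 'b) monoid_scheme \<Rightarrow> ('a \<Rightarrow> complex mat) \<times> nat \<Rightarrow> bool" where
  "unitary_rep G = (\<lambda>(\<pi>, n).
     (\<forall>g\<in>carrier G. unitary_mat (\<pi> g) n) \<and>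
     (\<forall>g\<in>carrier G. \<forall>h\<in>carrier G. \<pi> (g \<otimes>\<^bsub>G\<^esub> h) = \<pi> g * \<pi> h))"

definition irreducible_rep :: "('a, 'b) monoid_scheme \<Rightarrow> ('a \<Rightarrow> complex mat) \<times> nat \<Rightarrow> bool" where
  "irreducible_rep G = (\<lambda>(\<pi>, n).
     0 < n \<and>
     (\<forall>W. VectorSpace.subspace class_ring W (module_vec TYPE(complex) n) \<and>
          (\<forall>g\<in>carrier G. \<forall>w\<in>W. \<pi> g *\<^sub>v w \<in> W) \<longrightarrow>
          W = {0\<^sub>v n} \<or> W = carrier_vec n))"

definition unitary_irreps :: "('a, 'b) monoid_scheme \<Rightarrow> (('a \<Rightarrow> complex mat) \<times> nat) set" where
  "unitary_irreps G = {p. unitary_rep G p \<and> irreducible_rep G p}"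

text \<open>
  Equivalence only looks at the values on the carrier, so the arbitrary values of \<open>\<pi>\<close>
  outside the carrier do not create additional classes.
\<close>

definition rep_equiv ::
  "('a, 'b) monoid_scheme \<Rightarrow> ((('a \<Rightarrow> complex mat) \<times> nat) \<times> (('a \<Rightarrow> complex mat) \<times> nat)) set" where
  "rep_equiv G = {((\<pi>, m), (\<rho>, n)).
     (\<pi>, m) \<in> unitary_irreps G \<and> (\<rho>, n) \<in> unitary_irreps G \<and> m = n \<and>
     (\<exists>T\<in>carrier_mat n n. invertible_mat T \<and> (\<forall>g\<in>carrier G. T * \<pi> g = \<rho> g * T))}"

definition unitary_dual :: "('a, 'b) monoid_scheme \<Rightarrow> (('a \<Rightarrow> complex mat) \<times> nat) set set" where
  "unitary_dual G = unitary_irreps G // rep_equiv G"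

definition triv_class :: "('a, 'b) monoid_scheme \<Rightarrow> (('a \<Rightarrow> complex mat) \<times> nat) set" where
  "triv_class G = rep_equiv G `` {((\<lambda>_. 1\<^sub>m 1), 1)}"

text \<open>Meaningful on elements of the dual, where all members of a class have the same dimension.\<close>

definition class_dim :: "(('a \<Rightarrow> complex mat) \<times> nat) set \<Rightarrow> nat" where
  "class_dim c = (THE n. \<exists>\<pi>. (\<pi>, n) \<in> c)"

definition l2_space :: "('a, 'b) monoid_scheme \<Rightarrow> ('a \<Rightarrow> complex) set" where
  "l2_space G = extensional (carrier G)"

definition l2_inner :: "('a, 'b) monoid_scheme \<Rightarrow> ('a \<Rightarrow> complex) \<Rightarrow> ('a \<Rightarrow> complex) \<Rightarrow> complex" where
  "l2_inner G f h = (\<Sum>g\<in>carrier G. f g * cnj (h g))"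

definition l2_norm :: "('a, 'b) monoid_scheme \<Rightarrow> ('a \<Rightarrow> complex) \<Rightarrow> real" where
  "l2_norm G f = sqrt (Re (l2_inner G f f))"

definition l2_orthonormal_basis :: "('a, 'b) monoid_scheme \<Rightarrow> ('a \<Rightarrow> complex) set \<Rightarrow> bool" where
  "l2_orthonormal_basis G B \<longleftrightarrow>
     finite B \<and> B \<subseteq> l2_space G \<and>
     (\<forall>\<phi>\<in>B. \<forall>\<psi>\<in>B. l2_inner G \<phi> \<psi> = (if \<phi> = \<psi> then 1 else 0)) \<and>
     (\<forall>f\<in>l2_space G. \<exists>c. \<forall>g\<in>carrier G. f g = (\<Sum>\<phi>\<in>B. c \<phi> * \<phi> g))"

text \<open>The adjacency operator of the Cayley graph, with edges joining \<open>g\<close> to \<open>gs\<close> for \<open>s \<in> S\<close>.\<close>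

definition cayley_adjacency ::
  "('a, 'b) monoid_scheme \<Rightarrow> 'a set \<Rightarrow> ('a \<Rightarrow> complex) \<Rightarrow> 'a \<Rightarrow> complex" where
  "cayley_adjacency G S f = (\<lambda>g\<in>carrier G. \<Sum>s\<in>S. f (g \<otimes>\<^bsub>G\<^esub> s))"

definition cayley_eigenfunction ::
  "('a, 'b) monoid_scheme \<Rightarrow> 'a set \<Rightarrow> ('a \<Rightarrow> complex) \<Rightarrow> bool" where
  "cayley_eigenfunction G S \<phi> \<longleftrightarrow>
     \<phi> \<in> l2_space G \<and> (\<exists>g\<in>carrier G. \<phi> g \<noteq> 0) \<and>
     (\<exists>\<mu>::complex. \<forall>g\<in>carrier G. cayley_adjacency G S \<phi> g = \<mu> * \<phi> g)"

definition real_valued_on :: "('a, 'b) monoid_scheme \<Rightarrow> ('a \<Rightarrow> complex) \<Rightarrow> bool" where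
  "real_valued_on G \<phi> \<longleftrightarrow> (\<forall>g\<in>carrier G. \<phi> g \<in> \<real>)"

definition real_eigenbasis ::
  "('a, 'b) monoid_scheme \<Rightarrow> 'a set \<Rightarrow> ('a \<Rightarrow> complex) set \<Rightarrow> bool" where
  "real_eigenbasis G S B \<longleftrightarrow>
     l2_orthonormal_basis G B \<and>
     (\<forall>\<phi>\<in>B. real_valued_on G \<phi> \<and> cayley_eigenfunction G S \<phi>)"

definition quantum_measure :: "('a, 'b) monoid_scheme \<Rightarrow> ('a \<Rightarrow> complex) \<Rightarrow> 'a measure" where
  "quantum_measure G \<phi> = point_measure (carrier G) (\<lambda>g. ennreal ((cmod (\<phi> g))\<^sup>2))"

lemma integral_quantum_measure:
  fixes f :: "'a \<Rightarrow> real"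
  assumes "finite (carrier G)"
  shows "(\<integral>g. f g \<partial>quantum_measure G \<phi>) = (\<Sum>g\<in>carrier G. f g * (cmod (\<phi> g))\<^sup>2)"
  using assms by (simp add: quantum_measure_def lebesgue_integral_point_measure_finite mult.commute)

lemma measure_quantum_measure:
  assumes "finite (carrier G)" "A \<subseteq> carrier G"
  shows "measure (quantum_measure G \<phi>) A = (\<Sum>g\<in>A. (cmod (\<phi> g))\<^sup>2)"
  using assms by (simp add: quantum_measure_def measure_point_measure_finite_if)

lemma l2_norm_eq: "l2_norm G f = sqrt (\<Sum>g\<in>carrier G. (cmod (f g))\<^sup>2)"
  by (simp add: l2_norm_def l2_inner_def complex_norm_square [symmetric] del: of_real_power)

lemma invertible_mat_iff:
  assumes T: "T \<in> carrier_mat n n"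
  shows "invertible_mat T \<longleftrightarrow> (\<exists>R\<in>carrier_mat n n. T * R = 1\<^sub>m n \<and> R * T = 1\<^sub>m n)"
proof
  assume "invertible_mat T"
  then obtain R where R: "T * R = 1\<^sub>m n" "R * T = 1\<^sub>m (dim_row R)"
    using T unfolding invertible_mat_def inverts_mat_def by (metis carrier_matD(1))
  have "dim_col R = n" using arg_cong[OF R(1), of dim_col] by simp
  moreover have "dim_row R = n" using arg_cong[OF R(2), of dim_col] T by simp
  ultimately show "\<exists>R\<in>carrier_mat n n. T * R = 1\<^sub>m n \<and> R * T = 1\<^sub>m n"
    using R by (intro bexI[of _ R]) auto
next
  assume "\<exists>R\<in>carrier_mat n n. T * R = 1\<^sub>m n \<and> R * T = 1\<^sub>m n"
  then show "invertible_mat T"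
    using T unfolding invertible_mat_def inverts_mat_def by auto
qed

lemma equiv_rep_equiv: "equiv (unitary_irreps G) (rep_equiv G)"
proof (rule equivI)
  show "rep_equiv G \<subseteq> unitary_irreps G \<times> unitary_irreps G"
    by (auto simp: rep_equiv_def)
  show "refl_on (unitary_irreps G) (rep_equiv G)"
  proof (rule refl_onI)
    fix p assume p: "p \<in> unitary_irreps G"
    obtain \<pi> n where [simp]: "p = (\<pi>, n)" by (cases p)
    have c: "\<pi> g \<in> carrier_mat n n" if "g \<in> carrier G" for g
      using p that by (auto simp: unitary_irreps_def unitary_rep_def unitary_mat_def)
    have "invertible_mat (1\<^sub>m n :: complex mat)"
      unfolding invertible_mat_def inverts_mat_def by (auto intro!: exI[of _ "1\<^sub>m n"])
    then show "(p, p) \<in> rep_equiv G"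
      using p by (auto simp: rep_equiv_def left_mult_one_mat[OF c] right_mult_one_mat[OF c]
          intro!: bexI[of _ "1\<^sub>m n"])
  qed
  show "sym (rep_equiv G)"
  proof (rule symI)
    fix p q assume pq: "(p, q) \<in> rep_equiv G"
    obtain \<pi> m \<rho> n where [simp]: "p = (\<pi>, m)" "q = (\<rho>, n)" by (cases p, cases q)
    have [simp]: "m = n" using pq by (simp add: rep_equiv_def)
    obtain T where T: "T \<in> carrier_mat n n" "invertible_mat T"
      and i: "\<And>g. g \<in> carrier G \<Longrightarrow> T * \<pi> g = \<rho> g * T"
      using pq by (auto simp: rep_equiv_def)
    have c: "\<pi> g \<in> carrier_mat n n" "\<rho> g \<in> carrier_mat n n" if "g \<in> carrier G" for g
      using pq that by (auto simp: rep_equiv_def unitary_irreps_def unitary_rep_def unitary_mat_def)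
    obtain R where Rc: "R \<in> carrier_mat n n" and R: "T * R = 1\<^sub>m n" "R * T = 1\<^sub>m n"
      using T by (auto simp: invertible_mat_iff[OF T(1)])
    have "R * \<rho> g = \<pi> g * R" if g: "g \<in> carrier G" for g
    proof -
      have "R * \<rho> g = R * (\<rho> g * (T * R))" using R c[OF g] by simp
      also have "\<dots> = R * ((\<rho> g * T) * R)"
        using assoc_mult_mat[OF c(2)[OF g] T(1) Rc] by simp
      also have "\<dots> = R * (T * (\<pi> g * R))"
        using i[OF g] assoc_mult_mat[OF T(1) c(1)[OF g] Rc] by simp
      also have "\<dots> = (R * T) * (\<pi> g * R)"
        using assoc_mult_mat[OF Rc T(1), of "\<pi> g * R" n] c[OF g] Rc by simp
      also have "\<dots> = \<pi> g * R" using R(2) c[OF g] Rc by simp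
      finally show ?thesis .
    qed
    moreover have "invertible_mat R"
      using R T(1) by (auto simp: invertible_mat_iff[OF Rc])
    ultimately have "\<exists>V\<in>carrier_mat n n. invertible_mat V \<and> (\<forall>g\<in>carrier G. V * \<rho> g = \<pi> g * V)"
      using Rc by blast
    then show "(q, p) \<in> rep_equiv G"
      using pq by (simp add: rep_equiv_def)
  qed
  show "trans (rep_equiv G)"
  proof (rule transI)
    fix p q r assume pq: "(p, q) \<in> rep_equiv G" and qr: "(q, r) \<in> rep_equiv G"
    obtain \<pi> m \<rho> n \<sigma> k where [simp]: "p = (\<pi>, m)" "q = (\<rho>, n)" "r = (\<sigma>, k)"
      by (cases p, cases q, cases r)
    have [simp]: "m = n" "k = n" using pq qr by (simp_all add: rep_equiv_def)
    obtain T where T: "T \<in> carrier_mat n n" "invertible_mat T"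
      and i: "\<And>g. g \<in> carrier G \<Longrightarrow> T * \<pi> g = \<rho> g * T"
      using pq by (auto simp: rep_equiv_def)
    obtain U where U: "U \<in> carrier_mat n n" "invertible_mat U"
      and j: "\<And>g. g \<in> carrier G \<Longrightarrow> U * \<rho> g = \<sigma> g * U"
      using qr by (auto simp: rep_equiv_def)
    have c: "\<pi> g \<in> carrier_mat n n" "\<rho> g \<in> carrier_mat n n" "\<sigma> g \<in> carrier_mat n n"
      if "g \<in> carrier G" for g
      using pq qr that
      by (auto simp: rep_equiv_def unitary_irreps_def unitary_rep_def unitary_mat_def)
    have "(U * T) * \<pi> g = \<sigma> g * (U * T)" if g: "g \<in> carrier G" for g
      using i[OF g] j[OF g] assoc_mult_mat[OF U(1) T(1) c(1)[OF g]]
        assoc_mult_mat[OF U(1) c(2)[OF g] T(1)] assoc_mult_mat[OF c(3)[OF g] U(1) T(1)]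
      by simp
    moreover have "invertible_mat (U * T)"
    proof -
      obtain R where R: "R \<in> carrier_mat n n" "T * R = 1\<^sub>m n" "R * T = 1\<^sub>m n"
        using T by (auto simp: invertible_mat_iff[OF T(1)])
      obtain Q where Q: "Q \<in> carrier_mat n n" "U * Q = 1\<^sub>m n" "Q * U = 1\<^sub>m n"
        using U by (auto simp: invertible_mat_iff[OF U(1)])
      have "(U * T) * (R * Q) = U * ((T * R) * Q)"
        using T(1) U(1) R(1) Q(1) by (simp add: assoc_mult_mat[of _ n n _ n _ n])
      then have "(U * T) * (R * Q) = 1\<^sub>m n" using R Q by simp
      moreover have "(R * Q) * (U * T) = R * ((Q * U) * T)"
        using T(1) U(1) R(1) Q(1) by (simp add: assoc_mult_mat[of _ n n _ n _ n])
      then have "(R * Q) * (U * T) = 1\<^sub>m n" using R Q T(1) by simp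
      ultimately show ?thesis
        using invertible_mat_iff[OF mult_carrier_mat[OF U(1) T(1)]]
          mult_carrier_mat[OF R(1) Q(1)] by blast
    qed
    ultimately have "\<exists>V\<in>carrier_mat n n. invertible_mat V \<and> (\<forall>g\<in>carrier G. V * \<pi> g = \<sigma> g * V)"
      using mult_carrier_mat[OF U(1) T(1)] by blast
    then show "(p, r) \<in> rep_equiv G"
      using pq qr by (simp add: rep_equiv_def)
  qed
qed

lemma class_dim_eq:
  assumes "c \<in> unitary_dual G" "(\<pi>, n) \<in> c"
  shows "class_dim c = n"
  using assms unfolding class_dim_def
  by (intro the_equality) (auto simp: unitary_dual_def quotient_def rep_equiv_def)

lemma triv_in_unitary_dual: "triv_class G \<in> unitary_dual G"
proof -
  have adj: "mat_adjoint (1\<^sub>m 1 :: complex mat) * 1\<^sub>m 1 = 1\<^sub>m 1"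
    by (rule eq_matI) (auto simp: mat_adjoint_def mat_of_rows_def cols_def scalar_prod_def)
  have "W = {0\<^sub>v 1} \<or> W = carrier_vec 1"
    if W: "VectorSpace.subspace class_ring W (module_vec TYPE(complex) 1)" for W
  proof -
    have sub: "submodule class_ring W (module_vec TYPE(complex) 1)"
      using W by (simp add: VectorSpace.subspace_def)
    have sc: "W \<subseteq> carrier_vec 1" and z: "0\<^sub>v 1 \<in> W"
      and sm: "\<And>a v. v \<in> W \<Longrightarrow> a \<cdot>\<^sub>v v \<in> W"
      using sub unfolding submodule_def by (auto simp: module_vec_simps)
    show ?thesis
    proof (cases "W = {0\<^sub>v 1}")
      case False
      then obtain w where w: "w \<in> W" "w \<noteq> 0\<^sub>v 1" using z by auto
      have wc: "w \<in> carrier_vec 1" using w sc by auto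
      have w0: "vec_index w 0 \<noteq> 0"
        using w wc by (metis carrier_vecD eq_vecI index_zero_vec(1,2) less_one)
      have "v \<in> W" if v: "v \<in> carrier_vec 1" for v
      proof -
        have "(vec_index v 0 / vec_index w 0) \<cdot>\<^sub>v w = v"
          using w0 wc v by (intro eq_vecI) auto
        then show ?thesis using sm[OF w(1)] by metis
      qed
      then show ?thesis using sc by auto
    qed simp
  qed
  then have "((\<lambda>_. 1\<^sub>m 1), 1) \<in> unitary_irreps G"
    using adj by (auto simp: unitary_irreps_def unitary_rep_def irreducible_rep_def unitary_mat_def)
  then show ?thesis
    unfolding unitary_dual_def triv_class_def by (rule quotientI)
qed

end

theory Submission
  imports Defs "Jordan_Normal_Form.Spectral_Radius"
begin

text \<open>
  Every eigenspace \<open>E\<close> of the adjacency operator on the orthogonal complement of the constants is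
  invariant under left translation. Hence its reproducing kernel \<open>K\<close> satisfies \<open>K(g, g) = m/|G|\<close> with
  \<open>m = dim E\<close>, and the quadratic form \<open>\<phi> \<mapsto> \<mu>\<^sub>\<phi>[f]\<close> on the real points of \<open>E\<close> has trace
  \<open>m \<Sum> f / |G|\<close> and Frobenius norm at most \<open>(m/|G|)\<^sup>1\<^sup>/\<^sup>2 \<parallel>f\<parallel>\<close>. An orthonormal basis of \<open>E\<close> on which all the
  given forms are close to their normalised traces comes from a random choice of signs: the vectors
  of the basis are signed sums of orthonormal bases which are related by discrete Fourier phases,
  and the deviation of a quadratic form in random signs has exponential tails. A minimal invariant
  subspace of \<open>E\<close> is a nontrivial irreducible representation of dimension \<open>d \<le> m\<close>, so that the single
  summand of its class in the hypothesis pays for the union bound over \<open>E\<close>.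
\<close>

section \<open>Signs that balance quadratic forms\<close>

text \<open>Scaling by the dimension m shows where the room comes from: the tolerance becomes m t
  |f| / sqrt |G|, which is t sqrt m times the Frobenius bound. So a tail exponential in t sqrt m has
  to beat only the number m M of forms, one for each basis vector and each function. A single vector
  of signs must serve all of them, because orthonormality of the basis rests on a common choice. No
  probability space is used: signs are selected successively so that a sum of exponentials, one per
  form and per sign of its deviation, stays within a budget fixed at the start. The trivial
  representation has no summand in the hypothesis, which is why the constants are split off; their
  unit vector has exactly uniform quantum measure. Symmetry of the generating set makes the
  eigenvalues real, so each eigenspace is stable under conjugation and an orthonormal basis of its
  real points is one of the whole eigenspace.\<close>

lemma cosh_le_exp_half_square:
  fixes x :: real
  shows "cosh x \<le> exp (x\<^sup>2 / 2)"
proof -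
  have s1: "(\<lambda>n. x ^ (2 * n) / fact (2 * n)) sums cosh x"
  proof -
    have "(\<lambda>n. if even n then x ^ n /\<^sub>R fact n else 0) sums cosh x"
      by (rule cosh_converges)
    then have "(\<lambda>n. if even (2 * n) then x ^ (2 * n) /\<^sub>R fact (2 * n) else 0) sums cosh x"
      by (subst sums_mono_reindex[of "\<lambda>n. 2 * n"]) (auto simp: strict_mono_def elim!: evenE)
    then show ?thesis by (simp add: field_simps)
  qed
  have s2: "(\<lambda>n. (x\<^sup>2 / 2) ^ n / fact n) sums exp (x\<^sup>2 / 2)"
    using exp_converges[of "x\<^sup>2 / 2"] by (simp add: field_simps)
  \<comment> \<open>This comparison of factorials lets the two power series be compared term by
    term.\<close>
  have f: "2 ^ n * fact n \<le> (fact (2 * n) :: real)" for n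
  proof (induction n)
    case (Suc n)
    have "2 ^ Suc n * fact (Suc n) = (2 * real n + 2) * (2 ^ n * fact n)"
      by (simp add: algebra_simps)
    also have "\<dots> \<le> (2 * real n + 2) * fact (2 * n)"
      using Suc.IH by (intro mult_left_mono) auto
    also have "\<dots> \<le> (2 * real n + 2) * ((2 * real n + 1) * fact (2 * n))"
      by (intro mult_left_mono) (auto simp: algebra_simps)
    also have "\<dots> = fact (2 * Suc n)"
      by (simp add: algebra_simps)
    finally show ?case .
  qed simp
  have "x ^ (2 * n) / fact (2 * n) \<le> (x\<^sup>2 / 2) ^ n / fact n" for n
  proof -
    have "x ^ (2 * n) / fact (2 * n) \<le> x ^ (2 * n) / (2 ^ n * fact n)"
      using f[of n] by (intro divide_left_mono) (auto simp: power_mult)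
    then show ?thesis by (simp add: power_mult power_divide)
  qed
  then show ?thesis using s1 s2 by (rule sums_le)
qed

lemma sum_square_Suc:
  fixes B :: "nat \<Rightarrow> nat \<Rightarrow> real"
  assumes "\<And>p q. B p q = B q p"
  shows "(\<Sum>p<Suc n. \<Sum>q<Suc n. B p q) = (\<Sum>p<n. \<Sum>q<n. B p q) + 2 * (\<Sum>p<n. B p n) + B n n"
proof -
  have "(\<Sum>q<n. B n q) = (\<Sum>p<n. B p n)"
    by (intro sum.cong refl assms)
  then show ?thesis
    by (simp add: sum.distrib)
qed

text \<open>Cauchy-Schwarz over index pairs; the rank one matrix of the products of entries of
  \<open>b\<close> has Frobenius norm equal to the squared length of \<open>b\<close>.\<close>

lemma quadratic_form_le_frobenius:
  fixes B :: "nat \<Rightarrow> nat \<Rightarrow> real"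
  assumes "(\<Sum>p<n. \<Sum>q<n. (B p q)\<^sup>2) \<le> r\<^sup>2" "0 \<le> r"
  shows "(\<Sum>p<n. \<Sum>q<n. B p q * b p * b q) \<le> r * (\<Sum>p<n. (b p)\<^sup>2)"
proof -
  let ?P = "{..<n} \<times> {..<n}"
  let ?y = "\<Sum>p<n. (b p)\<^sup>2"
  have y0: "0 \<le> ?y" by (simp add: sum_nonneg)
  have "(\<Sum>z\<in>?P. B (fst z) (snd z) * (b (fst z) * b (snd z)))\<^sup>2
      \<le> (\<Sum>z\<in>?P. (B (fst z) (snd z))\<^sup>2) * (\<Sum>z\<in>?P. (b (fst z) * b (snd z))\<^sup>2)"
    by (rule Cauchy_Schwarz_ineq_sum)
  also have "(\<Sum>z\<in>?P. (b (fst z) * b (snd z))\<^sup>2) = ?y\<^sup>2"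
    by (simp add: power_mult_distrib sum.cartesian_product' power2_eq_square[of ?y] sum_product)
  also have "(\<Sum>z\<in>?P. (B (fst z) (snd z))\<^sup>2) = (\<Sum>p<n. \<Sum>q<n. (B p q)\<^sup>2)"
    by (simp add: sum.cartesian_product')
  also have "(\<Sum>z\<in>?P. B (fst z) (snd z) * (b (fst z) * b (snd z))) = (\<Sum>p<n. \<Sum>q<n. B p q * b p * b q)"
    by (simp add: sum.cartesian_product' mult.assoc)
  also have "(\<Sum>p<n. \<Sum>q<n. (B p q)\<^sup>2) * ?y\<^sup>2 \<le> (r * ?y)\<^sup>2"
    using assms by (simp add: power_mult_distrib mult_right_mono)
  finally show ?thesis
    using assms(2) y0 by (meson mult_nonneg_nonneg power2_le_imp_le)
qed

text \<open>
  Signs are fixed one at a time by conditional expectation. Averaging over the last sign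
  replaces the form \<open>B\<close> by its principal part plus the rank one form \<open>2 b b\<^sup>T\<close>, where \<open>b\<close> is the last
  column; smallness of the Frobenius norm makes the new bound no worse than the old one.
\<close>

lemma sign_choice:
  fixes B :: "'i \<Rightarrow> nat \<Rightarrow> nat \<Rightarrow> real" and c :: "'i \<Rightarrow> real"
  assumes "finite I" and "\<And>i p q. i \<in> I \<Longrightarrow> B i p q = B i q p"
    and "\<And>i. i \<in> I \<Longrightarrow> (\<Sum>p<n. \<Sum>q<n. (B i p q)\<^sup>2) \<le> (1/5)\<^sup>2"
  shows "\<exists>\<epsilon> :: nat \<Rightarrow> real. (\<forall>p. \<epsilon> p = 1 \<or> \<epsilon> p = -1) \<and>
    (\<Sum>i\<in>I. exp (c i + (\<Sum>p<n. \<Sum>q<n. \<epsilon> p * \<epsilon> q * B i p q) - (\<Sum>p<n. B i p p)))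
    \<le> (\<Sum>i\<in>I. exp (c i + 2 * (\<Sum>p<n. \<Sum>q<n. (B i p q)\<^sup>2)))"
  using assms(2,3)
proof (induction n arbitrary: B c)
  case 0
  show ?case by (auto intro!: exI[of _ "\<lambda>_. 1"])
next
  case (Suc n)
  define y where "y i = (\<Sum>p<n. (B i p n)\<^sup>2)" for i
  define X where "X i = (\<Sum>p<n. \<Sum>q<n. (B i p q)\<^sup>2)" for i
  \<comment> \<open>The last sign multiplies z = 2 * (sum of \<open>\<epsilon> p * B i p n\<close>).
    Averaging it costs a factor cosh z, at most exp (z^2 / 2), and z^2 / 2 is the quadratic form in
    the remaining signs that is added here.\<close>
  define C where "C i p q = B i p q + 2 * (B i p n * B i q n)" for i p q
  have y0: "0 \<le> y i" for i by (simp add: y_def sum_nonneg)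
  have X0: "0 \<le> X i" for i by (simp add: X_def sum_nonneg)
  have sq: "(\<Sum>p<Suc n. \<Sum>q<Suc n. (B i p q)\<^sup>2) = X i + 2 * y i + (B i n n)\<^sup>2" if "i \<in> I" for i
    using sum_square_Suc[of "\<lambda>p q. (B i p q)\<^sup>2" n] Suc.prems(1)[OF that]
    unfolding X_def y_def by simp
  have small: "X i + 2 * y i \<le> 1/25" if "i \<in> I" for i
  proof -
    have "X i + 2 * y i + (B i n n)\<^sup>2 \<le> 1/25"
      using Suc.prems(2)[OF that] unfolding sq[OF that] by (simp add: power_divide)
    then show ?thesis using zero_le_power2[of "B i n n"] by linarith
  qed
  \<comment> \<open>Origin of 1/5: the cross term is at most 4/5 * y and the square term at most
    4/50 * y, which together stay below y.\<close>
  have normC: "(\<Sum>p<n. \<Sum>q<n. (C i p q)\<^sup>2) \<le> X i + y i" if i: "i \<in> I" for i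
  proof -
    have "(C i p q)\<^sup>2 = (B i p q)\<^sup>2 + 4 * (B i p q * B i p n * B i q n)
        + 4 * ((B i p n)\<^sup>2 * (B i q n)\<^sup>2)" for p q
      by (simp add: C_def power2_eq_square algebra_simps)
    moreover have "(y i)\<^sup>2 = (\<Sum>p<n. \<Sum>q<n. (B i p n)\<^sup>2 * (B i q n)\<^sup>2)"
      by (simp add: y_def power2_eq_square[of "sum _ _"] sum_product)
    ultimately have "(\<Sum>p<n. \<Sum>q<n. (C i p q)\<^sup>2)
        = X i + 4 * (\<Sum>p<n. \<Sum>q<n. B i p q * B i p n * B i q n) + 4 * (y i)\<^sup>2"
      by (simp add: X_def sum.distrib sum_distrib_left)
    moreover have "(\<Sum>p<n. \<Sum>q<n. B i p q * B i p n * B i q n) \<le> 1/5 * y i"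
      unfolding y_def using small[OF i] y0[of i]
      by (intro quadratic_form_le_frobenius) (auto simp: X_def power2_eq_square)
    moreover have "(y i)\<^sup>2 \<le> 1/50 * y i"
      unfolding power2_eq_square using small[OF i] y0[of i] X0[of i] by (intro mult_right_mono) auto
    ultimately show ?thesis using y0[of i] by linarith
  qed
  \<comment> \<open>The trace of \<open>C\<close> exceeds that of the principal part of
    \<open>B\<close> by \<open>2 * y i\<close>, so the constant is shifted by the same amount. This
    is why the induction runs over arbitrary \<open>c\<close>.\<close>
  obtain \<epsilon> :: "nat \<Rightarrow> real" where \<epsilon>: "\<And>p. \<epsilon> p = 1 \<or> \<epsilon> p = -1"
    and le: "(\<Sum>i\<in>I. exp ((c i + 2 * y i) + (\<Sum>p<n. \<Sum>q<n. \<epsilon> p * \<epsilon> q * C i p q) - (\<Sum>p<n. C i p p)))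
      \<le> (\<Sum>i\<in>I. exp ((c i + 2 * y i) + 2 * (\<Sum>p<n. \<Sum>q<n. (C i p q)\<^sup>2)))"
  proof -
    have sym: "C i p q = C i q p" if "i \<in> I" for i p q
      using Suc.prems(1)[OF that, of p q] by (simp add: C_def)
    have bd: "(\<Sum>p<n. \<Sum>q<n. (C i p q)\<^sup>2) \<le> (1/5)\<^sup>2" if "i \<in> I" for i
      using normC[OF that] small[OF that] y0[of i] by (simp add: power2_eq_square)
    show ?thesis using Suc.IH[of C "\<lambda>i. c i + 2 * y i", OF sym bd] that by blast
  qed
  define W where "W i = c i + (\<Sum>p<n. \<Sum>q<n. \<epsilon> p * \<epsilon> q * B i p q) - (\<Sum>p<n. B i p p)" for i
  define z where "z i = 2 * (\<Sum>p<n. \<epsilon> p * B i p n)" for i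
  have eC: "(c i + 2 * y i) + (\<Sum>p<n. \<Sum>q<n. \<epsilon> p * \<epsilon> q * C i p q) - (\<Sum>p<n. C i p p) = W i + (z i)\<^sup>2 / 2" for i
  proof -
    have "(\<Sum>p<n. \<Sum>q<n. \<epsilon> p * \<epsilon> q * C i p q) = (\<Sum>p<n. \<Sum>q<n. \<epsilon> p * \<epsilon> q * B i p q) + (z i)\<^sup>2 / 2"
    proof -
      have "(z i)\<^sup>2 / 2 = (\<Sum>p<n. \<Sum>q<n. 2 * ((\<epsilon> p * B i p n) * (\<epsilon> q * B i q n)))"
      proof -
        have "(z i)\<^sup>2 / 2 = 2 * ((\<Sum>p<n. \<epsilon> p * B i p n) * (\<Sum>p<n. \<epsilon> p * B i p n))"
          by (simp add: z_def power2_eq_square)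
        then show ?thesis by (subst (asm) sum_product) (simp only: sum_distrib_left)
      qed
      moreover have "\<epsilon> p * \<epsilon> q * C i p q = \<epsilon> p * \<epsilon> q * B i p q + 2 * ((\<epsilon> p * B i p n) * (\<epsilon> q * B i q n))" for p q
        by (simp add: C_def algebra_simps)
      ultimately show ?thesis by (simp add: sum.distrib)
    qed
    moreover have "(\<Sum>p<n. C i p p) = (\<Sum>p<n. B i p p) + 2 * y i"
      by (simp add: C_def y_def sum.distrib sum_distrib_left power2_eq_square)
    ultimately show ?thesis by (simp add: W_def)
  qed
  have eB: "c i + (\<Sum>p<Suc n. \<Sum>q<Suc n. (\<epsilon>(n := \<sigma>)) p * (\<epsilon>(n := \<sigma>)) q * B i p q) - (\<Sum>p<Suc n. B i p p)
      = W i + \<sigma> * z i" if i: "i \<in> I" and \<sigma>: "\<sigma> = 1 \<or> \<sigma> = -1" for i \<sigma>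
  proof -
    have "(\<Sum>p<Suc n. \<Sum>q<Suc n. (\<epsilon>(n := \<sigma>)) p * (\<epsilon>(n := \<sigma>)) q * B i p q)
       = (\<Sum>p<n. \<Sum>q<n. \<epsilon> p * \<epsilon> q * B i p q) + \<sigma> * z i + B i n n"
      using sum_square_Suc[of "\<lambda>p q. (\<epsilon>(n := \<sigma>)) p * (\<epsilon>(n := \<sigma>)) q * B i p q" n] Suc.prems(1)[OF i] \<sigma>
      by (auto simp: z_def sum_distrib_left sum_negf algebra_simps)
    then show ?thesis by (simp add: W_def)
  qed
  define D where "D = (\<Sum>i\<in>I. exp (c i + 2 * (\<Sum>p<Suc n. \<Sum>q<Suc n. (B i p q)\<^sup>2)))"
  have "(\<Sum>i\<in>I. exp (W i + 1 * z i)) + (\<Sum>i\<in>I. exp (W i + (-1) * z i)) = (\<Sum>i\<in>I. 2 * (exp (W i) * cosh (z i)))"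
    unfolding sum.distrib[symmetric] exp_add
    by (intro sum.cong refl) (simp add: cosh_def distrib_left)
  also have "\<dots> \<le> (\<Sum>i\<in>I. 2 * exp (W i + (z i)\<^sup>2 / 2))"
    using cosh_le_exp_half_square by (intro sum_mono) (simp add: exp_add)
  also have "\<dots> \<le> 2 * (\<Sum>i\<in>I. exp ((c i + 2 * y i) + 2 * (\<Sum>p<n. \<Sum>q<n. (C i p q)\<^sup>2)))"
    using le unfolding eC by (simp add: sum_distrib_left[symmetric])
  also have "\<dots> \<le> 2 * D"
  proof -
    \<comment> \<open>The budget closes: the shift 2 y and twice the bound X + y give 2 X + 4 y,
      which is twice the full Frobenius square up to the last diagonal entry.\<close>
    have "c i + 2 * y i + 2 * (\<Sum>p<n. \<Sum>q<n. (C i p q)\<^sup>2)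
        \<le> c i + 2 * (\<Sum>p<Suc n. \<Sum>q<Suc n. (B i p q)\<^sup>2)" if "i \<in> I" for i
      using normC[OF that] zero_le_power2[of "B i n n"] unfolding sq[OF that] by argo
    then show ?thesis
      unfolding D_def by (intro mult_left_mono sum_mono) auto
  qed
  finally have "(\<Sum>i\<in>I. exp (W i + 1 * z i)) \<le> D \<or> (\<Sum>i\<in>I. exp (W i + (-1) * z i)) \<le> D"
    by linarith
  then obtain \<sigma> where \<sigma>: "\<sigma> = 1 \<or> \<sigma> = -1" "(\<Sum>i\<in>I. exp (W i + \<sigma> * z i)) \<le> D" by blast
  have "(\<Sum>i\<in>I. exp (c i + (\<Sum>p<Suc n. \<Sum>q<Suc n. (\<epsilon>(n := \<sigma>)) p * (\<epsilon>(n := \<sigma>)) q * B i p q) - (\<Sum>p<Suc n. B i p p)))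
      = (\<Sum>i\<in>I. exp (W i + \<sigma> * z i))"
    using eB \<sigma>(1) by (intro sum.cong refl) presburger
  then show ?case
    using \<sigma> \<epsilon> unfolding D_def by (intro exI[of _ "\<epsilon>(n := \<sigma>)"]) auto
qed

text \<open>Each form is scaled to Frobenius norm at most 1/5 and entered with both signs, so that
  an upper bound on exponentials controls the absolute value. The total budget 2 |I| exp (2/25) is
  at most 4 |I|; each single exponential is bounded by it, and hence by exp (s / 5).\<close>

lemma sign_choice_deviation:
  fixes F :: "'i \<Rightarrow> nat \<Rightarrow> nat \<Rightarrow> real" and N :: "'i \<Rightarrow> real"
  assumes fin: "finite I" and sym: "\<And>i p q. i \<in> I \<Longrightarrow> F i p q = F i q p"
    and N: "\<And>i. i \<in> I \<Longrightarrow> 0 \<le> N i"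
    and F: "\<And>i. i \<in> I \<Longrightarrow> (\<Sum>p<n. \<Sum>q<n. (F i p q)\<^sup>2) \<le> (N i)\<^sup>2"
    and few: "4 * real (card I) \<le> exp (s / 5)"
  shows "\<exists>\<epsilon> :: nat \<Rightarrow> real. (\<forall>p. \<epsilon> p = 1 \<or> \<epsilon> p = -1) \<and>
    (\<forall>i\<in>I. \<bar>(\<Sum>p<n. \<Sum>q<n. \<epsilon> p * \<epsilon> q * F i p q) - (\<Sum>p<n. F i p p)\<bar> \<le> s * N i)"
proof -
  define B where "B z p q = (if snd z then 1 else -1) / (5 * N (fst z)) * F (fst z) p q"
    for z :: "'i \<times> bool" and p q
  define J where "J = I \<times> (UNIV :: bool set)"
  have finJ: "finite J" using fin by (simp add: J_def)
  have nB: "(\<Sum>p<n. \<Sum>q<n. (B z p q)\<^sup>2) \<le> (1/5)\<^sup>2" if z: "z \<in> J" for z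
  \<comment> \<open>For \<open>N\<close> = 0 the convention x / 0 = 0 makes \<open>B\<close> vanish.
    The form itself is then zero, and its deviation is treated separately below.\<close>
  proof (cases "N (fst z) = 0")
    case False
    then have "N (fst z) > 0" using N z by (auto simp: J_def less_le)
    have "(\<Sum>p<n. \<Sum>q<n. (B z p q)\<^sup>2) = (\<Sum>p<n. \<Sum>q<n. (F (fst z) p q)\<^sup>2) / (5 * N (fst z))\<^sup>2"
      by (simp add: B_def power_mult_distrib power_divide sum_distrib_left sum_divide_distrib)
    also have "\<dots> \<le> (N (fst z))\<^sup>2 / (5 * N (fst z))\<^sup>2"
      using F z by (intro divide_right_mono) (auto simp: J_def)
    finally show ?thesis using False by (simp add: power2_eq_square)
  qed (simp add: B_def)
  obtain \<epsilon> :: "nat \<Rightarrow> real" where \<epsilon>: "\<And>p. \<epsilon> p = 1 \<or> \<epsilon> p = -1"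
    and le: "(\<Sum>z\<in>J. exp (0 + (\<Sum>p<n. \<Sum>q<n. \<epsilon> p * \<epsilon> q * B z p q) - (\<Sum>p<n. B z p p)))
      \<le> (\<Sum>z\<in>J. exp (0 + 2 * (\<Sum>p<n. \<Sum>q<n. (B z p q)\<^sup>2)))"
  proof -
    have "B z p q = B z q p" if "z \<in> J" for z p q
      using sym[of "fst z" p q] that by (auto simp: B_def J_def)
    from sign_choice[of J B n "\<lambda>_. 0", OF finJ this nB] show ?thesis using that by blast
  qed
  define d where "d i = (\<Sum>p<n. \<Sum>q<n. \<epsilon> p * \<epsilon> q * F i p q) - (\<Sum>p<n. F i p p)" for i
  have "\<bar>d i\<bar> \<le> s * N i" if i: "i \<in> I" for i
  proof (cases "N i = 0")
    case True
    then have "(\<Sum>p<n. \<Sum>q<n. (F i p q)\<^sup>2) = 0"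
      using F[OF i] by (intro antisym sum_nonneg) auto
    then have "F i p q = 0" if "p < n" "q < n" for p q
      using that by (auto simp: sum_nonneg_eq_0_iff sum_nonneg)
    then show ?thesis using True by (simp add: d_def)
  next
    case False
    then have Npos: "N i > 0" using N[OF i] by simp
    have "\<sigma> * d i \<le> s * N i" if \<sigma>: "\<sigma> = (if b then 1 else -1)" for \<sigma> b
    proof -
      have "exp (\<sigma> * d i / (5 * N i)) = exp (0 + (\<Sum>p<n. \<Sum>q<n. \<epsilon> p * \<epsilon> q * B (i, b) p q) - (\<Sum>p<n. B (i, b) p p))"
        unfolding B_def d_def using \<sigma>
        by (simp add: sum_distrib_left sum_divide_distrib diff_divide_distrib sum_negf algebra_simps)
      also have "\<dots> \<le> (\<Sum>z\<in>J. exp (0 + (\<Sum>p<n. \<Sum>q<n. \<epsilon> p * \<epsilon> q * B z p q) - (\<Sum>p<n. B z p p)))"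
        using finJ i by (intro member_le_sum) (auto simp: J_def)
      also have "\<dots> \<le> (\<Sum>z\<in>J. exp (0 + 2 * (1/5)\<^sup>2))"
        using nB by (intro order_trans[OF le] sum_mono) auto
      also have "\<dots> = 2 * real (card I) * exp (2/25)"
        by (simp add: J_def card_cartesian_product power2_eq_square)
      also have "\<dots> \<le> 2 * real (card I) * 2"
        using exp_bound[of "2/25 :: real"] by (intro mult_left_mono) (auto simp: power2_eq_square)
      also have "\<dots> \<le> exp (s / 5)" using few by simp
      finally show ?thesis using Npos by (simp add: field_simps)
    qed
    from this[of 1 True] this[of "-1" False] show ?thesis by simp
  qed
  then show ?thesis using \<epsilon> unfolding d_def by blast
qed

section \<open>Orthonormal families of functions\<close>

text \<open>
  Functions on a finite set \<open>X\<close> are represented as functions vanishing outside \<open>X\<close>. The scalars \<open>K\<close>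
  of a \<open>lin_sub\<close> are either \<open>UNIV\<close> or \<open>\<real>\<close>; the latter is used for spaces of real-valued functions.
\<close>

definition ip :: "'a set \<Rightarrow> ('a \<Rightarrow> complex) \<Rightarrow> ('a \<Rightarrow> complex) \<Rightarrow> complex" where
  "ip X f h = (\<Sum>x\<in>X. f x * cnj (h x))"

definition lin_sub :: "complex set \<Rightarrow> 'a set \<Rightarrow> ('a \<Rightarrow> complex) set \<Rightarrow> bool" where
  "lin_sub K X V \<longleftrightarrow> (\<forall>f\<in>V. \<forall>x. x \<notin> X \<longrightarrow> f x = 0) \<and> (\<lambda>x. 0) \<in> V \<and>
     (\<forall>f\<in>V. \<forall>h\<in>V. (\<lambda>x. f x + h x) \<in> V) \<and> (\<forall>c\<in>K. \<forall>f\<in>V. (\<lambda>x. c * f x) \<in> V)"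

definition orthonormal_family :: "'a set \<Rightarrow> nat \<Rightarrow> (nat \<Rightarrow> 'a \<Rightarrow> complex) \<Rightarrow> bool" where
  "orthonormal_family X m e \<longleftrightarrow> (\<forall>p<m. \<forall>q<m. ip X (e p) (e q) = (if p = q then 1 else 0))"

text \<open>Dimension is not a separate notion here: it is the length \<open>m\<close> of such a
  family, which \<open>onb_unique_card\<close> shows to be well defined.\<close>

definition onb :: "'a set \<Rightarrow> ('a \<Rightarrow> complex) set \<Rightarrow> nat \<Rightarrow> (nat \<Rightarrow> 'a \<Rightarrow> complex) \<Rightarrow> bool" where
  "onb X V m e \<longleftrightarrow> orthonormal_family X m e \<and> (\<forall>p<m. e p \<in> V) \<and>
     (\<forall>v\<in>V. v = (\<lambda>x. \<Sum>p<m. ip X v (e p) * e p x))"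

lemma lin_sub_support: "lin_sub K X V \<Longrightarrow> f \<in> V \<Longrightarrow> x \<notin> X \<Longrightarrow> f x = 0"
  by (auto simp: lin_sub_def)

lemma lin_sub_zero: "lin_sub K X V \<Longrightarrow> (\<lambda>x. 0) \<in> V"
  by (auto simp: lin_sub_def)

lemma lin_sub_add: "lin_sub K X V \<Longrightarrow> f \<in> V \<Longrightarrow> h \<in> V \<Longrightarrow> (\<lambda>x. f x + h x) \<in> V"
  by (auto simp: lin_sub_def)

lemma lin_sub_scale: "lin_sub K X V \<Longrightarrow> c \<in> K \<Longrightarrow> f \<in> V \<Longrightarrow> (\<lambda>x. c * f x) \<in> V"
  by (auto simp: lin_sub_def)

lemma lin_sub_sum:
  assumes V: "lin_sub K X V" and "\<And>i. i \<in> I \<Longrightarrow> c i \<in> K" "\<And>i. i \<in> I \<Longrightarrow> f i \<in> V"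
  shows "(\<lambda>x. \<Sum>i\<in>I. c i * f i x) \<in> V"
  using assms(2,3)
proof (induction I rule: infinite_finite_induct)
  case (insert i I)
  have "(\<lambda>x. c i * f i x + (\<Sum>i\<in>I. c i * f i x)) \<in> V"
    using insert by (intro lin_sub_add[OF V] lin_sub_scale[OF V]) auto
  then show ?case using insert.hyps by simp
qed (use lin_sub_zero[OF V] in simp_all)

lemma ip_add_left: "ip X (\<lambda>x. f x + h x) k = ip X f k + ip X h k"
  by (simp add: ip_def sum.distrib algebra_simps)

lemma ip_diff_left: "ip X (\<lambda>x. f x - h x) k = ip X f k - ip X h k"
  by (simp add: ip_def sum_subtractf algebra_simps)

lemma ip_scale_left: "ip X (\<lambda>x. c * f x) k = c * ip X f k"
  by (simp add: ip_def sum_distrib_left mult.assoc)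

lemma ip_sum_left: "ip X (\<lambda>x. \<Sum>i\<in>I. f i x) k = (\<Sum>i\<in>I. ip X (f i) k)"
  unfolding ip_def by (simp add: sum_distrib_right) (rule sum.swap)

lemma ip_cnj: "cnj (ip X f h) = ip X h f"
  by (simp add: ip_def mult.commute)

lemma ip_scale_right: "ip X f (\<lambda>x. c * h x) = cnj c * ip X f h"
  by (simp add: ip_def sum_distrib_left algebra_simps)

lemma ip_sum_right: "ip X k (\<lambda>x. \<Sum>i\<in>I. f i x) = (\<Sum>i\<in>I. ip X k (f i))"
  unfolding ip_def by (simp add: sum_distrib_left) (rule sum.swap)

lemma ip_diff_right: "ip X k (\<lambda>x. f x - h x) = ip X k f - ip X k h"
  by (simp add: ip_def sum_subtractf algebra_simps)

lemma ip_self: "ip X f f = of_real (\<Sum>x\<in>X. (cmod (f x))\<^sup>2)"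
  by (simp add: ip_def complex_norm_square del: of_real_power)

lemma ip_self_eq_0:
  assumes "finite X" "ip X f f = 0" "\<And>x. x \<notin> X \<Longrightarrow> f x = 0"
  shows "f = (\<lambda>x. 0)"
proof
  fix x
  have "(\<Sum>x\<in>X. (cmod (f x))\<^sup>2) = 0"
    using assms(2) unfolding ip_self by (simp only: of_real_eq_0_iff)
  then show "f x = 0"
    using assms(1,3) by (cases "x \<in> X") (auto simp: sum_nonneg_eq_0_iff)
qed

lemma orthonormal_familyD:
  "orthonormal_family X m e \<Longrightarrow> p < m \<Longrightarrow> q < m \<Longrightarrow> ip X (e p) (e q) = (if p = q then 1 else 0)"
  by (auto simp: orthonormal_family_def)

lemma orthonormal_family_norm:
  assumes "orthonormal_family X m e" "p < m"
  shows "(\<Sum>x\<in>X. (cmod (e p x))\<^sup>2) = 1"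
proof -
  have "complex_of_real (\<Sum>x\<in>X. (cmod (e p x))\<^sup>2) = of_real 1"
    using orthonormal_familyD[OF assms(1,2,2)] unfolding ip_self by simp
  then show ?thesis by (simp only: of_real_eq_iff)
qed

lemma orthonormal_family_combination:
  assumes "orthonormal_family X m e"
  shows "ip X (\<lambda>x. \<Sum>p<m. c p * e p x) (\<lambda>x. \<Sum>p<m. d p * e p x) = (\<Sum>p<m. c p * cnj (d p))"
proof -
  have "ip X (\<lambda>x. \<Sum>p<m. c p * e p x) (\<lambda>x. \<Sum>p<m. d p * e p x)
      = (\<Sum>p<m. \<Sum>q<m. c p * (cnj (d q) * (if p = q then 1 else 0)))"
    using orthonormal_familyD[OF assms]
    by (simp add: ip_sum_left ip_sum_right ip_scale_left ip_scale_right sum_distrib_left)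
  also have "\<dots> = (\<Sum>p<m. c p * cnj (d p))"
    by (intro sum.cong refl) (simp add: if_distrib[of "\<lambda>x. _ * x"] cong: if_cong)
  finally show ?thesis .
qed

lemma orthonormal_family_coeff:
  assumes e: "orthonormal_family X m e" and q: "q < m"
  shows "ip X (\<lambda>x. \<Sum>p<m. c p * e p x) (e q) = c q"
proof -
  have "ip X (\<lambda>x. \<Sum>p<m. c p * e p x) (e q) = (\<Sum>p<m. c p * (if p = q then 1 else 0))"
    using orthonormal_familyD[OF e _ q] by (simp add: ip_sum_left ip_scale_left)
  then show ?thesis using q by (simp add: if_distrib[of "\<lambda>x. _ * x"] cong: if_cong)
qed

lemma ip_combination_right:
  "ip X v (\<lambda>x. \<Sum>p<m. c p * e p x) = (\<Sum>p<m. cnj (c p) * ip X v (e p))"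
  by (simp add: ip_sum_right ip_scale_right)

text \<open>The Gram-Schmidt remainder: \<open>v\<close> minus its orthogonal projection to the span
  of the family.\<close>

definition residual :: "'a set \<Rightarrow> nat \<Rightarrow> (nat \<Rightarrow> 'a \<Rightarrow> complex) \<Rightarrow> ('a \<Rightarrow> complex) \<Rightarrow> 'a \<Rightarrow> complex" where
  "residual X m e v = (\<lambda>x. v x - (\<Sum>p<m. ip X v (e p) * e p x))"

lemma residual_orthogonal:
  assumes "orthonormal_family X m e" "q < m"
  shows "ip X (residual X m e v) (e q) = 0"
  unfolding residual_def ip_diff_left orthonormal_family_coeff[OF assms] by simp

lemma ip_residual_self:
  assumes e: "orthonormal_family X m e"
  shows "ip X (residual X m e v) (residual X m e v) = ip X v v - (\<Sum>p<m. of_real ((cmod (ip X v (e p)))\<^sup>2))"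
proof -
  have "ip X (residual X m e v) (residual X m e v) = ip X (residual X m e v) v"
    by (subst (2) residual_def)
      (simp add: ip_diff_right ip_combination_right residual_orthogonal[OF e])
  also have "\<dots> = ip X v v - (\<Sum>p<m. ip X v (e p) * ip X (e p) v)"
    by (simp add: residual_def ip_diff_left ip_sum_left ip_scale_left)
  also have "(\<Sum>p<m. ip X v (e p) * ip X (e p) v) = (\<Sum>p<m. of_real ((cmod (ip X v (e p)))\<^sup>2))"
    by (simp add: complex_norm_square ip_cnj del: of_real_power)
  finally show ?thesis .
qed

lemma bessel:
  assumes e: "orthonormal_family X m e"
  shows "(\<Sum>p<m. (cmod (ip X v (e p)))\<^sup>2) \<le> (\<Sum>x\<in>X. (cmod (v x))\<^sup>2)"
proof -
  have "complex_of_real (\<Sum>x\<in>X. (cmod (residual X m e v x))\<^sup>2)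
     = complex_of_real ((\<Sum>x\<in>X. (cmod (v x))\<^sup>2) - (\<Sum>p<m. (cmod (ip X v (e p)))\<^sup>2))"
    using ip_residual_self[OF e, of v] unfolding ip_self by simp
  then have "(\<Sum>x\<in>X. (cmod (residual X m e v x))\<^sup>2)
     = (\<Sum>x\<in>X. (cmod (v x))\<^sup>2) - (\<Sum>p<m. (cmod (ip X v (e p)))\<^sup>2)"
    by (simp only: of_real_eq_iff)
  moreover have "0 \<le> (\<Sum>x\<in>X. (cmod (residual X m e v x))\<^sup>2)" by (simp add: sum_nonneg)
  ultimately show ?thesis by linarith
qed

text \<open>Bessel's inequality for the point mass at x bounds the sum of |e_p(x)|^2 over p by 1;
  summing over x counts the family.\<close>

lemma orthonormal_family_card_le:
  assumes "finite X" and e: "orthonormal_family X m e"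
  shows "m \<le> card X"
proof -
  have *: "(\<Sum>p<m. (cmod (e p x))\<^sup>2) \<le> 1" if x: "x \<in> X" for x
  proof -
    define \<delta> :: "'a \<Rightarrow> complex" where "\<delta> y = (if y = x then 1 else 0)" for y
    have "ip X \<delta> (e p) = cnj (e p x)" for p
      using x assms(1) by (simp add: ip_def \<delta>_def if_distrib[of "\<lambda>x. x * _"] cong: if_cong)
    moreover have "(\<Sum>y\<in>X. (cmod (\<delta> y))\<^sup>2) = 1"
      using x assms(1) by (simp add: \<delta>_def if_distrib[of cmod] if_distrib[of "\<lambda>x. x\<^sup>2"] cong: if_cong)
    ultimately show ?thesis using bessel[OF e, of \<delta>] by simp
  qed
  have "real m = (\<Sum>p<m. \<Sum>x\<in>X. (cmod (e p x))\<^sup>2)"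
    using orthonormal_family_norm[OF e] by simp
  also have "\<dots> = (\<Sum>x\<in>X. \<Sum>p<m. (cmod (e p x))\<^sup>2)" by (rule sum.swap)
  also have "\<dots> \<le> (\<Sum>x\<in>X. 1)" using * by (intro sum_mono) auto
  finally show ?thesis by simp
qed

text \<open>\<open>K\<close> is not assumed closed under negation, and \<open>residual\<close>
  subtracts inner products; hence the minus sign in \<open>ip_K\<close>. The inclusion of the reals
  allows normalisation to unit length.\<close>

locale function_space =
  fixes X :: "'a set" and K :: "complex set" and V :: "('a \<Rightarrow> complex) set"
  assumes finite_X: "finite X" and lin: "lin_sub K X V" and reals: "\<real> \<subseteq> K"
    and ip_K: "\<And>v w. v \<in> V \<Longrightarrow> w \<in> V \<Longrightarrow> - ip X v w \<in> K"
begin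

lemma residual_in:
  assumes "\<And>p. p < m \<Longrightarrow> e p \<in> V" "v \<in> V"
  shows "residual X m e v \<in> V"
proof -
  have "(\<lambda>x. v x + (\<Sum>p<m. (- ip X v (e p)) * e p x)) \<in> V"
    using assms by (intro lin_sub_add[OF lin] lin_sub_sum[OF lin] ip_K) auto
  then show ?thesis by (simp add: residual_def sum_negf)
qed

text \<open>A nonzero residual, normalised, would extend the family inside \<open>V\<close>.\<close>

lemma onb_of_maximal:
  assumes e: "orthonormal_family X m e" "\<And>p. p < m \<Longrightarrow> e p \<in> V"
    and max: "\<And>e'. orthonormal_family X (Suc m) e' \<Longrightarrow> \<exists>p\<le>m. e' p \<notin> V"
  shows "onb X V m e"
proof -
  have "residual X m e v = (\<lambda>x. 0)" if v: "v \<in> V" for v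
  proof (rule ccontr)
    let ?r = "residual X m e v"
    assume nonzero: "?r \<noteq> (\<lambda>x. 0)"
    have rV: "?r \<in> V" using e(2) v by (rule residual_in[of m e v])
    have "?r x = 0" if "x \<notin> X" for x
      by (rule lin_sub_support[OF lin rV that])
    then have nz: "ip X ?r ?r \<noteq> 0"
      using nonzero ip_self_eq_0[OF finite_X, of ?r] by blast
    define n where "n = (\<Sum>x\<in>X. (cmod (?r x))\<^sup>2)"
    have n: "ip X ?r ?r = of_real n" "n \<ge> 0" "n \<noteq> 0"
      unfolding n_def using nz ip_self[of X ?r] by (force intro: sum_nonneg)+
    define e' where "e' p = (if p < m then e p else (\<lambda>x. of_real (1 / sqrt n) * ?r x))" for p
    have last: "ip X (e' p) (e' m) = 0" "ip X (e' m) (e' p) = 0" if "p < m" for p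
    proof -
      have "ip X ?r (e p) = 0" by (rule residual_orthogonal[OF e(1) that])
      then have "ip X (e p) ?r = 0" "ip X ?r (e p) = 0" using ip_cnj[of X ?r "e p"] by auto
      then show "ip X (e' p) (e' m) = 0" "ip X (e' m) (e' p) = 0"
        using that unfolding e'_def by (simp_all add: ip_scale_right ip_scale_left del: of_real_divide)
    qed
    have norm: "ip X (e' m) (e' m) = 1"
    proof -
      have "ip X (e' m) (e' m) = complex_of_real (1 / sqrt n) * (of_real (1 / sqrt n) * of_real n)"
        unfolding e'_def by (simp add: ip_scale_right ip_scale_left n(1) del: of_real_divide)
      also have "\<dots> = of_real (1 / sqrt n * (1 / sqrt n * n))"
        by (simp only: of_real_mult)
      also have "1 / sqrt n * (1 / sqrt n * n) = 1"
        using n real_sqrt_mult_self[of n] by (simp add: field_simps del: real_sqrt_mult_self)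
      finally show ?thesis by simp
    qed
    have old: "ip X (e' p) (e' q) = (if p = q then 1 else 0)" if "p < m" "q < m" for p q
      using that orthonormal_familyD[OF e(1) that] by (simp add: e'_def)
    have "orthonormal_family X (Suc m) e'"
      unfolding orthonormal_family_def less_Suc_eq using last norm old by auto
    moreover have "e' p \<in> V" if "p \<le> m" for p
    proof (cases "p < m")
      case False
      have "complex_of_real (1 / sqrt n) \<in> K" using reals by auto
      then show ?thesis
        unfolding e'_def using False lin_sub_scale[OF lin _ rV] by (simp del: of_real_divide)
    qed (use e(2) in \<open>simp add: e'_def\<close>)
    ultimately show False using max[of e'] by blast
  qed
  note res0 = this
  have "v x = (\<Sum>p<m. ip X v (e p) * e p x)" if "v \<in> V" for v x
    using fun_cong[OF res0[OF that], of x] by (simp add: residual_def)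
  then show ?thesis
    unfolding onb_def using e by (intro conjI allI impI ballI ext) auto
qed

lemma ex_onb: "\<exists>m e. onb X V m e"
proof -
  let ?P = "\<lambda>m. \<exists>e. orthonormal_family X m e \<and> (\<forall>p<m. e p \<in> V)"
  have "?P 0" by (auto simp: orthonormal_family_def)
  moreover have "\<forall>m. ?P m \<longrightarrow> m \<le> card X" using orthonormal_family_card_le[OF finite_X] by blast
  ultimately obtain m where m: "?P m" "\<And>k. ?P k \<Longrightarrow> k \<le> m"
    using ex_has_greatest_nat[of ?P 0 "\<lambda>m. m" "Suc (card X)"] by (auto simp: less_Suc_eq_le)
  then obtain e where "orthonormal_family X m e" "\<And>p. p < m \<Longrightarrow> e p \<in> V" by blast
  then have "onb X V m e"
    using m(2)[of "Suc m"] by (intro onb_of_maximal) (auto simp: less_Suc_eq_le)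
  then show ?thesis by blast
qed

text \<open>Double counting of the squared inner products between the two families: the expansion in
  \<open>e\<close> gives total k, and Bessel's inequality for \<open>e'\<close> bounds the total by
  m.\<close>

lemma orthonormal_family_le:
  assumes b: "onb X V m e" and e: "orthonormal_family X k e'" "\<And>p. p < k \<Longrightarrow> e' p \<in> V"
  shows "k \<le> m"
proof -
  have e1: "orthonormal_family X m e" using b by (simp add: onb_def)
  have "(\<Sum>x\<in>X. (cmod (e' q x))\<^sup>2) = (\<Sum>p<m. (cmod (ip X (e' q) (e p)))\<^sup>2)" if q: "q < k" for q
  proof -
    have "residual X m e (e' q) = (\<lambda>x. 0)"
      using b e(2)[OF q] by (auto simp: onb_def residual_def fun_eq_iff)
    then have "ip X (e' q) (e' q) = (\<Sum>p<m. of_real ((cmod (ip X (e' q) (e p)))\<^sup>2))"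
      using ip_residual_self[OF e1, of "e' q"] by (simp add: ip_def)
    then show ?thesis unfolding ip_self by (simp only: of_real_sum[symmetric] of_real_eq_iff)
  qed
  then have "real k = (\<Sum>q<k. \<Sum>p<m. (cmod (ip X (e' q) (e p)))\<^sup>2)"
    using orthonormal_family_norm[OF e(1)] by simp
  also have "\<dots> = (\<Sum>p<m. \<Sum>q<k. (cmod (ip X (e p) (e' q)))\<^sup>2)"
  proof -
    have "cmod (ip X (e' q) (e p)) = cmod (ip X (e p) (e' q))" for p q
      unfolding ip_cnj[of X "e' q" "e p", symmetric] by (rule complex_mod_cnj[symmetric])
    then show ?thesis by (subst sum.swap) simp
  qed
  also have "\<dots> \<le> (\<Sum>p<m. \<Sum>x\<in>X. (cmod (e p x))\<^sup>2)"
    by (intro sum_mono bessel[OF e(1)])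
  also have "\<dots> = (\<Sum>p<m. 1)"
    using orthonormal_family_norm[OF e1] by simp
  finally show ?thesis by simp
qed

text \<open>Spares the expansion clause for rotated and signed families: orthonormal, contained in
  \<open>V\<close> and of full length, they cannot be enlarged.\<close>

lemma onb_of_card:
  assumes b: "onb X V m e" and e: "orthonormal_family X m e'" "\<And>p. p < m \<Longrightarrow> e' p \<in> V"
  shows "onb X V m e'"
proof (rule onb_of_maximal[OF e])
  show "\<exists>p\<le>m. f p \<notin> V" if "orthonormal_family X (Suc m) f" for f
  proof (rule ccontr)
    assume "\<not> (\<exists>p\<le>m. f p \<notin> V)"
    then have "Suc m \<le> m" by (intro orthonormal_family_le[OF b that]) auto
    then show False by simp
  qed
qed

lemma onb_unique_card: "onb X V m e \<Longrightarrow> onb X V k e' \<Longrightarrow> m = k"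
  using orthonormal_family_le by (metis le_antisym onb_def)

end

section \<open>Balanced orthonormal bases\<close>

text \<open>
  Coordinates \<open>l\<close> and \<open>n + l\<close> are paired to a complex plane. For \<open>a < n\<close>, \<open>angle n a l\<close> is the argument of
  the \<open>(a, l)\<close> entry of the discrete Fourier transform of size \<open>n\<close>; row \<open>n + a\<close> is row \<open>a\<close> multiplied by \<open>\<i>\<close>.
\<close>

definition angle :: "nat \<Rightarrow> nat \<Rightarrow> nat \<Rightarrow> real" where
  "angle n a l = (if a < n then 2 * pi * real a * real l / real n
                  else 2 * pi * real (a - n) * real l / real n + pi / 2)"

text \<open>A geometric sum over powers of an n-th root of unity other than 1. The common phase
  \<gamma> factors out; it absorbs the quarter turns of the rows beyond n.\<close>

lemma sum_cis_eq_0: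
  fixes d :: int
  assumes n: "0 < n" and d: "d \<noteq> 0" "\<bar>d\<bar> < int n"
  shows "(\<Sum>l<n. cis (2 * pi * of_int d * real l / real n + \<gamma>)) = 0"
proof -
  define z where "z = cis (2 * pi * of_int d / real n)"
  have z1: "z \<noteq> 1"
  proof
    assume "z = 1"
    then have "cos (2 * pi * of_int d / real n) = 1" by (auto simp: z_def complex_eq_iff)
    then obtain k :: int where "2 * pi * of_int d / real n = of_int k * 2 * pi"
      by (auto simp: cos_one_2pi_int)
    then have "of_int d = (of_int k * of_int (int n) :: real)" using n by (simp add: field_simps)
    then have "d = k * int n" by (simp only: of_int_mult[symmetric] of_int_eq_iff)
    then show False using d by (cases "k = 0") (auto simp: abs_mult)
  qed
  have zn: "z ^ n = 1"
  proof -
    have "z ^ n = cis (real n * (2 * pi * of_int d / real n))"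
      by (simp only: z_def Complex.DeMoivre)
    also have "real n * (2 * pi * of_int d / real n) = 2 * pi * of_int d" using n by simp
    finally have "z ^ n = cis (2 * pi * of_int d)" .
    then show ?thesis by (simp add: cis_multiple_2pi)
  qed
  have "(\<Sum>l<n. cis (2 * pi * of_int d * real l / real n + \<gamma>)) = cis \<gamma> * (\<Sum>l<n. z ^ l)"
    by (simp add: sum_distrib_left z_def Complex.DeMoivre cis_mult add.commute mult.commute mult.left_commute)
  also have "(\<Sum>l<n. z ^ l) = 0"
    using geometric_sum[OF z1, of n] zn by simp
  finally show ?thesis by simp
qed

text \<open>For distinct frequencies the roots of unity cancel. Rows \<open>a\<close> and
  \<open>n + a\<close> share their frequency and differ by a quarter turn, whose cosine is
  0.\<close>

lemma sum_cos_angle_diff: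
  assumes n: "0 < n" and a: "a < 2 * n" and b: "b < 2 * n"
  shows "(\<Sum>l<n. cos (angle n a l - angle n b l)) = (if a = b then real n else 0)"
proof -
  define k where "k c = (if c < n then c else c - n)" for c
  define \<sigma> where "\<sigma> c = (if c < n then 0 else pi / 2)" for c
  have ang: "angle n c l = 2 * pi * real (k c) * real l / real n + \<sigma> c" for c l
    by (simp add: angle_def k_def \<sigma>_def)
  define d where "d = int (k a) - int (k b)"
  have diff: "angle n a l - angle n b l = 2 * pi * of_int d * real l / real n + (\<sigma> a - \<sigma> b)" for l
    using n by (simp add: ang d_def field_simps)
  show ?thesis
  proof (cases "d = 0")
    case True
    show ?thesis
    proof (cases "a = b")
      case False
      then have "cos (\<sigma> a - \<sigma> b) = 0"
        using True a b by (auto simp: d_def k_def \<sigma>_def split: if_splits)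
      then show ?thesis using True False by (simp add: diff)
    qed simp
  next
    case False
    have "\<bar>d\<bar> < int n" using a b by (auto simp: d_def k_def)
    from sum_cis_eq_0[OF n False this, of "\<sigma> a - \<sigma> b"]
    have "Re (\<Sum>l<n. cis (angle n a l - angle n b l)) = 0" by (simp add: diff)
    moreover have "a \<noteq> b" using False by (auto simp: d_def)
    ultimately show ?thesis by simp
  qed
qed

text \<open>A rotation by \<open>\<theta> l\<close> in the plane of \<open>e l\<close> and
  \<open>e (n + l)\<close>: the real counterpart of multiplying the l-th complex coordinate by a
  phase, so that real-valued functions stay real-valued.\<close>

definition rot :: "nat \<Rightarrow> (nat \<Rightarrow> real) \<Rightarrow> (nat \<Rightarrow> 'a \<Rightarrow> complex) \<Rightarrow> nat \<Rightarrow> 'a \<Rightarrow> complex" where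
  "rot n \<theta> e p = (\<lambda>x. if p < n
     then of_real (cos (\<theta> p)) * e p x + of_real (sin (\<theta> p)) * e (n + p) x
     else of_real (- sin (\<theta> (p - n))) * e (p - n) x + of_real (cos (\<theta> (p - n))) * e p x)"

lemma ip_plane:
  "ip X (\<lambda>x. of_real a * u x + of_real b * v x) (\<lambda>x. of_real c * y x + of_real d * z x)
   = of_real (a * c) * ip X u y + of_real (a * d) * ip X u z
     + of_real (b * c) * ip X v y + of_real (b * d) * ip X v z"
  by (simp add: ip_def sum.distrib sum_distrib_left algebra_simps)

lemma rot_orthonormal:
  assumes e: "orthonormal_family X (2 * n) e"
  shows "orthonormal_family X (2 * n) (rot n \<theta> e)"
proof -
  have o: "ip X (e p) (e q) = (if p = q then 1 else 0)" if "p < 2 * n" "q < 2 * n" for p q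
    by (rule orthonormal_familyD[OF e that])
  have sc: "cos t * cos t + sin t * sin t = 1" "sin t * sin t + cos t * cos t = 1" for t :: real
    using sin_cos_squared_add[of t] by (simp_all add: power2_eq_square)
  show ?thesis
    unfolding orthonormal_family_def
  proof (intro allI impI)
    fix p q assume pq: "p < 2 * n" "q < 2 * n"
    consider "p < n" "q < n" | "p < n" "\<not> q < n" | "\<not> p < n" "q < n" | "\<not> p < n" "\<not> q < n" by blast
    then show "ip X (rot n \<theta> e p) (rot n \<theta> e q) = (if p = q then 1 else 0)"
    proof cases
      case 1
      then show ?thesis
        unfolding rot_def using pq
        by (simp only: if_True ip_plane) (auto simp: o sc simp flip: of_real_mult of_real_add)
    next
      case 2
      then have "n \<le> q" by simp
      then show ?thesis
        unfolding rot_def using 2 pq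
        by (simp only: if_True if_False ip_plane) (auto simp: o sc simp flip: of_real_mult of_real_add)
    next
      case 3
      then have "n \<le> p" by simp
      then show ?thesis
        unfolding rot_def using 3 pq
        by (simp only: if_True if_False ip_plane) (auto simp: o sc simp flip: of_real_mult of_real_add)
    next
      case 4
      then have "n \<le> p" "n \<le> q" by simp_all
      then show ?thesis
        unfolding rot_def using 4 pq
        by (simp only: if_True if_False ip_plane) (auto simp: o sc simp flip: of_real_mult of_real_add)
    qed
  qed
qed

lemma sum_lessThan_double:
  fixes g :: "nat \<Rightarrow> 'b::comm_monoid_add"
  shows "(\<Sum>p<2 * n. g p) = (\<Sum>l<n. g l + g (n + l))"
proof -
  have "{..<2 * n} = {..<n} \<union> {n..<n + n}" by auto
  then have "(\<Sum>p<2 * n. g p) = sum g {..<n} + sum g {n..<n + n}"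
    by (simp add: sum.union_disjoint ivl_disj_int)
  also have "sum g {n..<n + n} = (\<Sum>l<n. g (n + l))"
    using sum.shift_bounds_nat_ivl[of g 0 n n] by (simp add: lessThan_atLeast0 add.commute)
  finally show ?thesis by (simp add: sum.distrib)
qed

text \<open>
  For all signs these vectors are orthonormal, and each of them is a normalised signed sum of an
  orthonormal basis of the same space. The latter makes the mean of a quadratic form over the
  signs equal to its normalised trace, although real flat orthogonal matrices need not exist.
\<close>

definition signed_rot ::
  "nat \<Rightarrow> (nat \<Rightarrow> real) \<Rightarrow> (nat \<Rightarrow> 'a \<Rightarrow> complex) \<Rightarrow> nat \<Rightarrow> 'a \<Rightarrow> complex" where
  "signed_rot n \<epsilon> e a = (\<lambda>x. \<Sum>p<2 * n. of_real (\<epsilon> p / sqrt (2 * real n)) * rot n (angle n a) e p x)"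

text \<open>In complex notation the l-th coordinate of vector a is (\<epsilon>_l + i
  \<epsilon>_(n+l)) exp (i angle_a(l)) / sqrt (2 n). The sign factor has squared modulus 2 whatever
  the signs are, so it drops out of inner products and leaves the cosine sums of
  \<open>sum_cos_angle_diff\<close>.\<close>

lemma signed_rot_orthonormal:
  assumes e: "orthonormal_family X (2 * n) e" and \<epsilon>: "\<And>p. \<epsilon> p = 1 \<or> \<epsilon> p = -1"
  shows "orthonormal_family X (2 * n) (signed_rot n \<epsilon> e)"
  unfolding orthonormal_family_def
proof (intro allI impI)
  fix a b assume ab: "a < 2 * n" "b < 2 * n"
  define r where "r = 1 / sqrt (2 * real n)"
  define c where "c a p = r * (if p < n
      then \<epsilon> p * cos (angle n a p) - \<epsilon> (n + p) * sin (angle n a p)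
      else \<epsilon> (p - n) * sin (angle n a (p - n)) + \<epsilon> p * cos (angle n a (p - n)))" for a p
  have w: "signed_rot n \<epsilon> e a = (\<lambda>x. \<Sum>p<2 * n. of_real (c a p) * e p x)" for a
    unfolding signed_rot_def sum_lessThan_double
    by (intro ext sum.cong refl) (simp add: rot_def c_def r_def divide_inverse algebra_simps)
  have \<epsilon>2: "\<epsilon> p * \<epsilon> p = 1" for p using \<epsilon>[of p] by auto
  have "c a l * c b l + c a (n + l) * c b (n + l)
      = r * r * ((\<epsilon> l * \<epsilon> l + \<epsilon> (n + l) * \<epsilon> (n + l)) * cos (angle n a l - angle n b l))" if "l < n" for l
    using that unfolding c_def cos_diff by (simp add: algebra_simps)
  then have "(\<Sum>p<2 * n. c a p * c b p) = r * r * (2 * (\<Sum>l<n. cos (angle n a l - angle n b l)))"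
    unfolding sum_lessThan_double by (simp add: \<epsilon>2 sum_distrib_left)
  also have "\<dots> = (if a = b then 1 else 0)"
    using ab by (simp add: sum_cos_angle_diff r_def)
  finally have "(\<Sum>p<2 * n. c a p * c b p) = (if a = b then 1 else 0)" .
  moreover have "ip X (signed_rot n \<epsilon> e a) (signed_rot n \<epsilon> e b) = of_real (\<Sum>p<2 * n. c a p * c b p)"
    unfolding w orthonormal_family_combination[OF e] by simp
  ultimately show "ip X (signed_rot n \<epsilon> e a) (signed_rot n \<epsilon> e b) = (if a = b then 1 else 0)" by simp
qed

text \<open>The quadratic form \<open>\<mu>\<^sub>\<phi>[f]\<close>, polarised; meaningful for real-valued arguments.\<close>

definition qform :: "'a set \<Rightarrow> ('a \<Rightarrow> real) \<Rightarrow> ('a \<Rightarrow> complex) \<Rightarrow> ('a \<Rightarrow> complex) \<Rightarrow> real" where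
  "qform X f v w = (\<Sum>x\<in>X. f x * Re (v x) * Re (w x))"

lemma qform_commute: "qform X f v w = qform X f w v"
  by (simp add: qform_def mult.commute mult.left_commute)

lemma qform_sum_left: "qform X f (\<lambda>x. \<Sum>i\<in>I. g i x) w = (\<Sum>i\<in>I. qform X f (g i) w)"
  unfolding qform_def by (simp add: sum_distrib_left sum_distrib_right) (rule sum.swap)

lemma qform_scale_left: "qform X f (\<lambda>x. of_real c * g x) w = c * qform X f g w"
  by (simp add: qform_def sum_distrib_left algebra_simps)

lemma qform_combination:
  "qform X f (\<lambda>x. \<Sum>p<m. of_real (c p) * e p x) (\<lambda>x. \<Sum>p<m. of_real (c p) * e p x)
   = (\<Sum>p<m. \<Sum>q<m. c p * c q * qform X f (e p) (e q))"
proof -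
  have "qform X f v (\<lambda>x. \<Sum>p<m. of_real (c p) * e p x) = (\<Sum>q<m. c q * qform X f v (e q))" for v
    by (subst (1 2) qform_commute) (simp add: qform_sum_left qform_scale_left)
  then show ?thesis
    by (simp add: qform_sum_left qform_scale_left sum_distrib_left mult.assoc)
qed

lemma qform_signs:
  assumes "0 < m"
  shows "real m * qform X f (\<lambda>x. \<Sum>p<m. of_real (\<epsilon> p / sqrt (real m)) * e p x)
       (\<lambda>x. \<Sum>p<m. of_real (\<epsilon> p / sqrt (real m)) * e p x)
   = (\<Sum>p<m. \<Sum>q<m. \<epsilon> p * \<epsilon> q * qform X f (e p) (e q))"
proof -
  have "\<epsilon> p / sqrt (real m) * (\<epsilon> q / sqrt (real m)) * c = \<epsilon> p * \<epsilon> q * c / real m" for p q c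
    using assms by (simp add: field_simps)
  then show ?thesis
    using assms unfolding qform_combination by (simp add: sum_divide_distrib[symmetric])
qed

text \<open>\<open>frobenius\<close> and \<open>trace\<close> are demanded of every orthonormal
  basis, because each signed vector is a signed sum over a differently rotated one. Through
  \<open>onb\<close>, \<open>m\<close> is the dimension of \<open>V\<close>.\<close>

locale real_function_space = function_space X \<real> V for X :: "'a set" and V +
  fixes J :: "'j set" and f :: "'j \<Rightarrow> 'a \<Rightarrow> real" and N T :: "'j \<Rightarrow> real" and m :: nat
  assumes finite_J: "finite J" and N_nonneg: "\<And>j. j \<in> J \<Longrightarrow> 0 \<le> N j"
    and frobenius: "\<And>j e. j \<in> J \<Longrightarrow> onb X V m e \<Longrightarrow>
      (\<Sum>p<m. \<Sum>q<m. (qform X (f j) (e p) (e q))\<^sup>2) \<le> (N j)\<^sup>2"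
    and trace: "\<And>j e. j \<in> J \<Longrightarrow> onb X V m e \<Longrightarrow> (\<Sum>p<m. qform X (f j) (e p) (e p)) = T j"
begin

text \<open>The forms are indexed by pairs (j, a): form (j, a) is the one of f_j written in the
  basis rotated by row a, and its value at the signs is m times the value at the a-th vector. This
  gives m |J| forms, all balanced by one choice of signs.\<close>

lemma even_basis:
  assumes m: "m = 2 * n" and e: "onb X V m e" and few: "4 * (real m * real (card J)) \<le> exp (s / 5)"
  shows "\<exists>w. onb X V m w \<and> (\<forall>j\<in>J. \<forall>a<m. \<bar>real m * qform X (f j) (w a) (w a) - T j\<bar> \<le> s * N j)"
proof (cases "n = 0")
  case True
  then show ?thesis using e m by auto
next
  case False
  let ?e = "\<lambda>a. rot n (angle n a) e"
  have eo: "orthonormal_family X (2 * n) e" and eV: "\<And>p. p < m \<Longrightarrow> e p \<in> V"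
    using e m by (auto simp: onb_def)
  have rotV: "rot n \<theta> e p \<in> V" if "p < m" for \<theta> p
    unfolding rot_def using that m
    by (cases "p < n") (auto intro!: lin_sub_add[OF lin] lin_sub_scale[OF lin] eV simp del: of_real_minus)
  have ro: "onb X V m (?e a)" for a
    using rotV rot_orthonormal[OF eo] m by (intro onb_of_card[OF e]) auto
  let ?F = "\<lambda>(j, a) p q. qform X (f j) (?e a p) (?e a q)"
  have "\<exists>\<epsilon> :: nat \<Rightarrow> real. (\<forall>p. \<epsilon> p = 1 \<or> \<epsilon> p = -1) \<and>
    (\<forall>i\<in>J \<times> {..<m}. \<bar>(\<Sum>p<m. \<Sum>q<m. \<epsilon> p * \<epsilon> q * ?F i p q) - (\<Sum>p<m. ?F i p p)\<bar> \<le> s * N (fst i))"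
  proof (rule sign_choice_deviation)
    show "?F i p q = ?F i q p" for i p q by (cases i) (simp add: qform_commute)
    show "(\<Sum>p<m. \<Sum>q<m. (?F i p q)\<^sup>2) \<le> (N (fst i))\<^sup>2" if "i \<in> J \<times> {..<m}" for i
      using that frobenius[OF _ ro] by (cases i) auto
    show "4 * real (card (J \<times> {..<m})) \<le> exp (s / 5)"
      using few by (simp add: card_cartesian_product mult.commute)
  qed (use finite_J N_nonneg in auto)
  then obtain \<epsilon> :: "nat \<Rightarrow> real" where \<epsilon>: "\<And>p. \<epsilon> p = 1 \<or> \<epsilon> p = -1"
    and dev: "\<And>j a. j \<in> J \<Longrightarrow> a < m \<Longrightarrow>
      \<bar>(\<Sum>p<m. \<Sum>q<m. \<epsilon> p * \<epsilon> q * qform X (f j) (?e a p) (?e a q)) - T j\<bar> \<le> s * N j"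
    using trace[OF _ ro] by fastforce
  have "signed_rot n \<epsilon> e a \<in> V" if "a < m" for a
    unfolding signed_rot_def using rotV m by (intro lin_sub_sum[OF lin]) auto
  then have "onb X V m (signed_rot n \<epsilon> e)"
    using signed_rot_orthonormal[OF eo \<epsilon>] m by (intro onb_of_card[OF e]) auto
  moreover have "real m * qform X (f j) (signed_rot n \<epsilon> e a) (signed_rot n \<epsilon> e a)
      = (\<Sum>p<m. \<Sum>q<m. \<epsilon> p * \<epsilon> q * qform X (f j) (?e a p) (?e a q))" for j a
    using qform_signs[of m X "f j" \<epsilon> "?e a"] False m unfolding signed_rot_def by simp
  ultimately show ?thesis using dev by (intro exI[of _ "signed_rot n \<epsilon> e"]) auto
qed

text \<open>A single vector has no orthogonality to respect, so signs on one fixed basis work in any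
  dimension.\<close>

lemma unit_vector:
  assumes m: "0 < m" and e: "onb X V m e" and few: "4 * real (card J) \<le> exp (s / 5)"
  shows "\<exists>u\<in>V. ip X u u = 1 \<and> (\<forall>j\<in>J. \<bar>real m * qform X (f j) u u - T j\<bar> \<le> s * N j)"
proof -
  have eo: "orthonormal_family X m e" and eV: "\<And>p. p < m \<Longrightarrow> e p \<in> V"
    using e by (auto simp: onb_def)
  have "\<exists>\<epsilon> :: nat \<Rightarrow> real. (\<forall>p. \<epsilon> p = 1 \<or> \<epsilon> p = -1) \<and>
    (\<forall>j\<in>J. \<bar>(\<Sum>p<m. \<Sum>q<m. \<epsilon> p * \<epsilon> q * qform X (f j) (e p) (e q)) - (\<Sum>p<m. qform X (f j) (e p) (e p))\<bar>
      \<le> s * N j)"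
    using finite_J N_nonneg frobenius[OF _ e] few
    by (intro sign_choice_deviation) (auto simp: qform_commute)
  then obtain \<epsilon> :: "nat \<Rightarrow> real" where \<epsilon>: "\<And>p. \<epsilon> p = 1 \<or> \<epsilon> p = -1"
    and dev: "\<And>j. j \<in> J \<Longrightarrow>
      \<bar>(\<Sum>p<m. \<Sum>q<m. \<epsilon> p * \<epsilon> q * qform X (f j) (e p) (e q)) - T j\<bar> \<le> s * N j"
    using trace[OF _ e] by fastforce
  define u where "u = (\<lambda>x. \<Sum>p<m. of_real (\<epsilon> p / sqrt (real m)) * e p x)"
  have "u \<in> V" unfolding u_def using eV by (intro lin_sub_sum[OF lin]) auto
  moreover have "ip X u u = 1"
  proof -
    have "\<epsilon> p / sqrt (real m) * (\<epsilon> p / sqrt (real m)) = 1 / real m" for p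
      using \<epsilon>[of p] m by auto
    then have "of_real (\<epsilon> p / sqrt (real m)) * cnj (of_real (\<epsilon> p / sqrt (real m))) = complex_of_real (1 / real m)" for p
      by (simp only: complex_cnj_complex_of_real of_real_mult[symmetric])
    then show ?thesis
      unfolding u_def orthonormal_family_combination[OF eo] using m by simp
  qed
  ultimately show ?thesis
    using dev qform_signs[OF m, of X _ \<epsilon> e] unfolding u_def by auto
qed

end

text \<open>Lets bounds on \<open>V\<close> descend to the complement of \<open>u\<close>, and
  determines the dimension of that complement.\<close>

lemma onb_append:
  assumes V: "function_space X \<real> V" and u: "u \<in> V" "ip X u u = 1"
    and e: "onb X {v \<in> V. ip X v u = 0} k e"
  shows "onb X V (Suc k) (\<lambda>p. if p < k then e p else u)"
proof -
  interpret function_space X \<real> V by fact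
  let ?e = "\<lambda>p. if p < k then e p else u"
  have eo: "orthonormal_family X k e" and eV: "e p \<in> V" and eu: "ip X (e p) u = 0" "ip X u (e p) = 0" if "p < k" for p
    using e that ip_cnj[of X "e p" u] by (auto simp: onb_def)
  have "orthonormal_family X (Suc k) ?e"
    unfolding orthonormal_family_def less_Suc_eq
    using eu u(2) orthonormal_familyD[OF eo] by auto
  moreover have "\<forall>p<Suc k. ?e p \<in> V" using eV u(1) by auto
  moreover have "v x = (\<Sum>p<Suc k. ip X v (?e p) * ?e p x)" if v: "v \<in> V" for v x
  proof -
    define c where "c = ip X v u"
    define r where "r = (\<lambda>x. v x + (- c) * u x)"
    have "r \<in> V"
      unfolding r_def c_def using v u by (intro lin_sub_add[OF lin] lin_sub_scale[OF lin] ip_K)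
    moreover have "ip X r u = 0"
      by (simp only: r_def ip_add_left ip_scale_left u(2) c_def[symmetric]) simp
    ultimately have "r = (\<lambda>x. \<Sum>p<k. ip X r (e p) * e p x)"
      using e by (simp add: onb_def)
    from fun_cong[OF this, of x] have "r x = (\<Sum>p<k. ip X r (e p) * e p x)" .
    also have "\<dots> = (\<Sum>p<k. ip X v (e p) * e p x)"
    proof (intro sum.cong refl)
      fix p assume "p \<in> {..<k}"
      then have "ip X r (e p) = ip X v (e p)"
        unfolding r_def ip_add_left ip_scale_left using eu by simp
      then show "ip X r (e p) * e p x = ip X v (e p) * e p x" by simp
    qed
    finally have "v x - ip X v u * u x = (\<Sum>p<k. ip X v (e p) * e p x)" by (simp add: r_def c_def)
    then show ?thesis by (simp add: diff_eq_eq)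
  qed
  ultimately show ?thesis unfolding onb_def by (intro conjI ballI ext)
qed

context real_function_space
begin

text \<open>In odd dimension one balanced vector is split off, and its complement is even-dimensional.\<close>

lemma odd_basis:
  assumes m: "m = Suc (2 * n)" and e: "onb X V m e" and few: "4 * (real m * real (card J)) \<le> exp (s / 5)"
  shows "\<exists>w. onb X V m w \<and> (\<forall>j\<in>J. \<forall>a<m. \<bar>real m * qform X (f j) (w a) (w a) - T j\<bar> \<le> 2 * s * N j)"
proof -
  have "1 * real (card J) \<le> real m * real (card J)" using m by (intro mult_right_mono) auto
  then have "4 * real (card J) \<le> exp (s / 5)" using few by linarith
  then obtain u where u: "u \<in> V" "ip X u u = 1"
    and udev: "\<And>j. j \<in> J \<Longrightarrow> \<bar>real m * qform X (f j) u u - T j\<bar> \<le> s * N j"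
    using unit_vector[OF _ e, of s] m by auto
  define W where "W = {v \<in> V. ip X v u = 0}"
  define ext where "ext e' = (\<lambda>p. if p < 2 * n then e' p else u)" for e' :: "nat \<Rightarrow> 'a \<Rightarrow> complex"
  interpret W: function_space X \<real> W
  proof
    show "lin_sub \<real> X W"
      using lin unfolding lin_sub_def W_def by (auto simp: ip_add_left ip_scale_left) (simp add: ip_def)
  qed (use finite_X ip_K in \<open>auto simp: W_def\<close>)
  have VX: "function_space X \<real> V" by unfold_locales
  obtain k e' where e': "onb X W k e'" using W.ex_onb by blast
  have "Suc k = m"
    using onb_unique_card[OF onb_append[OF VX u e'[unfolded W_def]] e] .
  then have k: "k = 2 * n" using m by simp
  have extb: "onb X V m (ext h)" if "onb X W (2 * n) h" for h
    unfolding ext_def m using that by (intro onb_append[OF VX u]) (simp add: W_def)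
  have ext: "ext h p = h p" if "p < 2 * n" for h p
    using that by (simp add: ext_def)
  have extu: "ext h (2 * n) = u" for h by (simp add: ext_def)
  \<comment> \<open>On the complement the form is a principal block of the form on \<open>V\<close>,
    so the Frobenius bound is inherited and the trace loses exactly the value at
    \<open>u\<close>.\<close>
  interpret W: real_function_space X W J f N "\<lambda>j. T j - qform X (f j) u u" "2 * n"
  proof
    fix j h assume j: "j \<in> J" and h: "onb X W (2 * n) h"
    have "(\<Sum>p<2 * n. \<Sum>q<2 * n. (qform X (f j) (h p) (h q))\<^sup>2)
        = (\<Sum>p<2 * n. \<Sum>q<2 * n. (qform X (f j) (ext h p) (ext h q))\<^sup>2)"
      by (simp add: ext)
    also have "\<dots> \<le> (\<Sum>p<2 * n. \<Sum>q<m. (qform X (f j) (ext h p) (ext h q))\<^sup>2)"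
      by (intro sum_mono sum_mono2) (auto simp: m)
    also have "\<dots> \<le> (\<Sum>p<m. \<Sum>q<m. (qform X (f j) (ext h p) (ext h q))\<^sup>2)"
      unfolding m by (intro sum_mono2 sum_nonneg) auto
    finally show "(\<Sum>p<2 * n. \<Sum>q<2 * n. (qform X (f j) (h p) (h q))\<^sup>2) \<le> (N j)\<^sup>2"
      using frobenius[OF j extb[OF h]] by linarith
    show "(\<Sum>p<2 * n. qform X (f j) (h p) (h p)) = T j - qform X (f j) u u"
      using trace[OF j extb[OF h]] by (simp add: m ext extu)
  qed (use finite_J N_nonneg in auto)
  have "real (2 * n) * real (card J) \<le> real m * real (card J)"
    by (intro mult_right_mono) (auto simp: m)
  then have "4 * (real (2 * n) * real (card J)) \<le> exp (s / 5)" using few by linarith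
  then obtain w where w: "onb X W (2 * n) w"
    and wdev: "\<And>j a. j \<in> J \<Longrightarrow> a < 2 * n \<Longrightarrow>
      \<bar>real (2 * n) * qform X (f j) (w a) (w a) - (T j - qform X (f j) u u)\<bar> \<le> s * N j"
    using W.even_basis[OF refl e'[unfolded k]] by blast
  have "\<bar>real m * qform X (f j) (ext w a) (ext w a) - T j\<bar> \<le> 2 * s * N j"
    if j: "j \<in> J" and a: "a < m" for j a
  proof (cases "a < 2 * n")
    case False
    then have "ext w a = u" by (simp add: ext_def)
    then show ?thesis using udev[OF j] by (simp add: abs_if split: if_splits)
  next
    case True
    define Q where "Q = qform X (f j) (w a) (w a)"
    define q where "q = qform X (f j) u u"
    define D where "D = s * N j"
    define M where "M = real (2 * n)"
    have M: "2 \<le> M" using True by (simp add: M_def)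
    have mM: "real m = M + 1" by (simp add: m M_def)
    have A: "\<bar>M * Q - (T j - q)\<bar> \<le> D" and B: "\<bar>(M + 1) * q - T j\<bar> \<le> D"
      using wdev[OF j True] udev[OF j] unfolding Q_def q_def D_def M_def[symmetric] mM by auto
    \<comment> \<open>Passes from normalisation by the dimension M of the complement to
      normalisation by M + 1. The error (M + 2) D is at most 2 M D because M >= 2; hence the factor
      2 in the conclusion.\<close>
    have "M * ((M + 1) * Q - T j) = (M + 1) * (M * Q - (T j - q)) - ((M + 1) * q - T j)"
      by (simp add: algebra_simps)
    then have "\<bar>M * ((M + 1) * Q - T j)\<bar> \<le> (M + 1) * \<bar>M * Q - (T j - q)\<bar> + \<bar>(M + 1) * q - T j\<bar>"
      using abs_triangle_ineq4[of "(M + 1) * (M * Q - (T j - q))" "(M + 1) * q - T j"] M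
      by (simp add: abs_mult)
    also have "\<dots> \<le> (M + 1) * D + D"
      using A B M by (intro add_mono mult_left_mono) auto
    also have "\<dots> \<le> M * (2 * D)"
    proof -
      have "0 \<le> (M - 2) * D" using M A by (intro mult_nonneg_nonneg) auto
      then show ?thesis by (simp add: algebra_simps)
    qed
    finally have "M * \<bar>(M + 1) * Q - T j\<bar> \<le> M * (2 * D)" using M by (simp add: abs_mult)
    then have "\<bar>(M + 1) * Q - T j\<bar> \<le> 2 * D" using M by simp
    then show ?thesis using True unfolding mM Q_def D_def by (simp add: ext)
  qed
  then show ?thesis using extb[OF w] by blast
qed

lemma balanced_basis:
  assumes e: "onb X V m e" and few: "4 * (real m * real (card J)) \<le> exp (s / 5)" and s: "0 \<le> s"
  shows "\<exists>w. onb X V m w \<and> (\<forall>j\<in>J. \<forall>a<m. \<bar>real m * qform X (f j) (w a) (w a) - T j\<bar> \<le> 2 * s * N j)"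
proof (cases "even m")
  case True
  then obtain n where "m = 2 * n" by (elim evenE)
  from even_basis[OF this e few] obtain w where w: "onb X V m w"
    and "\<forall>j\<in>J. \<forall>a<m. \<bar>real m * qform X (f j) (w a) (w a) - T j\<bar> \<le> s * N j" by blast
  moreover have "s * N j \<le> 2 * s * N j" if "j \<in> J" for j
    using N_nonneg[OF that] s by simp
  ultimately show ?thesis by (meson order_trans)
next
  case False
  then obtain n where "m = Suc (2 * n)" by (metis oddE Suc_eq_plus1)
  from odd_basis[OF this e few] show ?thesis .
qed

end

section \<open>Left-invariant spaces of functions\<close>

text \<open>Serves two families that are not visibly finite: the union of eigenbases over all
  complex numbers, and the matrix coefficients of the dual.\<close>

lemma finite_orthonormal_set:
  assumes X: "finite X" and B: "\<And>\<phi> \<psi>. \<phi> \<in> B \<Longrightarrow> \<psi> \<in> B \<Longrightarrow> ip X \<phi> \<psi> = (if \<phi> = \<psi> then 1 else 0)"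
  shows "finite B"
proof (rule ccontr)
  assume "infinite B"
  then obtain F where F: "F \<subseteq> B" "finite F" "card F = Suc (card X)"
    using infinite_arbitrarily_large by blast
  then obtain e where e: "bij_betw e {..<Suc (card X)} F"
    using ex_bij_betw_nat_finite[of F] by (auto simp: atLeast0LessThan)
  have "orthonormal_family X (Suc (card X)) e"
    unfolding orthonormal_family_def
  proof (intro allI impI)
    fix p q assume pq: "p < Suc (card X)" "q < Suc (card X)"
    have "e p \<in> B" "e q \<in> B" using e F(1) pq by (auto simp: bij_betw_def)
    moreover have "e p = e q \<longleftrightarrow> p = q" using e pq by (auto simp: bij_betw_def inj_on_def)
    ultimately show "ip X (e p) (e q) = (if p = q then 1 else 0)" using B by simp
  qed
  from orthonormal_family_card_le[OF X this] show False by simp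
qed

text \<open>With k the reproducing kernel, the left side is the sum over x, y of f(x) f(y) k(x,y)^2.
  The bound 2 f(x) f(y) <= f(x)^2 + f(y)^2 reduces it to row sums of k^2, and each row sum is k(x,x)
  = \<kappa> by orthonormality.\<close>

lemma frobenius_le_kernel:
  fixes r :: "nat \<Rightarrow> 'a \<Rightarrow> real"
  assumes o: "\<And>p q. p < m \<Longrightarrow> q < m \<Longrightarrow> (\<Sum>x\<in>X. r p x * r q x) = (if p = q then 1 else 0)"
    and \<kappa>: "\<And>x. x \<in> X \<Longrightarrow> (\<Sum>p<m. (r p x)\<^sup>2) = \<kappa>"
  shows "(\<Sum>p<m. \<Sum>q<m. (\<Sum>x\<in>X. f x * r p x * r q x)\<^sup>2) \<le> \<kappa> * (\<Sum>x\<in>X. (f x)\<^sup>2)"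
proof -
  define k where "k x y = (\<Sum>p<m. r p x * r p y)" for x y
  have ksym: "k x y = k y x" for x y by (simp add: k_def mult.commute)
  have ksq: "(k x y)\<^sup>2 = (\<Sum>p<m. \<Sum>q<m. (r p x * r q x) * (r p y * r q y))" for x y
    unfolding k_def power2_eq_square sum_product by (intro sum.cong refl) (simp add: mult_ac)
  have kk: "(\<Sum>y\<in>X. (k x y)\<^sup>2) = \<kappa>" if x: "x \<in> X" for x
  proof -
    have "(\<Sum>y\<in>X. (k x y)\<^sup>2) = (\<Sum>p<m. \<Sum>q<m. (r p x * r q x) * (\<Sum>y\<in>X. r p y * r q y))"
      unfolding ksq sum_distrib_left by (subst sum.swap, intro sum.cong refl, subst sum.swap, rule refl)
    also have "\<dots> = (\<Sum>p<m. \<Sum>q<m. if p = q then (r p x * r q x) else 0)"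
      by (intro sum.cong refl) (auto simp: o)
    also have "\<dots> = \<kappa>" using \<kappa>[OF x] by (simp add: power2_eq_square)
    finally show ?thesis .
  qed
  have "(\<Sum>p<m. \<Sum>q<m. (\<Sum>x\<in>X. f x * r p x * r q x)\<^sup>2)
      = (\<Sum>p<m. \<Sum>q<m. \<Sum>x\<in>X. \<Sum>y\<in>X. (f x * f y) * ((r p x * r q x) * (r p y * r q y)))"
    unfolding power2_eq_square sum_product by (intro sum.cong refl) (simp add: mult_ac)
  also have "\<dots> = (\<Sum>x\<in>X. \<Sum>y\<in>X. \<Sum>p<m. \<Sum>q<m. (f x * f y) * ((r p x * r q x) * (r p y * r q y)))"
    by (subst (2) sum.swap, subst sum.swap, subst (3) sum.swap, subst (2) sum.swap, rule refl)
  also have "\<dots> = (\<Sum>x\<in>X. \<Sum>y\<in>X. (f x * f y) * (k x y)\<^sup>2)"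
    unfolding ksq sum_distrib_left by simp
  also have "\<dots> \<le> (\<Sum>x\<in>X. \<Sum>y\<in>X. ((f x)\<^sup>2 / 2 + (f y)\<^sup>2 / 2) * (k x y)\<^sup>2)"
  proof (intro sum_mono mult_right_mono)
    show "f x * f y \<le> (f x)\<^sup>2 / 2 + (f y)\<^sup>2 / 2" for x y
      using sum_squares_bound[of "f x" "f y"] by simp
  qed simp
  also have "\<dots> = (\<Sum>x\<in>X. (f x)\<^sup>2 / 2 * (\<Sum>y\<in>X. (k x y)\<^sup>2)) + (\<Sum>x\<in>X. \<Sum>y\<in>X. (f y)\<^sup>2 / 2 * (k y x)\<^sup>2)"
    by (simp add: distrib_right sum.distrib sum_distrib_left ksym)
  also have "(\<Sum>x\<in>X. \<Sum>y\<in>X. (f y)\<^sup>2 / 2 * (k y x)\<^sup>2) = (\<Sum>x\<in>X. (f x)\<^sup>2 / 2 * (\<Sum>y\<in>X. (k x y)\<^sup>2))"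
    unfolding sum_distrib_left by (rule sum.swap)
  also have "(\<Sum>x\<in>X. (f x)\<^sup>2 / 2 * (\<Sum>y\<in>X. (k x y)\<^sup>2)) = (\<Sum>x\<in>X. (f x)\<^sup>2 / 2 * \<kappa>)"
    using kk by (intro sum.cong) auto
  also have "\<dots> + \<dots> = \<kappa> * (\<Sum>x\<in>X. (f x)\<^sup>2)"
    by (simp add: sum_distrib_left sum.distrib[symmetric] mult.commute)
  finally show ?thesis .
qed

section \<open>Translations, reproducing kernels and real points on a finite group\<close>

locale fin_group = group G for G (structure) +
  assumes fin: "finite (carrier G)"
begin

abbreviation "X \<equiv> carrier G"

definition ltrans :: "'a \<Rightarrow> ('a \<Rightarrow> complex) \<Rightarrow> 'a \<Rightarrow> complex" where
  "ltrans x v = (\<lambda>g. if g \<in> X then v (inv x \<otimes> g) else 0)"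

definition left_inv_sub :: "('a \<Rightarrow> complex) set \<Rightarrow> bool" where
  "left_inv_sub E \<longleftrightarrow> lin_sub UNIV X E \<and> (\<forall>x\<in>X. \<forall>v\<in>E. ltrans x v \<in> E)"

lemma sum_left_mult:
  assumes "x \<in> X"
  shows "(\<Sum>g\<in>X. F (x \<otimes> g)) = (\<Sum>g\<in>X. F g)"
proof (rule sum.reindex_bij_witness[of _ "\<lambda>g. inv x \<otimes> g" "\<lambda>g. x \<otimes> g"])
qed (use assms in \<open>auto simp: m_assoc[symmetric]\<close>)

lemma sum_right_mult:
  assumes "x \<in> X"
  shows "(\<Sum>g\<in>X. F (g \<otimes> x)) = (\<Sum>g\<in>X. F g)"
proof (rule sum.reindex_bij_witness[of _ "\<lambda>g. g \<otimes> inv x" "\<lambda>g. g \<otimes> x"])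
qed (use assms in \<open>auto simp: m_assoc\<close>)

lemma ip_ltrans:
  assumes x: "x \<in> X"
  shows "ip X (ltrans x v) w = ip X v (ltrans (inv x) w)"
proof -
  have "ip X (ltrans x v) w = (\<Sum>g\<in>X. v (inv x \<otimes> g) * cnj (w (x \<otimes> (inv x \<otimes> g))))"
    unfolding ip_def ltrans_def using x by (intro sum.cong) (auto simp: m_assoc[symmetric])
  also have "\<dots> = (\<Sum>g\<in>X. v g * cnj (w (x \<otimes> g)))"
    using sum_left_mult[of "inv x" "\<lambda>g. v g * cnj (w (x \<otimes> g))"] x by simp
  also have "\<dots> = ip X v (ltrans (inv x) w)"
    unfolding ip_def ltrans_def using x by simp
  finally show ?thesis .
qed

lemma ltrans_mult:
  assumes "x \<in> X" "y \<in> X"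
  shows "ltrans (x \<otimes> y) v = ltrans x (ltrans y v)"
  using assms by (auto simp: ltrans_def inv_mult_group m_assoc)

lemma ltrans_one: "(\<And>g. g \<notin> X \<Longrightarrow> v g = 0) \<Longrightarrow> ltrans \<one> v = v"
  by (auto simp: ltrans_def)

lemma ip_ltrans_ltrans:
  assumes "x \<in> X" "\<And>g. g \<notin> X \<Longrightarrow> w g = 0"
  shows "ip X (ltrans x v) (ltrans x w) = ip X v w"
  using assms by (simp add: ip_ltrans ltrans_mult[symmetric] ltrans_one)

lemma ltrans_combination: "ltrans x (\<lambda>g. \<Sum>p\<in>I. c p * e p g) = (\<lambda>g. \<Sum>p\<in>I. c p * ltrans x (e p) g)"
  by (auto simp: ltrans_def)

text \<open>The reproducing kernel of a left-invariant space is left-invariant, so its diagonal is constant.\<close>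

lemma sum_onb_square:
  assumes E: "left_inv_sub E" and e: "onb X E m e" and g: "g \<in> X"
  shows "(\<Sum>p<m. (cmod (e p g))\<^sup>2) = real m / real (order G)"
proof -
  have lin: "lin_sub UNIV X E" using E by (simp add: left_inv_sub_def)
  define k where "k h = (\<lambda>x. \<Sum>p<m. cnj (e p h) * e p x)" for h
  have kE: "k h \<in> E" for h
    unfolding k_def using e by (intro lin_sub_sum[OF lin]) (auto simp: onb_def)
  have rep: "ip X v (k h) = v h" if "v \<in> E" for v h
  proof -
    have "ip X v (k h) = (\<Sum>p<m. ip X v (e p) * e p h)"
      unfolding k_def ip_combination_right by (simp add: mult.commute)
    moreover have "v = (\<lambda>x. \<Sum>p<m. ip X v (e p) * e p x)" using e that by (simp add: onb_def)
    ultimately show ?thesis by (simp add: fun_eq_iff)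
  qed
  have kdiag: "k h h = of_real (\<Sum>p<m. (cmod (e p h))\<^sup>2)" for h
    by (simp add: k_def complex_norm_square mult.commute del: of_real_power)
  have const: "k g g = k \<one> \<one>" if g: "g \<in> X" for g
  proof -
    have tE: "ltrans g (k \<one>) \<in> E" using E g kE by (simp add: left_inv_sub_def)
    \<comment> \<open>Both \<open>ltrans g (k \<one>)\<close> and \<open>k g\<close> represent
      evaluation at \<open>g\<close> on \<open>E\<close>. Their difference therefore is orthogonal
      to all of \<open>E\<close>, in particular to itself.\<close>
    define d where "d = (\<lambda>x. ltrans g (k \<one>) x + (-1) * k g x)"
    have dE: "d \<in> E"
      unfolding d_def by (intro lin_sub_add[OF lin] tE lin_sub_scale[OF lin] kE) simp
    have d': "d = (\<lambda>x. ltrans g (k \<one>) x - k g x)" by (simp add: d_def)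
    have iE: "ltrans (inv g) d \<in> E" using E g dE by (simp add: left_inv_sub_def)
    have "ip X d (ltrans g (k \<one>)) = ip X (ltrans (inv g) d) (k \<one>)"
      using ip_ltrans[of "inv g" d "k \<one>"] g by simp
    also have "\<dots> = d g" using rep[OF iE] g by (simp add: ltrans_def)
    finally have "ip X d d = 0"
      using rep[OF dE, of g] by (subst (2) d') (simp add: ip_diff_right)
    then have "d = (\<lambda>x. 0)"
      by (rule ip_self_eq_0[OF fin _ lin_sub_support[OF lin dE]])
    from fun_cong[OF this, of g] have "ltrans g (k \<one>) g = k g g" by (simp add: d')
    then show ?thesis using g by (simp add: ltrans_def)
  qed
  define S where "S h = (\<Sum>p<m. (cmod (e p h))\<^sup>2)" for h
  have SS: "S h = S \<one>" if "h \<in> X" for h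
    using const[OF that] unfolding kdiag S_def by (simp only: of_real_eq_iff)
  have "real m = (\<Sum>p<m. \<Sum>x\<in>X. (cmod (e p x))\<^sup>2)"
    using orthonormal_family_norm[of X m e] e by (simp add: onb_def)
  also have "\<dots> = (\<Sum>x\<in>X. S x)" unfolding S_def by (rule sum.swap)
  also have "\<dots> = (\<Sum>x\<in>X. S g)" by (intro sum.cong refl) (metis SS g)
  also have "\<dots> = real (order G) * S g" by (simp add: order_def)
  finally have "real m = real (order G) * S g" .
  moreover have "order G > 0" using order_gt_0_iff_finite fin by blast
  ultimately show ?thesis by (simp add: S_def[symmetric] field_simps)
qed

definition real_part :: "('a \<Rightarrow> complex) set \<Rightarrow> ('a \<Rightarrow> complex) set" where
  "real_part E = {v \<in> E. \<forall>x. v x \<in> \<real>}"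

lemma ip_real: "(\<And>x. v x \<in> \<real>) \<Longrightarrow> (\<And>x. w x \<in> \<real>) \<Longrightarrow> ip X v w \<in> \<real>"
  by (auto simp: ip_def Reals_cnj_iff)

lemma real_part_space:
  assumes "lin_sub UNIV X E"
  shows "function_space X \<real> (real_part E)"
proof
  show "lin_sub \<real> X (real_part E)"
    using assms unfolding lin_sub_def real_part_def by auto
qed (use fin ip_real in \<open>auto simp: real_part_def\<close>)

text \<open>Real and imaginary parts of a member of \<open>E\<close> are combinations of it and its
  conjugate, so they lie in the real part of \<open>E\<close> and can be expanded there.\<close>

lemma onb_real_part:
  assumes lin: "lin_sub UNIV X E" and cnjE: "\<And>v. v \<in> E \<Longrightarrow> (\<lambda>x. cnj (v x)) \<in> E"
    and e: "onb X (real_part E) m e"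
  shows "onb X E m e"
  unfolding onb_def
proof (intro conjI ballI ext)
  show "orthonormal_family X m e" "\<forall>p<m. e p \<in> E" using e by (auto simp: onb_def real_part_def)
  fix v g assume v: "v \<in> E"
  define a where "a = (\<lambda>x. (1/2) * v x + (1/2) * cnj (v x))"
  define b where "b = (\<lambda>x. (- \<i> / 2) * v x + (\<i> / 2) * cnj (v x))"
  have "a \<in> E" "b \<in> E"
    unfolding a_def b_def by (intro lin_sub_add[OF lin] lin_sub_scale[OF lin] cnjE v UNIV_I)+
  moreover have "a x = of_real (Re (v x))" "b x = of_real (Im (v x))" for x
    by (auto simp: a_def b_def complex_eq_iff)
  ultimately have "a \<in> real_part E" "b \<in> real_part E" by (auto simp: real_part_def)
  moreover have "h g = (\<Sum>p<m. ip X h (e p) * e p g)" if "h \<in> real_part E" for h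
  proof -
    have "h = (\<lambda>x. \<Sum>p<m. ip X h (e p) * e p x)" using e that unfolding onb_def by blast
    from fun_cong[OF this, of g] show ?thesis .
  qed
  ultimately have ab: "a g = (\<Sum>p<m. ip X a (e p) * e p g)" "b g = (\<Sum>p<m. ip X b (e p) * e p g)"
    by blast+
  have vab: "v = (\<lambda>x. a x + \<i> * b x)" by (auto simp: a_def b_def complex_eq_iff)
  have "v g = (\<Sum>p<m. ip X a (e p) * e p g) + \<i> * (\<Sum>p<m. ip X b (e p) * e p g)"
    using ab by (subst vab) simp
  also have "\<dots> = (\<Sum>p<m. (ip X a (e p) + \<i> * ip X b (e p)) * e p g)"
    by (simp add: sum_distrib_left sum.distrib distrib_right mult.assoc)
  also have "\<dots> = (\<Sum>p<m. ip X v (e p) * e p g)"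
    by (subst vab) (simp only: ip_add_left ip_scale_left)
  finally show "v g = (\<Sum>p<m. ip X v (e p) * e p g)" .
qed

theorem balanced_basis_left_invariant:
  fixes f :: "'j \<Rightarrow> 'a \<Rightarrow> real"
  assumes E: "left_inv_sub E" and cnjE: "\<And>v. v \<in> E \<Longrightarrow> (\<lambda>x. cnj (v x)) \<in> E"
    and e: "onb X (real_part E) m e" and J: "finite J" and t: "0 < t"
    and few: "4 * (real m * real (card J)) \<le> exp (t * sqrt (real m) / 10)"
  shows "\<exists>w. onb X (real_part E) m w \<and> (\<forall>j\<in>J. \<forall>a<m.
    \<bar>qform X (f j) (w a) (w a) - (\<Sum>x\<in>X. f j x) / real (order G)\<bar>
      \<le> t * (sqrt (\<Sum>x\<in>X. (f j x)\<^sup>2) / sqrt (real (order G))))"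
proof -
  have lin: "lin_sub UNIV X E" using E by (simp add: left_inv_sub_def)
  interpret R: function_space X \<real> "real_part E" by (rule real_part_space[OF lin])
  define \<kappa> where "\<kappa> = real m / real (order G)"
  have re: "(\<Sum>p<m. (Re (h p x))\<^sup>2) = \<kappa>" if h: "onb X (real_part E) m h" and x: "x \<in> X" for h x
  proof -
    have "h p x \<in> \<real>" if "p < m" for p using h that by (auto simp: onb_def real_part_def)
    then have "(Re (h p x))\<^sup>2 = (cmod (h p x))\<^sup>2" if "p < m" for p
      using that by (simp add: cmod_power2 complex_is_Real_iff)
    then show ?thesis
      using sum_onb_square[OF E onb_real_part[OF lin cnjE h] x] by (simp add: \<kappa>_def)
  qed
  interpret R: real_function_space X "real_part E" J f
    "\<lambda>j. sqrt \<kappa> * sqrt (\<Sum>x\<in>X. (f j x)\<^sup>2)" "\<lambda>j. \<kappa> * (\<Sum>x\<in>X. f j x)" m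
  proof
    show "finite J" by fact
    show "0 \<le> sqrt \<kappa> * sqrt (\<Sum>x\<in>X. (f j x)\<^sup>2)" for j
      by (simp add: \<kappa>_def sum_nonneg)
    fix j h assume h: "onb X (real_part E) m h"
    have "(\<Sum>x\<in>X. Re (h p x) * Re (h q x)) = (if p = q then 1 else 0)" if "p < m" "q < m" for p q
    proof -
      have "h p x \<in> \<real>" "h q x \<in> \<real>" for x using h that by (auto simp: onb_def real_part_def)
      then have "Re (ip X (h p) (h q)) = (\<Sum>x\<in>X. Re (h p x) * Re (h q x))"
        by (simp add: ip_def complex_is_Real_iff)
      moreover have "ip X (h p) (h q) = (if p = q then 1 else 0)"
        using h that by (auto simp: onb_def orthonormal_family_def)
      ultimately show ?thesis by (metis one_complex.sel(1) zero_complex.sel(1))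
    qed
    from frobenius_le_kernel[where r = "\<lambda>p x. Re (h p x)" and f = "f j", OF this re[OF h]]
    show "(\<Sum>p<m. \<Sum>q<m. (qform X (f j) (h p) (h q))\<^sup>2) \<le> (sqrt \<kappa> * sqrt (\<Sum>x\<in>X. (f j x)\<^sup>2))\<^sup>2"
      by (simp add: qform_def power_mult_distrib \<kappa>_def sum_nonneg)
    have "(\<Sum>p<m. qform X (f j) (h p) (h p)) = (\<Sum>x\<in>X. f j x * (\<Sum>p<m. (Re (h p x))\<^sup>2))"
      unfolding qform_def by (subst sum.swap) (simp add: sum_distrib_left power2_eq_square mult.assoc)
    also have "\<dots> = \<kappa> * (\<Sum>x\<in>X. f j x)"
      using re[OF h] by (simp add: sum_distrib_left mult.commute)
    finally show "(\<Sum>p<m. qform X (f j) (h p) (h p)) = \<kappa> * (\<Sum>x\<in>X. f j x)" .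
  qed
  \<comment> \<open>\<open>balanced_basis\<close> loses a factor 2, so half of t sqrt m is
    available; s / 5 is then the exponent t sqrt m / 10 of \<open>few\<close>. The remaining factor
    is sqrt m * sqrt \<kappa> = m / sqrt |G|.\<close>
  define s where "s = t * sqrt (real m) / 2"
  have "0 \<le> s" "4 * (real m * real (card J)) \<le> exp (s / 5)" using t few by (auto simp: s_def)
  from R.balanced_basis[OF e this(2,1)] obtain w where w: "onb X (real_part E) m w"
    and dev: "\<And>j a. j \<in> J \<Longrightarrow> a < m \<Longrightarrow> \<bar>real m * qform X (f j) (w a) (w a) - \<kappa> * (\<Sum>x\<in>X. f j x)\<bar>
       \<le> 2 * s * (sqrt \<kappa> * sqrt (\<Sum>x\<in>X. (f j x)\<^sup>2))" by blast
  have "\<bar>qform X (f j) (w a) (w a) - (\<Sum>x\<in>X. f j x) / real (order G)\<bar>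
      \<le> t * (sqrt (\<Sum>x\<in>X. (f j x)\<^sup>2) / sqrt (real (order G)))" if j: "j \<in> J" and a: "a < m" for j a
  proof -
    have m0: "0 < real m" using a by simp
    have "real m * \<bar>qform X (f j) (w a) (w a) - (\<Sum>x\<in>X. f j x) / real (order G)\<bar>
        = \<bar>real m * qform X (f j) (w a) (w a) - \<kappa> * (\<Sum>x\<in>X. f j x)\<bar>"
    proof -
      have "real m * \<bar>y\<bar> = \<bar>real m * y\<bar>" for y by (simp add: abs_mult)
      then show ?thesis by (simp add: \<kappa>_def right_diff_distrib)
    qed
    also have "\<dots> \<le> 2 * s * (sqrt \<kappa> * sqrt (\<Sum>x\<in>X. (f j x)\<^sup>2))" by (rule dev[OF j a])
    also have "\<dots> = real m * (t * (sqrt (\<Sum>x\<in>X. (f j x)\<^sup>2) / sqrt (real (order G))))"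
    proof -
      have "sqrt (real m) * sqrt \<kappa> = real m / sqrt (real (order G))"
        by (simp add: \<kappa>_def real_sqrt_divide)
      then have "2 * s * sqrt \<kappa> = t * (real m / sqrt (real (order G)))"
        by (simp add: s_def mult.assoc)
      then show ?thesis by (simp add: mult.assoc[symmetric])
    qed
    finally show ?thesis using m0 by (simp only: mult_le_cancel_left_pos)
  qed
  then show ?thesis using w by blast
qed

end

section \<open>Eigenspaces of Cayley graphs\<close>

text \<open>
  The matrix of an operator preserving \<open>V\<close> in an orthonormal basis of \<open>V\<close> has an eigenvector by
  the fundamental theorem of algebra.
\<close>

lemma eigenvector_exists:
  assumes X: "finite X" and V: "lin_sub UNIV X V" and v: "v \<in> V" "v \<noteq> (\<lambda>x. 0)"
    and T: "\<And>v. v \<in> V \<Longrightarrow> T v \<in> V"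
    and T_lin: "\<And>(I::nat set) c e x. finite I \<Longrightarrow> T (\<lambda>x. \<Sum>p\<in>I. c p * e p x) x = (\<Sum>p\<in>I. c p * T (e p) x)"
  shows "\<exists>w\<in>V. \<exists>\<nu>. w \<noteq> (\<lambda>x. 0) \<and> (\<forall>x. T w x = \<nu> * w x)"
proof -
  interpret function_space X UNIV V using X V by unfold_locales auto
  obtain m e where e: "onb X V m e" using ex_onb by blast
  have eo: "orthonormal_family X m e" and eV: "\<And>p. p < m \<Longrightarrow> e p \<in> V"
    and ex: "\<And>v. v \<in> V \<Longrightarrow> v = (\<lambda>x. \<Sum>p<m. ip X v (e p) * e p x)"
    using e unfolding onb_def by blast+
  have m: "0 < m"
  proof (rule ccontr)
    assume "\<not> 0 < m"
    then have "(\<lambda>x. \<Sum>p<m. ip X v (e p) * e p x) = (\<lambda>x. 0)" by simp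
    then have "v = (\<lambda>x. 0)" by (rule trans[OF ex[OF v(1)]])
    then show False using v(2) by blast
  qed
  define A where "A = mat m m (\<lambda>(p, q). ip X (T (e q)) (e p))"
  have A: "A \<in> carrier_mat m m" by (simp add: A_def)
  obtain \<nu> where "eigenvalue A \<nu>" using spectrum_non_empty[OF A m] by (auto simp: spectrum_def)
  then obtain c where c: "c \<in> carrier_vec m" "c \<noteq> 0\<^sub>v m" "A *\<^sub>v c = \<nu> \<cdot>\<^sub>v c"
    using A by (auto simp: eigenvalue_def eigenvector_def)
  define w where "w = (\<lambda>x. \<Sum>q<m. vec_index c q * e q x)"
  have wV: "w \<in> V" unfolding w_def by (intro lin_sub_sum[OF V] eV) auto
  have wc: "ip X w (e q) = vec_index c q" if "q < m" for q
    unfolding w_def by (rule orthonormal_family_coeff[OF eo that])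
  have "w \<noteq> (\<lambda>x. 0)"
  proof
    assume "w = (\<lambda>x. 0)"
    then have "vec_index c q = 0" if "q < m" for q using wc[OF that] by (simp add: ip_def)
    then have "c = 0\<^sub>v m" using c(1) by (intro eq_vecI) auto
    then show False using c(2) by simp
  qed
  moreover have "T w x = \<nu> * w x" for x
  proof -
    have Ac: "(\<Sum>q<m. vec_index c q * ip X (T (e q)) (e p)) = \<nu> * vec_index c p" if p: "p < m" for p
    proof -
      have "(\<Sum>q<m. vec_index c q * ip X (T (e q)) (e p)) = vec_index (A *\<^sub>v c) p"
        using p c(1) by (simp add: A_def scalar_prod_def atLeast0LessThan mult.commute)
      then show ?thesis using c p by simp
    qed
    have "T w x = (\<Sum>q<m. vec_index c q * T (e q) x)" unfolding w_def by (rule T_lin) simp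
    also have "\<dots> = (\<Sum>q<m. vec_index c q * (\<Sum>p<m. ip X (T (e q)) (e p) * e p x))"
    proof (intro sum.cong refl)
      fix q assume "q \<in> {..<m}"
      then have "T (e q) \<in> V" using T eV by auto
      from fun_cong[OF ex[OF this], of x]
      show "vec_index c q * T (e q) x = vec_index c q * (\<Sum>p<m. ip X (T (e q)) (e p) * e p x)"
        by (rule arg_cong)
    qed
    also have "\<dots> = (\<Sum>p<m. (\<Sum>q<m. vec_index c q * ip X (T (e q)) (e p)) * e p x)"
      unfolding sum_distrib_left sum_distrib_right by (subst sum.swap) (simp add: mult.assoc)
    also have "\<dots> = \<nu> * w x"
      using Ac by (simp add: w_def sum_distrib_left mult.assoc)
    finally show ?thesis .
  qed
  ultimately show ?thesis using wV by blast
qed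

locale cayley = fin_group G for G (structure) +
  fixes S :: "'a set"
  assumes S: "S \<subseteq> carrier G" and S_inv: "set_inv S = S"
begin

lemma inv_S: "s \<in> S \<Longrightarrow> inv s \<in> S"
  using S_inv unfolding SET_INV_def by blast

definition adj :: "('a \<Rightarrow> complex) \<Rightarrow> 'a \<Rightarrow> complex" where
  "adj v = (\<lambda>g. if g \<in> X then \<Sum>s\<in>S. v (g \<otimes> s) else 0)"

text \<open>The zero sum expresses orthogonality to the constants, so for \<nu> = |S| only the other
  eigenfunctions remain. If no eigenfunction of this kind exists for \<nu>, the space is
  {0}.\<close>

definition eigsp :: "complex \<Rightarrow> ('a \<Rightarrow> complex) set" where
  "eigsp \<nu> = {v. (\<forall>x. x \<notin> X \<longrightarrow> v x = 0) \<and> adj v = (\<lambda>x. \<nu> * v x) \<and> (\<Sum>g\<in>X. v g) = 0}"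

text \<open>Adjacency multiplies by generators on the right, so it commutes with left translations,
  which also preserve sums over the group.\<close>

lemma eigsp_left_inv: "left_inv_sub (eigsp \<nu>)"
proof -
  have "adj (\<lambda>x. f x + h x) = (\<lambda>x. adj f x + adj h x)" "adj (\<lambda>x. c * f x) = (\<lambda>x. c * adj f x)"
    for f h c
    by (auto simp: adj_def sum.distrib sum_distrib_left)
  then have "lin_sub UNIV X (eigsp \<nu>)"
    unfolding lin_sub_def eigsp_def
    by (auto simp: sum.distrib sum_distrib_left[symmetric] algebra_simps) (simp add: adj_def fun_eq_iff)
  moreover have "ltrans x v \<in> eigsp \<nu>" if x: "x \<in> X" and v: "v \<in> eigsp \<nu>" for x v
  proof -
    have "adj (ltrans x v) g = \<nu> * ltrans x v g" for g
    proof (cases "g \<in> X")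
      case True
      then have "adj (ltrans x v) g = adj v (inv x \<otimes> g)"
        unfolding adj_def ltrans_def using x S by (auto intro!: sum.cong simp: m_assoc)
      also have "\<dots> = \<nu> * v (inv x \<otimes> g)" using v by (simp add: eigsp_def)
      finally show ?thesis using True by (simp add: ltrans_def)
    qed (simp add: adj_def ltrans_def)
    moreover have "(\<Sum>g\<in>X. ltrans x v g) = 0"
      using sum_left_mult[of "inv x" v] v x by (simp add: ltrans_def eigsp_def)
    ultimately show ?thesis by (auto simp: eigsp_def ltrans_def)
  qed
  ultimately show ?thesis by (simp add: left_inv_sub_def)
qed

lemma eigsp_lin: "lin_sub UNIV X (eigsp \<nu>)"
  using eigsp_left_inv by (simp add: left_inv_sub_def)

text \<open>Right translation by s has right translation by inv s as its adjoint, and inversion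
  permutes \<open>S\<close>.\<close>

lemma ip_adj: "ip X (adj v) w = ip X v (adj w)"
proof -
  have "ip X (adj v) w = (\<Sum>s\<in>S. \<Sum>g\<in>X. v (g \<otimes> s) * cnj (w g))"
    unfolding ip_def adj_def by (simp add: sum_distrib_right) (rule sum.swap)
  also have "\<dots> = (\<Sum>s\<in>S. \<Sum>g\<in>X. v g * cnj (w (g \<otimes> inv s)))"
  proof (rule sum.cong[OF refl])
    fix s assume s: "s \<in> S"
    then have sX: "s \<in> X" using S by blast
    have "(\<Sum>g\<in>X. v (g \<otimes> s) * cnj (w g)) = (\<Sum>g\<in>X. v (g \<otimes> s) * cnj (w (g \<otimes> s \<otimes> inv s)))"
      using sX by (intro sum.cong) (auto simp: m_assoc)
    also have "\<dots> = (\<Sum>g\<in>X. v g * cnj (w (g \<otimes> inv s)))"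
      using sum_right_mult[OF sX, of "\<lambda>g. v g * cnj (w (g \<otimes> inv s))"] by simp
    finally show "(\<Sum>g\<in>X. v (g \<otimes> s) * cnj (w g)) = (\<Sum>g\<in>X. v g * cnj (w (g \<otimes> inv s)))" .
  qed
  also have "\<dots> = (\<Sum>s\<in>S. \<Sum>g\<in>X. v g * cnj (w (g \<otimes> s)))"
    by (rule sum.reindex_bij_witness[of _ "\<lambda>s. inv s" "\<lambda>s. inv s"]) (use S inv_S in auto)
  also have "\<dots> = ip X v (adj w)"
    unfolding ip_def adj_def by (simp add: sum_distrib_left) (rule sum.swap)
  finally show ?thesis .
qed

lemma eigsp_real:
  assumes v: "v \<in> eigsp \<nu>" "v \<noteq> (\<lambda>x. 0)"
  shows "\<nu> \<in> \<real>"
proof -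
  have a: "adj v = (\<lambda>x. \<nu> * v x)" and supp: "\<And>x. x \<notin> X \<Longrightarrow> v x = 0" using v(1) by (auto simp: eigsp_def)
  have "\<nu> * ip X v v = cnj \<nu> * ip X v v"
    using ip_adj[of v v] unfolding a by (simp add: ip_scale_left ip_scale_right)
  moreover have "ip X v v \<noteq> 0" using ip_self_eq_0[OF fin, of v] supp v(2) by auto
  ultimately show ?thesis by (simp add: Reals_cnj_iff)
qed

lemma eigsp_cnj:
  assumes "\<nu> \<in> \<real>" "v \<in> eigsp \<nu>"
  shows "(\<lambda>x. cnj (v x)) \<in> eigsp \<nu>"
proof -
  have a: "adj v = (\<lambda>x. \<nu> * v x)" and z: "(\<Sum>g\<in>X. v g) = 0" using assms(2) by (auto simp: eigsp_def)
  have "adj (\<lambda>x. cnj (v x)) x = cnj (adj v x)" for x by (simp add: adj_def)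
  then have "adj (\<lambda>x. cnj (v x)) = (\<lambda>x. \<nu> * cnj (v x))"
    using assms(1) by (simp add: a Reals_cnj_iff fun_eq_iff)
  moreover have "(\<Sum>g\<in>X. cnj (v g)) = 0" using arg_cong[OF z, of cnj] by simp
  ultimately show ?thesis using assms(2) by (simp add: eigsp_def)
qed

lemma eigsp_orthogonal:
  assumes v: "v \<in> eigsp \<nu>" "v \<noteq> (\<lambda>x. 0)" and w: "w \<in> eigsp \<mu>" "w \<noteq> (\<lambda>x. 0)" and "\<nu> \<noteq> \<mu>"
  shows "ip X v w = 0"
proof -
  have "adj v = (\<lambda>x. \<nu> * v x)" "adj w = (\<lambda>x. \<mu> * w x)" using v w by (auto simp: eigsp_def)
  then have "\<nu> * ip X v w = cnj \<mu> * ip X v w"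
    using ip_adj[of v w] by (simp add: ip_scale_left ip_scale_right)
  moreover have "cnj \<mu> = \<mu>" using eigsp_real[OF w] by (simp add: Reals_cnj_iff)
  ultimately show ?thesis using \<open>\<nu> \<noteq> \<mu>\<close> by simp
qed

definition const_fun :: "'a \<Rightarrow> complex" where
  "const_fun = (\<lambda>x. if x \<in> X then of_real (1 / sqrt (real (order G))) else 0)"

lemma order_pos: "0 < real (order G)"
  using order_gt_0_iff_finite fin by simp

lemma ip_const_fun: "ip X v const_fun = of_real (1 / sqrt (real (order G))) * (\<Sum>g\<in>X. v g)"
  unfolding ip_def sum_distrib_left by (intro sum.cong refl) (simp add: const_fun_def)

lemma ip_const_fun_self: "ip X const_fun const_fun = 1"
proof -
  have "ip X const_fun const_fun
      = of_real (1 / sqrt (real (order G))) * (\<Sum>g\<in>X. of_real (1 / sqrt (real (order G))))"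
    unfolding ip_const_fun by (simp add: const_fun_def)
  also have "\<dots> = of_real (1 / sqrt (real (order G)) * (real (order G) * (1 / sqrt (real (order G)))))"
    by (simp only: sum_constant of_real_mult order_def of_real_of_nat_eq)
  also have "1 / sqrt (real (order G)) * (real (order G) * (1 / sqrt (real (order G)))) = 1"
    using order_pos by (simp add: field_simps)
  finally show ?thesis by simp
qed

lemma adj_const_fun: "adj const_fun = (\<lambda>x. of_nat (card S) * const_fun x)"
  using S by (auto simp: adj_def const_fun_def fun_eq_iff subset_iff)

text \<open>Completeness: the complement \<open>R\<close> of \<open>B\<close> is stable under
  \<open>adj\<close>, which is self-adjoint with all members of \<open>B\<close> as eigenfunctions.
  An eigenvector in \<open>R\<close> would be orthogonal to the constants, hence lie in some
  \<open>eigsp \<nu>\<close>, and its expansion in \<open>w \<nu>\<close> would make it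
  zero.\<close>

theorem ex_eigenbasis:
  assumes w: "\<And>\<nu>. eigsp \<nu> \<noteq> {\<lambda>x. 0} \<Longrightarrow> onb X (real_part (eigsp \<nu>)) (m \<nu>) (w \<nu>)"
  defines "B \<equiv> insert const_fun (\<Union>\<nu>\<in>{\<nu>. eigsp \<nu> \<noteq> {\<lambda>x. 0}}. w \<nu> ` {..<m \<nu>})"
  shows "finite B" and "\<And>\<phi> \<psi>. \<phi> \<in> B \<Longrightarrow> \<psi> \<in> B \<Longrightarrow> ip X \<phi> \<psi> = (if \<phi> = \<psi> then 1 else 0)"
    and "\<And>v. (\<And>x. x \<notin> X \<Longrightarrow> v x = 0) \<Longrightarrow> v = (\<lambda>x. \<Sum>\<phi>\<in>B. ip X v \<phi> * \<phi> x)"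
    and "\<And>\<phi>. \<phi> \<in> B \<Longrightarrow> (\<forall>x. \<phi> x \<in> \<real>) \<and> (\<forall>x. x \<notin> X \<longrightarrow> \<phi> x = 0) \<and> (\<exists>\<nu>. adj \<phi> = (\<lambda>x. \<nu> * \<phi> x))"
proof -
  have wE: "w \<nu> p \<in> eigsp \<nu>" "\<forall>x. w \<nu> p x \<in> \<real>" if "eigsp \<nu> \<noteq> {\<lambda>x. 0}" "p < m \<nu>" for \<nu> p
    using w that by (auto simp: onb_def real_part_def)
  have wo: "ip X (w \<nu> p) (w \<nu> q) = (if p = q then 1 else 0)"
    if "eigsp \<nu> \<noteq> {\<lambda>x. 0}" "p < m \<nu>" "q < m \<nu>" for \<nu> p q
    using w[OF that(1)] that by (auto simp: onb_def orthonormal_family_def)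
  have w0: "w \<nu> p \<noteq> (\<lambda>x. 0)" if "eigsp \<nu> \<noteq> {\<lambda>x. 0}" "p < m \<nu>" for \<nu> p
    using wo[OF that that(2)] by (auto simp: ip_def)
  have wc: "ip X (w \<nu> p) const_fun = 0" "ip X const_fun (w \<nu> p) = 0" if "eigsp \<nu> \<noteq> {\<lambda>x. 0}" "p < m \<nu>" for \<nu> p
  proof -
    show "ip X (w \<nu> p) const_fun = 0" using wE[OF that] by (simp add: ip_const_fun eigsp_def)
    then show "ip X const_fun (w \<nu> p) = 0" using ip_cnj[of X "w \<nu> p" const_fun] by simp
  qed
  have ww: "ip X (w \<nu> p) (w \<mu> q) = (if w \<nu> p = w \<mu> q then 1 else 0)"
    if *: "eigsp \<nu> \<noteq> {\<lambda>x. 0}" "p < m \<nu>" "eigsp \<mu> \<noteq> {\<lambda>x. 0}" "q < m \<mu>" for \<nu> \<mu> p q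
  proof (cases "w \<nu> p = w \<mu> q")
    case True
    then show ?thesis using wo[OF *(1,2,2)] by simp
  next
    case False
    show ?thesis
    proof (cases "\<nu> = \<mu>")
      case True
      then show ?thesis using False wo[OF *(1,2)] * by auto
    next
      case ne: False
      then show ?thesis using False eigsp_orthogonal[OF wE(1) w0 wE(1) w0 ne] * by simp
    qed
  qed
  show orth: "ip X \<phi> \<psi> = (if \<phi> = \<psi> then 1 else 0)" if "\<phi> \<in> B" "\<psi> \<in> B" for \<phi> \<psi>
  proof -
    have c: "w \<nu> p \<noteq> const_fun" if "eigsp \<nu> \<noteq> {\<lambda>x. 0}" "p < m \<nu>" for \<nu> p
      using wc[OF that] ip_const_fun_self by auto
    have B_cases: "\<theta> = const_fun \<or> (\<exists>\<nu> p. eigsp \<nu> \<noteq> {\<lambda>x. 0} \<and> p < m \<nu> \<and> \<theta> = w \<nu> p)" if "\<theta> \<in> B" for \<theta>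
      using that by (auto simp: B_def)
    from B_cases[OF that(1)] B_cases[OF that(2)] show ?thesis
    proof (elim disjE exE conjE)
      fix \<nu> p \<mu> q
      assume *: "eigsp \<nu> \<noteq> {\<lambda>x. 0}" "p < m \<nu>" "\<phi> = w \<nu> p" "eigsp \<mu> \<noteq> {\<lambda>x. 0}" "q < m \<mu>" "\<psi> = w \<mu> q"
      show ?thesis unfolding *(3,6) by (rule ww[OF *(1,2,4,5)])
    next
      fix \<nu> p
      assume *: "\<phi> = const_fun" "eigsp \<nu> \<noteq> {\<lambda>x. 0}" "p < m \<nu>" "\<psi> = w \<nu> p"
      show ?thesis unfolding *(1,4) using wc(2)[OF *(2,3)] c[OF *(2,3)] by presburger
    next
      fix \<nu> p
      assume *: "\<psi> = const_fun" "eigsp \<nu> \<noteq> {\<lambda>x. 0}" "p < m \<nu>" "\<phi> = w \<nu> p"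
      show ?thesis unfolding *(1,4) using wc(1)[OF *(2,3)] c[OF *(2,3)] by presburger
    qed (simp add: ip_const_fun_self)
  qed
  \<comment> \<open>The union in \<open>B\<close> runs over all complex \<nu>; finiteness comes from
    orthonormality rather than from counting eigenvalues.\<close>
  show finB: "finite B" by (rule finite_orthonormal_set[OF fin orth])
  show props: "(\<forall>x. \<phi> x \<in> \<real>) \<and> (\<forall>x. x \<notin> X \<longrightarrow> \<phi> x = 0) \<and> (\<exists>\<nu>. adj \<phi> = (\<lambda>x. \<nu> * \<phi> x))" if \<phi>: "\<phi> \<in> B" for \<phi>
  proof (cases "\<phi> = const_fun")
    case True
    have "\<exists>\<nu>. adj const_fun = (\<lambda>x. \<nu> * const_fun x)" using adj_const_fun by blast
    then show ?thesis using True by (simp add: const_fun_def)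
  next
    case False
    then obtain \<nu> p where "eigsp \<nu> \<noteq> {\<lambda>x. 0}" "p < m \<nu>" "\<phi> = w \<nu> p" using \<phi> by (auto simp: B_def)
    then show ?thesis using wE[of \<nu> p] by (auto simp: eigsp_def)
  qed
  define R where "R = {v. (\<forall>x. x \<notin> X \<longrightarrow> v x = 0) \<and> (\<forall>\<phi>\<in>B. ip X v \<phi> = 0)}"
  have R: "lin_sub UNIV X R"
    unfolding lin_sub_def R_def by (auto simp: ip_add_left ip_scale_left) (simp add: ip_def)
  have R0: "v = (\<lambda>x. 0)" if "v \<in> R" for v
  proof (rule ccontr)
    assume "v \<noteq> (\<lambda>x. 0)"
    moreover have "adj v \<in> R" if "v \<in> R" for v
    proof -
      have "ip X (adj v) \<phi> = 0" if \<phi>: "\<phi> \<in> B" for \<phi>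
      proof -
        obtain \<nu> where "adj \<phi> = (\<lambda>x. \<nu> * \<phi> x)" using props[OF \<phi>] by blast
        then show ?thesis using \<open>v \<in> R\<close> \<phi> unfolding ip_adj by (simp add: ip_scale_right R_def)
      qed
      then show ?thesis by (auto simp: R_def adj_def)
    qed
    moreover have "adj (\<lambda>x. \<Sum>p\<in>I. c p * e p x) x = (\<Sum>p\<in>I. c p * adj (e p) x)"
      if "finite I" for I :: "nat set" and c e x
      unfolding adj_def by (simp add: sum_distrib_left) (rule impI, rule sum.swap)
    ultimately obtain u \<nu> where u: "u \<in> R" "u \<noteq> (\<lambda>x. 0)" "\<And>x. adj u x = \<nu> * u x"
      using eigenvector_exists[OF fin R \<open>v \<in> R\<close>, of adj] by blast
    have "ip X u const_fun = 0" using u(1) by (simp add: R_def B_def)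
    then have "(\<Sum>g\<in>X. u g) = 0" using order_pos by (simp add: ip_const_fun)
    then have uE: "u \<in> eigsp \<nu>" using u by (auto simp: eigsp_def R_def)
    then have E: "eigsp \<nu> \<noteq> {\<lambda>x. 0}" using u(2) by auto
    have "onb X (eigsp \<nu>) (m \<nu>) (w \<nu>)"
      by (rule onb_real_part[OF eigsp_lin eigsp_cnj[OF eigsp_real[OF uE u(2)]] w[OF E]])
    then have "u = (\<lambda>x. \<Sum>p<m \<nu>. ip X u (w \<nu> p) * w \<nu> p x)" using uE unfolding onb_def by blast
    also have "\<dots> = (\<lambda>x. 0)"
    proof -
      have "ip X u (w \<nu> p) = 0" if "p < m \<nu>" for p using u(1) E that by (auto simp: R_def B_def)
      then show ?thesis by simp
    qed
    finally show False using u(2) by simp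
  qed
  show "v = (\<lambda>x. \<Sum>\<phi>\<in>B. ip X v \<phi> * \<phi> x)" if supp: "\<And>x. x \<notin> X \<Longrightarrow> v x = 0" for v
  proof -
    define r where "r = (\<lambda>x. v x - (\<Sum>\<phi>\<in>B. ip X v \<phi> * \<phi> x))"
    have "ip X r \<psi> = 0" if \<psi>: "\<psi> \<in> B" for \<psi>
    proof -
      have "ip X r \<psi> = ip X v \<psi> - (\<Sum>\<phi>\<in>B. ip X v \<phi> * ip X \<phi> \<psi>)"
        by (simp only: r_def ip_diff_left ip_sum_left ip_scale_left)
      also have "(\<Sum>\<phi>\<in>B. ip X v \<phi> * ip X \<phi> \<psi>) = (\<Sum>\<phi>\<in>B. if \<phi> = \<psi> then ip X v \<phi> else 0)"
        by (intro sum.cong refl) (simp add: orth \<psi>)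
      also have "\<dots> = ip X v \<psi>" using finB \<psi> by simp
      finally show ?thesis by simp
    qed
    moreover have "r x = 0" if "x \<notin> X" for x
      using supp[OF that] props that by (simp add: r_def)
    ultimately have "r = (\<lambda>x. 0)" by (intro R0) (simp add: R_def)
    then show ?thesis by (simp add: r_def fun_eq_iff)
  qed
qed

end

section \<open>Irreducible representations\<close>

lemma subspace_vecI:
  fixes W :: "'k::field vec set"
  assumes "W \<subseteq> carrier_vec n" "0\<^sub>v n \<in> W" "\<And>v w. v \<in> W \<Longrightarrow> w \<in> W \<Longrightarrow> v + w \<in> W"
    and "\<And>a v. v \<in> W \<Longrightarrow> a \<cdot>\<^sub>v v \<in> W"
  shows "VectorSpace.subspace class_ring W (module_vec TYPE('k) n)"
proof -
  have m: "Module.module class_ring (module_vec TYPE('k) n)"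
    using vec_vs unfolding vectorspace_def by blast
  show ?thesis
    unfolding VectorSpace.subspace_def submodule_def
    using assms vec_vs m by (auto simp: module_vec_simps)
qed

lemma subspace_vecD:
  fixes W :: "'k::field vec set"
  assumes "VectorSpace.subspace class_ring W (module_vec TYPE('k) n)"
  shows "W \<subseteq> carrier_vec n" "0\<^sub>v n \<in> W" "\<And>v w. v \<in> W \<Longrightarrow> w \<in> W \<Longrightarrow> v + w \<in> W"
    and "\<And>a v. v \<in> W \<Longrightarrow> a \<cdot>\<^sub>v v \<in> W"
  using assms unfolding VectorSpace.subspace_def submodule_def by (auto simp: module_vec_simps class_ring_simps)

lemma index_mat_adjoint:
  assumes "A \<in> carrier_mat n n" "i < n" "j < n"
  shows "mat_adjoint A $$ (i, j) = conjugate (A $$ (j, i))"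
  using assms by (simp add: mat_adjoint_def mat_of_rows_index)

lemma mat_adjoint_carrier: "A \<in> carrier_mat n n \<Longrightarrow> mat_adjoint A \<in> carrier_mat n n"
  by (auto simp: mat_adjoint_def mat_of_rows_def)

lemma mult_mat_unit_vec:
  fixes A :: "complex mat"
  assumes "A \<in> carrier_mat n m" "j < m"
  shows "A *\<^sub>v unit_vec m j = col A j"
  using assms
  by (intro eq_vecI) (auto simp: scalar_prod_def unit_vec_def if_distrib[of "\<lambda>x. _ * x"] cong: if_cong)

lemma mult_mat_zero_vec:
  assumes "A \<in> carrier_mat n m"
  shows "A *\<^sub>v 0\<^sub>v m = 0\<^sub>v n"
  using assms by (intro eq_vecI) auto

text \<open>T R and R T have the same trace, and these traces are n and m.\<close>

lemma two_sided_inverse_square: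
  fixes T :: "complex mat"
  assumes T: "T \<in> carrier_mat n m" and R: "R \<in> carrier_mat m n"
    and TR: "T * R = 1\<^sub>m n" and RT: "R * T = 1\<^sub>m m"
  shows "m = n"
proof -
  have "(\<Sum>i<n. \<Sum>j<m. T $$ (i, j) * R $$ (j, i)) = of_nat n"
  proof -
    have "(\<Sum>j<m. T $$ (i, j) * R $$ (j, i)) = (T * R) $$ (i, i)" if "i < n" for i
      using T R that by (simp add: scalar_prod_def atLeast0LessThan)
    then show ?thesis by (simp add: TR)
  qed
  moreover have "(\<Sum>j<m. \<Sum>i<n. T $$ (i, j) * R $$ (j, i)) = of_nat m"
  proof -
    have "(\<Sum>i<n. T $$ (i, j) * R $$ (j, i)) = (R * T) $$ (j, j)" if "j < m" for j
      using T R that by (simp add: scalar_prod_def atLeast0LessThan mult.commute)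
    then show ?thesis by (simp add: RT)
  qed
  ultimately have "complex_of_nat n = of_nat m"
    using sum.swap[of "\<lambda>i j. T $$ (i, j) * R $$ (j, i)" "{..<m}" "{..<n}"] by simp
  then show ?thesis by (simp only: of_nat_eq_iff)
qed

text \<open>The columns of the inverse \<open>R\<close> are preimages of the unit vectors;
  injectivity then turns T (R T) = T into R T = 1. Squareness is a conclusion, because Schur's lemma
  compares representations of unrelated dimensions.\<close>

lemma bijective_mat_invertible:
  fixes T :: "complex mat"
  assumes T: "T \<in> carrier_mat n m"
    and inj: "\<And>v. v \<in> carrier_vec m \<Longrightarrow> T *\<^sub>v v = 0\<^sub>v n \<Longrightarrow> v = 0\<^sub>v m"
    and surj: "\<And>w. w \<in> carrier_vec n \<Longrightarrow> \<exists>v\<in>carrier_vec m. T *\<^sub>v v = w"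
  shows "m = n" and "invertible_mat T"
proof -
  have "\<forall>i. \<exists>v\<in>carrier_vec m. T *\<^sub>v v = unit_vec n i" using surj by simp
  then have "\<forall>i. \<exists>v. v \<in> carrier_vec m \<and> T *\<^sub>v v = unit_vec n i" by blast
  from choice[OF this] obtain r where r: "\<And>i. r i \<in> carrier_vec m" "\<And>i. T *\<^sub>v r i = unit_vec n i"
    by blast
  define R where "R = mat m n (\<lambda>(j, i). vec_index (r i) j)"
  have R: "R \<in> carrier_mat m n" by (simp add: R_def)
  have colR: "col R i = r i" if "i < n" for i
    using that r(1)[of i] by (intro eq_vecI) (auto simp: R_def)
  have TR: "T * R = 1\<^sub>m n"
  proof (rule mat_col_eqI)
    fix i assume "i < dim_col (1\<^sub>m n :: complex mat)"
    then have i: "i < n" by simp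
    have "col (T * R) i = T *\<^sub>v col R i" using T R i by (intro col_mult2) auto
    then show "col (T * R) i = col (1\<^sub>m n) i" using i by (simp add: colR r(2))
  qed (use T R in auto)
  have RT: "R * T = 1\<^sub>m m"
  proof (rule mat_col_eqI)
    fix j assume "j < dim_col (1\<^sub>m m :: complex mat)"
    then have j: "j < m" by simp
    define d where "d = col (R * T) j - unit_vec m j"
    have c: "col (R * T) j \<in> carrier_vec m" using R T by (simp add: carrier_vecI)
    have "T *\<^sub>v col (R * T) j = T *\<^sub>v (R *\<^sub>v col T j)"
      by (simp only: col_mult2[OF R T j])
    also have "\<dots> = (T * R) *\<^sub>v col T j"
      using T R j by (intro assoc_mult_mat_vec[symmetric]) auto
    also have "\<dots> = col T j" using T j by (simp add: TR)
    also have "\<dots> = T *\<^sub>v unit_vec m j" by (simp only: mult_mat_unit_vec[OF T j])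
    finally have e: "T *\<^sub>v col (R * T) j = T *\<^sub>v unit_vec m j" .
    have "T *\<^sub>v d = T *\<^sub>v col (R * T) j - T *\<^sub>v unit_vec m j"
      unfolding d_def using T c by (intro mult_minus_distrib_mat_vec) auto
    also have "\<dots> = 0\<^sub>v n" unfolding e using T by (intro minus_cancel_vec mult_mat_vec_carrier) auto
    finally have "d = 0\<^sub>v m" using c by (intro inj) (auto simp: d_def)
    have "vec_index (col (R * T) j) i = vec_index (unit_vec m j) i" if "i < m" for i
    proof -
      have "vec_index d i = 0" using \<open>d = 0\<^sub>v m\<close> that by simp
      moreover have "vec_index d i = vec_index (col (R * T) j) i - vec_index (unit_vec m j) i"
        unfolding d_def using that by (intro index_minus_vec) simp
      ultimately show ?thesis by simp
    qed
    then have "col (R * T) j = unit_vec m j"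
      using carrier_vecD[OF c] by (intro eq_vecI) auto
    then show "col (R * T) j = col (1\<^sub>m m) j" using j by simp
  qed (use T R in auto)
  show "m = n" by (rule two_sided_inverse_square[OF T R TR RT])
  then show "invertible_mat T" using T R TR RT by (auto simp: invertible_mat_iff)
qed

lemma unitary_repD:
  assumes "unitary_rep G (\<pi>, n)" "g \<in> carrier G"
  shows "\<pi> g \<in> carrier_mat n n" "mat_adjoint (\<pi> g) * \<pi> g = 1\<^sub>m n"
    and "h \<in> carrier G \<Longrightarrow> \<pi> (g \<otimes>\<^bsub>G\<^esub> h) = \<pi> g * \<pi> h"
  using assms by (auto simp: unitary_rep_def unitary_mat_def)

lemma irreducible_repD:
  assumes "irreducible_rep G (\<pi>, n)"
    and "VectorSpace.subspace class_ring W (module_vec TYPE(complex) n)"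
    and "\<And>g w. g \<in> carrier G \<Longrightarrow> w \<in> W \<Longrightarrow> \<pi> g *\<^sub>v w \<in> W"
  shows "W = {0\<^sub>v n} \<or> W = carrier_vec n"
  using assms unfolding irreducible_rep_def by blast

text \<open>Kernel and image of an intertwiner are invariant; as \<open>T\<close> is nonzero,
  irreducibility leaves only the zero kernel and the full image.\<close>

theorem schur:
  assumes p: "(\<pi>, m) \<in> unitary_irreps G" and r: "(\<rho>, n) \<in> unitary_irreps G"
    and T: "T \<in> carrier_mat n m" "T \<noteq> 0\<^sub>m n m"
    and int: "\<And>g. g \<in> carrier G \<Longrightarrow> T * \<pi> g = \<rho> g * T"
  shows "((\<pi>, m), (\<rho>, n)) \<in> rep_equiv G"
proof -
  have pu: "unitary_rep G (\<pi>, m)" "irreducible_rep G (\<pi>, m)" and ru: "unitary_rep G (\<rho>, n)" "irreducible_rep G (\<rho>, n)"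
    using p r by (auto simp: unitary_irreps_def)
  have intv: "T *\<^sub>v (\<pi> g *\<^sub>v v) = \<rho> g *\<^sub>v (T *\<^sub>v v)" if g: "g \<in> carrier G" and v: "v \<in> carrier_vec m" for g v
    using int[OF g] assoc_mult_mat_vec[OF T(1) unitary_repD(1)[OF pu(1) g] v]
      assoc_mult_mat_vec[OF unitary_repD(1)[OF ru(1) g] T(1) v] by simp
  obtain v0 where v0: "v0 \<in> carrier_vec m" "T *\<^sub>v v0 \<noteq> 0\<^sub>v n"
  proof -
    obtain i j where ij: "i < n" "j < m" "T $$ (i, j) \<noteq> 0"
    proof -
      have "\<exists>i j. i < n \<and> j < m \<and> T $$ (i, j) \<noteq> 0"
      proof (rule ccontr)
        assume "\<not> ?thesis"
        then have "T = 0\<^sub>m n m" using T(1) by (intro eq_matI) auto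
        then show False using T(2) by blast
      qed
      then show ?thesis using that by blast
    qed
    have "T *\<^sub>v unit_vec m j = col T j" by (rule mult_mat_unit_vec[OF T(1) ij(2)])
    moreover have "vec_index (col T j) i \<noteq> 0" using T(1) ij by simp
    ultimately have "T *\<^sub>v unit_vec m j \<noteq> 0\<^sub>v n" using ij(1) by auto
    then show ?thesis using that[of "unit_vec m j"] by simp
  qed
  define Ker where "Ker = {v \<in> carrier_vec m. T *\<^sub>v v = 0\<^sub>v n}"
  have "VectorSpace.subspace class_ring Ker (module_vec TYPE(complex) m)"
  proof (rule subspace_vecI)
    show "v + w \<in> Ker" if "v \<in> Ker" "w \<in> Ker" for v w
      using that mult_add_distrib_mat_vec[OF T(1), of v w] by (simp add: Ker_def)
    show "a \<cdot>\<^sub>v v \<in> Ker" if "v \<in> Ker" for a v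
    proof -
      have "a \<cdot>\<^sub>v 0\<^sub>v n = 0\<^sub>v n" by (intro eq_vecI) auto
      then show ?thesis using that mult_mat_vec[OF T(1), of v a] by (simp add: Ker_def)
    qed
  qed (use mult_mat_zero_vec[OF T(1)] in \<open>auto simp: Ker_def\<close>)
  moreover have "\<pi> g *\<^sub>v v \<in> Ker" if g: "g \<in> carrier G" and v: "v \<in> Ker" for g v
  proof -
    have vc: "v \<in> carrier_vec m" and Tv: "T *\<^sub>v v = 0\<^sub>v n" using v by (auto simp: Ker_def)
    have "T *\<^sub>v (\<pi> g *\<^sub>v v) = 0\<^sub>v n"
      unfolding intv[OF g vc] Tv by (rule mult_mat_zero_vec[OF unitary_repD(1)[OF ru(1) g]])
    then show ?thesis
      using mult_mat_vec_carrier[OF unitary_repD(1)[OF pu(1) g] vc] by (simp add: Ker_def)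
  qed
  ultimately have "Ker = {0\<^sub>v m} \<or> Ker = carrier_vec m"
    by (rule irreducible_repD[OF pu(2)])
  moreover have "v0 \<notin> Ker" using v0(2) unfolding Ker_def by blast
  ultimately have Ker: "Ker = {0\<^sub>v m}" using v0(1) by blast
  define Im where "Im = (*\<^sub>v) T ` carrier_vec m"
  have "VectorSpace.subspace class_ring Im (module_vec TYPE(complex) n)"
  proof (rule subspace_vecI)
    show "Im \<subseteq> carrier_vec n" using T(1) by (auto simp: Im_def)
    show "0\<^sub>v n \<in> Im"
      unfolding Im_def by (rule image_eqI[where x = "0\<^sub>v m"]) (simp_all add: mult_mat_zero_vec[OF T(1)])
    show "v + w \<in> Im" if vw: "v \<in> Im" "w \<in> Im" for v w
    proof -
      obtain v' w' where c: "v' \<in> carrier_vec m" "w' \<in> carrier_vec m" "v = T *\<^sub>v v'" "w = T *\<^sub>v w'"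
        using vw by (auto simp: Im_def)
      then have "v + w = T *\<^sub>v (v' + w')" by (simp add: mult_add_distrib_mat_vec[OF T(1)])
      moreover have "v' + w' \<in> carrier_vec m" using c by simp
      ultimately show ?thesis unfolding Im_def by (rule image_eqI)
    qed
    show "a \<cdot>\<^sub>v v \<in> Im" if v: "v \<in> Im" for a v
    proof -
      obtain v' where c: "v' \<in> carrier_vec m" "v = T *\<^sub>v v'" using v by (auto simp: Im_def)
      then have "a \<cdot>\<^sub>v v = T *\<^sub>v (a \<cdot>\<^sub>v v')" by (simp add: mult_mat_vec[OF T(1)])
      moreover have "a \<cdot>\<^sub>v v' \<in> carrier_vec m" using c by simp
      ultimately show ?thesis unfolding Im_def by (rule image_eqI)
    qed
  qed
  moreover have "\<rho> g *\<^sub>v v \<in> Im" if g: "g \<in> carrier G" and v: "v \<in> Im" for g v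
  proof -
    obtain v' where c: "v' \<in> carrier_vec m" "v = T *\<^sub>v v'" using v by (auto simp: Im_def)
    then have "\<rho> g *\<^sub>v v = T *\<^sub>v (\<pi> g *\<^sub>v v')" using intv[OF g c(1)] by simp
    then show ?thesis
      unfolding Im_def by (rule image_eqI) (rule mult_mat_vec_carrier[OF unitary_repD(1)[OF pu(1) g] c(1)])
  qed
  ultimately have "Im = {0\<^sub>v n} \<or> Im = carrier_vec n"
    by (rule irreducible_repD[OF ru(2)])
  moreover have "T *\<^sub>v v0 \<in> Im" using v0(1) unfolding Im_def by (rule imageI)
  ultimately have Im: "Im = carrier_vec n" using v0(2) by blast
  have inj: "v = 0\<^sub>v m" if "v \<in> carrier_vec m" "T *\<^sub>v v = 0\<^sub>v n" for v
  proof -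
    have "v \<in> Ker" using that unfolding Ker_def by blast
    then show ?thesis using Ker by blast
  qed
  have surj: "\<exists>v\<in>carrier_vec m. T *\<^sub>v v = w" if "w \<in> carrier_vec n" for w
    using that unfolding Im[symmetric] Im_def by blast
  have "m = n" by (rule bijective_mat_invertible(1)[OF T(1) inj surj])
  moreover have "invertible_mat T" by (rule bijective_mat_invertible(2)[OF T(1) inj surj])
  moreover have "\<forall>g\<in>carrier G. T * \<pi> g = \<rho> g * T" using int by blast
  ultimately show ?thesis
    unfolding rep_equiv_def mem_Collect_eq prod.case using p r T(1) by (intro conjI bexI[of _ T]) auto
qed

section \<open>Orthogonality of matrix coefficients\<close>

context fin_group
begin

text \<open>Cancelling the isometry \<rho>(x) gives \<rho>(y) as the adjoint of \<rho>(x) times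
  \<rho>(x y). The cases x = y = 1 and y = inv x are the two claims.\<close>

lemma unitary_rep_inv:
  assumes r: "unitary_rep G (\<rho>, n)" and h: "h \<in> X"
  shows "\<rho> \<one> = 1\<^sub>m n" and "\<rho> (inv h) = mat_adjoint (\<rho> h)"
proof -
  have c: "\<rho> g \<in> carrier_mat n n" "mat_adjoint (\<rho> g) \<in> carrier_mat n n" if "g \<in> X" for g
    using unitary_repD(1)[OF r that] mat_adjoint_carrier by auto
  have cancel: "\<rho> y = mat_adjoint (\<rho> x) * \<rho> (x \<otimes> y)" if x: "x \<in> X" and y: "y \<in> X" for x y
  proof -
    have "mat_adjoint (\<rho> x) * \<rho> (x \<otimes> y) = (mat_adjoint (\<rho> x) * \<rho> x) * \<rho> y"
      using unitary_repD(3)[OF r x y] assoc_mult_mat[OF c(2)[OF x] c(1)[OF x] c(1)[OF y]] by simp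
    then show ?thesis using unitary_repD(2)[OF r x] c(1)[OF y] by simp
  qed
  show one: "\<rho> \<one> = 1\<^sub>m n"
    using cancel[of \<one> \<one>] unitary_repD(2)[OF r, of \<one>] by simp
  show "\<rho> (inv h) = mat_adjoint (\<rho> h)"
    using cancel[OF h, of "inv h"] h c(2)[OF h] by (simp add: one)
qed

text \<open>This coefficient is 1 at the unit of the group, hence nonzero; the index 0 exists
  because irreducible representations have positive dimension.\<close>

definition coeff00 :: "('a \<Rightarrow> complex mat) \<Rightarrow> 'a \<Rightarrow> complex" where
  "coeff00 \<pi> = (\<lambda>g. if g \<in> X then \<pi> g $$ (0, 0) else 0)"

text \<open>Averaging the matrix unit E_00 to the sum of \<pi>(g) E_00 \<rho>(g)^-1 gives the
  intertwiner \<open>T\<close>. Schur's lemma makes it vanish for inequivalent representations, and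
  its (0,0) entry is the inner product.\<close>

lemma coeff00_orthogonal:
  assumes p: "(\<pi>, m) \<in> unitary_irreps G" and r: "(\<rho>, n) \<in> unitary_irreps G"
    and ne: "((\<rho>, n), (\<pi>, m)) \<notin> rep_equiv G"
  shows "ip X (coeff00 \<pi>) (coeff00 \<rho>) = 0"
proof -
  have pu: "unitary_rep G (\<pi>, m)" and ru: "unitary_rep G (\<rho>, n)" and mn: "0 < m" "0 < n"
    using p r by (auto simp: unitary_irreps_def irreducible_rep_def)
  have pc: "\<pi> g \<in> carrier_mat m m" and rc: "\<rho> g \<in> carrier_mat n n" if "g \<in> X" for g
    using unitary_repD(1)[OF pu that] unitary_repD(1)[OF ru that] by auto
  define T where "T = mat m n (\<lambda>(i, j). \<Sum>g\<in>X. \<pi> g $$ (i, 0) * cnj (\<rho> g $$ (j, 0)))"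
  have T: "T \<in> carrier_mat m n" by (simp add: T_def)
  have "T * \<rho> h = \<pi> h * T" if h: "h \<in> X" for h
  proof (rule eq_matI)
    fix i k assume "i < dim_row (\<pi> h * T)" "k < dim_col (\<pi> h * T)"
    then have i: "i < m" and k: "k < n" using pc[OF h] T by auto
    have ih: "inv h \<in> X" using h by simp
    have "(T * \<rho> h) $$ (i, k) = (\<Sum>j<n. (\<Sum>g\<in>X. \<pi> g $$ (i, 0) * cnj (\<rho> g $$ (j, 0))) * \<rho> h $$ (j, k))"
      using T rc[OF h] i k by (simp add: scalar_prod_def T_def atLeast0LessThan)
    also have "\<dots> = (\<Sum>g\<in>X. \<pi> g $$ (i, 0) * (\<Sum>j<n. cnj (\<rho> g $$ (j, 0)) * \<rho> h $$ (j, k)))"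
      unfolding sum_distrib_left sum_distrib_right by (subst sum.swap) (simp add: mult.assoc)
    also have "\<dots> = (\<Sum>g\<in>X. \<pi> g $$ (i, 0) * cnj (\<rho> (inv h \<otimes> g) $$ (k, 0)))"
    proof (rule sum.cong[OF refl])
      fix g assume g: "g \<in> X"
      have "\<rho> (inv h \<otimes> g) $$ (k, 0) = (mat_adjoint (\<rho> h) * \<rho> g) $$ (k, 0)"
        using unitary_repD(3)[OF ru ih g] unitary_rep_inv(2)[OF ru h] by simp
      also have "\<dots> = (\<Sum>j<n. cnj (\<rho> h $$ (j, k)) * \<rho> g $$ (j, 0))"
        using mat_adjoint_carrier[OF rc[OF h]] rc[OF g] k mn(2) index_mat_adjoint[OF rc[OF h] k]
        by (simp add: scalar_prod_def atLeast0LessThan)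
      finally show "\<pi> g $$ (i, 0) * (\<Sum>j<n. cnj (\<rho> g $$ (j, 0)) * \<rho> h $$ (j, k))
          = \<pi> g $$ (i, 0) * cnj (\<rho> (inv h \<otimes> g) $$ (k, 0))"
        by (simp add: mult.commute)
    qed
    also have "\<dots> = (\<Sum>g\<in>X. \<pi> (h \<otimes> g) $$ (i, 0) * cnj (\<rho> (inv h \<otimes> (h \<otimes> g)) $$ (k, 0)))"
      by (rule sum_left_mult[OF h, symmetric])
    also have "\<dots> = (\<Sum>g\<in>X. (\<Sum>j<m. \<pi> h $$ (i, j) * \<pi> g $$ (j, 0)) * cnj (\<rho> g $$ (k, 0)))"
    proof (rule sum.cong[OF refl])
      fix g assume g: "g \<in> X"
      have "\<pi> (h \<otimes> g) $$ (i, 0) = (\<Sum>j<m. \<pi> h $$ (i, j) * \<pi> g $$ (j, 0))"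
        using unitary_repD(3)[OF pu h g] pc[OF h] pc[OF g] i mn(1) by (simp add: scalar_prod_def atLeast0LessThan)
      moreover have "inv h \<otimes> (h \<otimes> g) = g" using h g by (simp add: m_assoc[symmetric])
      ultimately show "\<pi> (h \<otimes> g) $$ (i, 0) * cnj (\<rho> (inv h \<otimes> (h \<otimes> g)) $$ (k, 0))
          = (\<Sum>j<m. \<pi> h $$ (i, j) * \<pi> g $$ (j, 0)) * cnj (\<rho> g $$ (k, 0))" by simp
    qed
    also have "\<dots> = (\<Sum>j<m. \<pi> h $$ (i, j) * (\<Sum>g\<in>X. \<pi> g $$ (j, 0) * cnj (\<rho> g $$ (k, 0))))"
      unfolding sum_distrib_left sum_distrib_right by (subst sum.swap) (simp add: mult.assoc)
    also have "\<dots> = (\<pi> h * T) $$ (i, k)"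
      using pc[OF h] T i k by (simp add: scalar_prod_def T_def atLeast0LessThan)
    finally show "(T * \<rho> h) $$ (i, k) = (\<pi> h * T) $$ (i, k)" .
  qed (use T pc[OF h] rc[OF h] in auto)
  then have "T = 0\<^sub>m m n" using schur[OF r p T] ne by blast
  then have "T $$ (0, 0) = 0" using mn by simp
  then show ?thesis using mn by (simp add: T_def ip_def coeff00_def)
qed

text \<open>
  Distinct classes have orthogonal matrix coefficients, so there are at most \<open>|G|\<close> of them. This
  matters because sums over infinite sets are \<open>0\<close>.
\<close>

theorem finite_unitary_dual: "finite (unitary_dual G)"
proof -
  have "\<forall>c\<in>unitary_dual G. \<exists>\<pi> n. (\<pi>, n) \<in> unitary_irreps G \<and> c = rep_equiv G `` {(\<pi>, n)}"
    by (auto simp: unitary_dual_def quotient_def)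
  then obtain P N where PN': "\<forall>c\<in>unitary_dual G. (P c, N c) \<in> unitary_irreps G \<and> c = rep_equiv G `` {(P c, N c)}"
    unfolding bchoice_iff by blast
  then have PN: "(P c, N c) \<in> unitary_irreps G" and cPN: "c = rep_equiv G `` {(P c, N c)}"
    if "c \<in> unitary_dual G" for c
    using that by blast+
  define \<phi> where "\<phi> c = coeff00 (P c)" for c
  define nn where "nn c = (\<Sum>x\<in>X. (cmod (\<phi> c x))\<^sup>2)" for c
  define \<psi> where "\<psi> c = (\<lambda>x. of_real (1 / sqrt (nn c)) * \<phi> c x)" for c
  have pos: "0 < nn c" if c: "c \<in> unitary_dual G" for c
  proof -
    have u: "unitary_rep G (P c, N c)" "0 < N c"
      using PN[OF c] by (auto simp: unitary_irreps_def irreducible_rep_def)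
    have "\<phi> c \<one> = 1" using unitary_rep_inv(1)[OF u(1), of \<one>] u(2) by (simp add: \<phi>_def coeff00_def)
    then have "1 \<le> (cmod (\<phi> c \<one>))\<^sup>2" by simp
    also have "\<dots> \<le> nn c" unfolding nn_def using fin by (intro member_le_sum) auto
    finally show ?thesis by simp
  qed
  have nrm: "ip X (\<psi> c) (\<psi> c) = 1" if c: "c \<in> unitary_dual G" for c
  proof -
    have "ip X (\<phi> c) (\<phi> c) = of_real (nn c)" unfolding nn_def by (rule ip_self)
    then have "ip X (\<psi> c) (\<psi> c) = of_real (1 / sqrt (nn c) * (1 / sqrt (nn c) * nn c))"
      unfolding \<psi>_def ip_scale_left ip_scale_right complex_cnj_complex_of_real by (simp only: of_real_mult)
    also have "1 / sqrt (nn c) * (1 / sqrt (nn c) * nn c) = 1"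
      using pos[OF c] by (simp add: field_simps)
    finally show ?thesis by simp
  qed
  have orth: "ip X (\<psi> c) (\<psi> d) = 0" if c: "c \<in> unitary_dual G" and d: "d \<in> unitary_dual G" and "c \<noteq> d" for c d
  proof -
    have "((P d, N d), (P c, N c)) \<notin> rep_equiv G"
    proof
      assume "((P d, N d), (P c, N c)) \<in> rep_equiv G"
      from equiv_class_eq[OF equiv_rep_equiv this] have "d = c"
        by (rule trans[OF cPN[OF d] trans[OF _ cPN[OF c, symmetric]]])
      then show False using \<open>c \<noteq> d\<close> by blast
    qed
    then have "ip X (\<phi> c) (\<phi> d) = 0"
      unfolding \<phi>_def by (rule coeff00_orthogonal[OF PN[OF c] PN[OF d]])
    then show ?thesis unfolding \<psi>_def ip_scale_left ip_scale_right by simp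
  qed
  have inj: "inj_on \<psi> (unitary_dual G)"
  proof (rule inj_onI, rule ccontr)
    fix c d assume *: "c \<in> unitary_dual G" "d \<in> unitary_dual G" "\<psi> c = \<psi> d" "c \<noteq> d"
    then show False using orth[OF *(1,2,4)] nrm[OF *(1)] by simp
  qed
  have "finite (\<psi> ` unitary_dual G)"
  proof (rule finite_orthonormal_set[OF fin])
    fix a b assume "a \<in> \<psi> ` unitary_dual G" "b \<in> \<psi> ` unitary_dual G"
    then obtain c d where cd: "c \<in> unitary_dual G" "d \<in> unitary_dual G" "a = \<psi> c" "b = \<psi> d" by blast
    show "ip X a b = (if a = b then 1 else 0)"
    proof (cases "c = d")
      case True
      then show ?thesis using nrm[OF cd(1)] by (simp add: cd)
    next
      case False
      then have "\<psi> c \<noteq> \<psi> d" using inj_on_eq_iff[OF inj cd(1,2)] by blast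
      then show ?thesis using orth[OF cd(1,2) False] by (simp add: cd)
    qed
  qed
  then show ?thesis by (rule finite_imageD[OF _ inj])
qed

end

section \<open>Representations carried by left-invariant spaces\<close>

context fin_group
begin

lemma left_inv_subD:
  assumes "left_inv_sub U"
  shows "lin_sub UNIV X U" "x \<in> X \<Longrightarrow> v \<in> U \<Longrightarrow> ltrans x v \<in> U"
  using assms by (auto simp: left_inv_sub_def)

lemma function_space_UNIV: "lin_sub UNIV X U \<Longrightarrow> function_space X UNIV U"
  using fin by unfold_locales auto

definition trans_mat :: "nat \<Rightarrow> (nat \<Rightarrow> 'a \<Rightarrow> complex) \<Rightarrow> 'a \<Rightarrow> complex mat" where
  "trans_mat d u x = mat d d (\<lambda>(a, b). ip X (ltrans x (u b)) (u a))"

lemma trans_mat_carrier: "trans_mat d u x \<in> carrier_mat d d"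
  by (simp add: trans_mat_def)

lemma ltrans_basis:
  assumes U: "left_inv_sub U" and u: "onb X U d u" and x: "x \<in> X" and b: "b < d"
  shows "ltrans x (u b) = (\<lambda>g. \<Sum>a<d. trans_mat d u x $$ (a, b) * u a g)"
proof -
  have "ltrans x (u b) \<in> U" using u b left_inv_subD(2)[OF U x] by (simp add: onb_def)
  then have "ltrans x (u b) = (\<lambda>g. \<Sum>a<d. ip X (ltrans x (u b)) (u a) * u a g)"
    using u unfolding onb_def by blast
  also have "\<dots> = (\<lambda>g. \<Sum>a<d. trans_mat d u x $$ (a, b) * u a g)"
    using b by (simp add: trans_mat_def)
  finally show ?thesis .
qed

text \<open>Unitarity reflects the invariance of \<open>ip\<close> under translations,
  multiplicativity the rule \<open>ltrans_mult\<close>.\<close>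

lemma unitary_rep_trans_mat:
  assumes U: "left_inv_sub U" and u: "onb X U d u"
  shows "unitary_rep G (trans_mat d u, d)"
proof -
  have uo: "orthonormal_family X d u" and uU: "\<And>a. a < d \<Longrightarrow> u a \<in> U" using u by (auto simp: onb_def)
  have supp: "u a g = 0" if "a < d" "g \<notin> X" for a g
    using lin_sub_support[OF left_inv_subD(1)[OF U] uU[OF that(1)] that(2)] .
  have "mat_adjoint (trans_mat d u x) * trans_mat d u x = 1\<^sub>m d" if x: "x \<in> X" for x
  proof (rule eq_matI)
    fix b c assume "b < dim_row (1\<^sub>m d :: complex mat)" "c < dim_col (1\<^sub>m d :: complex mat)"
    then have b: "b < d" and c: "c < d" by auto
    let ?A = "trans_mat d u x"
    have "(mat_adjoint ?A * ?A) $$ (b, c) = (\<Sum>a<d. cnj (?A $$ (a, b)) * ?A $$ (a, c))"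
      using mat_adjoint_carrier[OF trans_mat_carrier[of d u x]] trans_mat_carrier[of d u x] b c
        index_mat_adjoint[OF trans_mat_carrier[of d u x] b]
      by (simp add: scalar_prod_def atLeast0LessThan)
    also have "\<dots> = ip X (ltrans x (u c)) (ltrans x (u b))"
      unfolding ltrans_basis[OF U u x b] ltrans_basis[OF U u x c] orthonormal_family_combination[OF uo]
      by (simp add: mult.commute)
    also have "\<dots> = ip X (u c) (u b)" using supp[OF b] by (intro ip_ltrans_ltrans[OF x])
    also have "\<dots> = 1\<^sub>m d $$ (b, c)" using orthonormal_familyD[OF uo c b] b c by auto
    finally show "(mat_adjoint ?A * ?A) $$ (b, c) = 1\<^sub>m d $$ (b, c)" .
  qed (use mat_adjoint_carrier[OF trans_mat_carrier[of d u x]] trans_mat_carrier[of d u x] in auto)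
  moreover have "trans_mat d u (x \<otimes> y) = trans_mat d u x * trans_mat d u y" if x: "x \<in> X" and y: "y \<in> X" for x y
  proof (rule eq_matI)
    fix a c assume "a < dim_row (trans_mat d u x * trans_mat d u y)" "c < dim_col (trans_mat d u x * trans_mat d u y)"
    then have a: "a < d" and c: "c < d" using trans_mat_carrier[of d u x] trans_mat_carrier[of d u y] by auto
    have "trans_mat d u (x \<otimes> y) $$ (a, c) = ip X (ltrans x (ltrans y (u c))) (u a)"
      using a c x y by (simp add: trans_mat_def ltrans_mult)
    also have "\<dots> = (\<Sum>b<d. trans_mat d u y $$ (b, c) * ip X (ltrans x (u b)) (u a))"
      unfolding ltrans_basis[OF U u y c] ltrans_combination by (simp only: ip_sum_left ip_scale_left)
    also have "\<dots> = (\<Sum>b<d. trans_mat d u x $$ (a, b) * trans_mat d u y $$ (b, c))"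
      using a by (intro sum.cong) (auto simp: trans_mat_def)
    also have "\<dots> = (trans_mat d u x * trans_mat d u y) $$ (a, c)"
      using trans_mat_carrier[of d u x] trans_mat_carrier[of d u y] a c
      by (simp add: scalar_prod_def atLeast0LessThan)
    finally show "trans_mat d u (x \<otimes> y) $$ (a, c) = (trans_mat d u x * trans_mat d u y) $$ (a, c)" .
  qed (simp_all add: trans_mat_def)
  ultimately show ?thesis
    using trans_mat_carrier[of d u] by (auto simp: unitary_rep_def unitary_mat_def)
qed

text \<open>The coordinate map \<open>\<Phi>\<close> carries an invariant subspace \<open>W\<close>
  of vectors to a left-invariant subspace of \<open>U\<close>. By minimality its dimension is 0 or
  at least d, and in the second case an orthonormal basis of it is already one of
  \<open>U\<close>.\<close>

lemma irreducible_rep_trans_mat: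
  assumes U: "left_inv_sub U" and u: "onb X U d u" and d: "0 < d"
    and min: "\<And>U' k w. left_inv_sub U' \<Longrightarrow> U' \<subseteq> U \<Longrightarrow> onb X U' k w \<Longrightarrow> 0 < k \<Longrightarrow> d \<le> k"
  shows "irreducible_rep G (trans_mat d u, d)"
proof -
  have uo: "orthonormal_family X d u" and uU: "\<And>a. a < d \<Longrightarrow> u a \<in> U" using u by (auto simp: onb_def)
  have lin: "lin_sub UNIV X U" by (rule left_inv_subD(1)[OF U])
  interpret U: function_space X UNIV U by (rule function_space_UNIV[OF lin])
  define \<Phi> where "\<Phi> w = (\<lambda>g. \<Sum>a<d. vec_index w a * u a g)" for w
  have \<Phi>U: "\<Phi> w \<in> U" for w unfolding \<Phi>_def by (intro lin_sub_sum[OF lin] uU) auto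
  have coeff: "ip X (\<Phi> w) (u a) = vec_index w a" if "a < d" for w a
    unfolding \<Phi>_def by (rule orthonormal_family_coeff[OF uo that, of "vec_index w"])
  have \<Phi>inj: "v = w" if "v \<in> carrier_vec d" "w \<in> carrier_vec d" "\<Phi> v = \<Phi> w" for v w
  proof (rule eq_vecI)
    fix a assume "a < dim_vec w"
    then have "a < d" using that(2) by simp
    then show "vec_index v a = vec_index w a" using coeff[of a v] coeff[of a w] that(3) by simp
  qed (use that in simp)
  have "W = {0\<^sub>v d} \<or> W = carrier_vec d"
    if W: "VectorSpace.subspace class_ring W (module_vec TYPE(complex) d)"
      and inv: "\<And>g w. g \<in> X \<Longrightarrow> w \<in> W \<Longrightarrow> trans_mat d u g *\<^sub>v w \<in> W" for W
  proof -
    note Wsub = subspace_vecD[OF W]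
    have Wc: "w \<in> carrier_vec d" if "w \<in> W" for w using Wsub(1) that by blast
    define U' where "U' = \<Phi> ` W"
    have \<Phi>W: "\<Phi> w \<in> U'" if "w \<in> W" for w using that by (simp add: U'_def)
    have U'U: "U' \<subseteq> U" using \<Phi>U by (auto simp: U'_def)
    have add: "\<Phi> (v + w) = (\<lambda>g. \<Phi> v g + \<Phi> w g)" if "v \<in> W" "w \<in> W" for v w
      unfolding \<Phi>_def sum.distrib[symmetric]
      using Wc[OF that(1)] Wc[OF that(2)] by (intro ext sum.cong refl) (simp add: distrib_right)
    have scale: "\<Phi> (c \<cdot>\<^sub>v v) = (\<lambda>g. c * \<Phi> v g)" if "v \<in> W" for c v
      unfolding \<Phi>_def sum_distrib_left
      using Wc[OF that] by (intro ext sum.cong refl) simp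
    have zero: "\<Phi> (0\<^sub>v d) = (\<lambda>g. 0)"
      unfolding \<Phi>_def by (intro ext sum.neutral) simp
    have linU': "lin_sub UNIV X U'"
      unfolding lin_sub_def
    proof (intro conjI ballI allI impI)
      show "f x = 0" if "f \<in> U'" "x \<notin> X" for f x
        using lin_sub_support[OF lin _ that(2)] that(1) U'U by blast
      show "(\<lambda>x. 0) \<in> U'" unfolding zero[symmetric] by (rule \<Phi>W[OF Wsub(2)])
      show "(\<lambda>x. f x + h x) \<in> U'" if fh: "f \<in> U'" "h \<in> U'" for f h
      proof -
        obtain v w where vw: "v \<in> W" "w \<in> W" "f = \<Phi> v" "h = \<Phi> w" using fh by (auto simp: U'_def)
        show ?thesis
          unfolding vw(3,4) add[OF vw(1,2), symmetric] by (rule \<Phi>W[OF Wsub(3)[OF vw(1,2)]])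
      qed
      show "(\<lambda>x. c * f x) \<in> U'" if f: "f \<in> U'" for c f
      proof -
        obtain v where v: "v \<in> W" "f = \<Phi> v" using f by (auto simp: U'_def)
        show ?thesis
          unfolding v(2) scale[OF v(1), symmetric] by (rule \<Phi>W[OF Wsub(4)[OF v(1)]])
      qed
    qed
    have "ltrans x f \<in> U'" if x: "x \<in> X" and f: "f \<in> U'" for x f
    proof -
      obtain w where w: "w \<in> W" "f = \<Phi> w" using f by (auto simp: U'_def)
      have "ltrans x f = \<Phi> (trans_mat d u x *\<^sub>v w)"
      proof
        fix g
        have "ltrans x f g = (\<Sum>b<d. vec_index w b * (\<Sum>a<d. trans_mat d u x $$ (a, b) * u a g))"
          unfolding w(2) \<Phi>_def ltrans_combination using ltrans_basis[OF U u x] by simp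
        also have "\<dots> = (\<Sum>a<d. (\<Sum>b<d. trans_mat d u x $$ (a, b) * vec_index w b) * u a g)"
          unfolding sum_distrib_left sum_distrib_right by (subst sum.swap) (simp add: mult_ac)
        also have "\<dots> = \<Phi> (trans_mat d u x *\<^sub>v w) g"
          using trans_mat_carrier[of d u x] Wc[OF w(1)] unfolding \<Phi>_def
          by (intro sum.cong) (auto simp: scalar_prod_def atLeast0LessThan)
        finally show "ltrans x f g = \<Phi> (trans_mat d u x *\<^sub>v w) g" .
      qed
      then show ?thesis using \<Phi>W[OF inv[OF x w(1)]] by simp
    qed
    then have invU': "left_inv_sub U'" using linU' by (simp add: left_inv_sub_def)
    interpret U': function_space X UNIV U' by (rule function_space_UNIV[OF linU'])
    obtain k w where w: "onb X U' k w" using U'.ex_onb by blast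
    show ?thesis
    proof (cases "k = 0")
      case True
      have "v = 0\<^sub>v d" if v: "v \<in> W" for v
      proof -
        have "\<Phi> v = (\<lambda>x. \<Sum>p<k. ip X (\<Phi> v) (w p) * w p x)"
          using w v unfolding onb_def U'_def by blast
        also have "\<dots> = \<Phi> (0\<^sub>v d)" unfolding zero using True by simp
        finally show ?thesis by (rule \<Phi>inj[OF Wc[OF v] zero_carrier_vec])
      qed
      then show ?thesis using Wsub(2) by blast
    next
      case False
      then have "d \<le> k" using min[OF invU' U'U w] by simp
      have wo: "orthonormal_family X k w" and wU': "\<And>p. p < k \<Longrightarrow> w p \<in> U'" using w by (auto simp: onb_def)
      have wU: "\<And>p. p < k \<Longrightarrow> w p \<in> U" using wU' U'U by blast
      have "k \<le> d" by (rule U.orthonormal_family_le[OF u wo wU])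
      then have kd: "k = d" using \<open>d \<le> k\<close> by simp
      have wb: "onb X U d w" using wo wU unfolding kd by (rule U.onb_of_card[OF u])
      have "v \<in> W" if v: "v \<in> carrier_vec d" for v
      proof -
        have 1: "\<Phi> v = (\<lambda>x. \<Sum>p<d. ip X (\<Phi> v) (w p) * w p x)"
          using wb \<Phi>U[of v] unfolding onb_def by blast
        have "\<Phi> v \<in> U'" by (subst 1, rule lin_sub_sum[OF linU']) (use wU' kd in auto)
        then obtain v' where v': "\<Phi> v = \<Phi> v'" "v' \<in> W" unfolding U'_def by (rule imageE)
        have "v = v'" by (rule \<Phi>inj[OF v Wc[OF v'(2)] v'(1)])
        then show ?thesis using v'(2) by simp
      qed
      then show ?thesis using Wsub(1) by blast
    qed
  qed
  note sub = this
  show ?thesis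
    unfolding irreducible_rep_def prod.case
  proof (intro conjI allI impI)
    fix W assume "VectorSpace.subspace class_ring W (module_vec TYPE(complex) d) \<and>
      (\<forall>g\<in>X. \<forall>w\<in>W. trans_mat d u g *\<^sub>v w \<in> W)"
    then show "W = {0\<^sub>v d} \<or> W = carrier_vec d" by (intro sub) blast+
  qed (rule d)
qed

text \<open>An invariant subspace of least positive dimension is irreducible.\<close>

theorem ex_nontrivial_class:
  assumes E: "left_inv_sub E" and e: "onb X E m e" and m: "0 < m"
    and mean: "\<And>v. v \<in> E \<Longrightarrow> (\<Sum>g\<in>X. v g) = 0"
  shows "\<exists>c\<in>unitary_dual G - {triv_class G}. 0 < class_dim c \<and> class_dim c \<le> m"
proof -
  let ?P = "\<lambda>d. \<exists>U u. left_inv_sub U \<and> U \<subseteq> E \<and> onb X U d u \<and> 0 < d"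
  define d where "d = (LEAST d. ?P d)"
  have Pm: "?P m" using E e m by blast
  have "?P d" unfolding d_def by (rule LeastI[of ?P, OF Pm])
  then obtain U u where U: "left_inv_sub U" "U \<subseteq> E" and u: "onb X U d u" and d: "0 < d" by blast
  have dm: "d \<le> m" unfolding d_def by (rule Least_le[of ?P, OF Pm])
  have min: "d \<le> k" if "left_inv_sub U'" "U' \<subseteq> U" "onb X U' k w" "0 < k" for U' k w
    unfolding d_def
    using that order_trans[OF that(2) U(2)] by (intro Least_le exI[of _ U'] exI[of _ w] conjI)
  define \<pi> where "\<pi> = trans_mat d u"
  have irr: "(\<pi>, d) \<in> unitary_irreps G"
    unfolding unitary_irreps_def \<pi>_def mem_Collect_eq
    by (intro conjI unitary_rep_trans_mat[OF U(1) u] irreducible_rep_trans_mat[OF U(1) u d] min)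
  define c where "c = rep_equiv G `` {(\<pi>, d)}"
  have c: "c \<in> unitary_dual G" unfolding c_def unitary_dual_def by (rule quotientI[OF irr])
  have inc: "(\<pi>, d) \<in> c"
    unfolding c_def using equiv_class_self[OF equiv_rep_equiv irr] .
  have "c \<noteq> triv_class G"
  proof
    \<comment> \<open>Then every translation fixes \<open>u 0\<close>, so \<open>u 0\<close> is
      constant; zero mean makes it vanish, contrary to its unit norm. This is where the removal of
      the constants from the eigenspaces is used.\<close>
    assume "c = triv_class G"
    then have "(((\<lambda>_. 1\<^sub>m 1), 1), (\<pi>, d)) \<in> rep_equiv G" using inc by (simp add: triv_class_def)
    then obtain T where d1: "d = 1" and T: "T \<in> carrier_mat 1 1" "invertible_mat T"
      and int: "\<And>g. g \<in> X \<Longrightarrow> T * 1\<^sub>m 1 = \<pi> g * T"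
      by (auto simp: rep_equiv_def)
    obtain R where R: "R \<in> carrier_mat 1 1" "T * R = 1\<^sub>m 1"
      using T by (auto simp: invertible_mat_iff[OF T(1)])
    have pi1: "\<pi> g = 1\<^sub>m 1" if g: "g \<in> X" for g
    proof -
      have pc: "\<pi> g \<in> carrier_mat 1 1" unfolding \<pi>_def d1 by (rule trans_mat_carrier)
      have "\<pi> g = \<pi> g * (T * R)" using pc R by simp
      also have "\<dots> = (\<pi> g * T) * R" using assoc_mult_mat[OF pc T(1) R(1)] by simp
      also have "\<pi> g * T = T" using int[OF g] T(1) by simp
      finally show ?thesis using R(2) by simp
    qed
    have inv: "ltrans g (u 0) = u 0" if g: "g \<in> X" for g
      using ltrans_basis[OF U(1) u g d] pi1[OF g] unfolding \<pi>_def d1 by simp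
    have const: "u 0 g = u 0 \<one>" if g: "g \<in> X" for g
      using fun_cong[OF inv[OF g], of g] g by (simp add: ltrans_def)
    have "u 0 \<in> E" using u d U(2) by (auto simp: onb_def)
    then have "(\<Sum>g\<in>X. u 0 g) = 0" by (rule mean)
    moreover have "(\<Sum>g\<in>X. u 0 g) = (\<Sum>g\<in>X. u 0 \<one>)" by (intro sum.cong refl const)
    ultimately have one0: "u 0 \<one> = 0" using fin one_closed by auto
    have "(\<Sum>x\<in>X. (cmod (u 0 x))\<^sup>2) = 0"
      by (intro sum.neutral ballI) (simp add: trans[OF const one0])
    moreover have "(\<Sum>x\<in>X. (cmod (u 0 x))\<^sup>2) = 1"
      using orthonormal_family_norm[OF _ d, of X u] u by (simp add: onb_def)
    ultimately show False by simp
  qed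
  moreover have "class_dim c = d" by (rule class_dim_eq[OF c inc])
  ultimately show ?thesis using c d dm by auto
qed

end

section \<open>Balanced eigenbases\<close>

text \<open>
  With \<open>y = t \<surd>d\<close> and \<open>r = \<surd>(m/d)\<close> the hypothesis reads \<open>12 M d\<^sup>2 < exp (y/64)\<close>, in particular \<open>y > 128\<close>,
  and the claim follows from \<open>4 m M \<le> r\<^sup>2 exp (y/64) \<le> exp (2 r + y/64) \<le> exp (y r/10)\<close>.
\<close>

lemma dimension_bound:
  fixes d m M :: nat and t :: real
  assumes d: "0 < d" "d \<le> m" and t: "0 < t"
    and h: "2 * real M * ((real d)\<^sup>2 * (6 * exp (- (t * sqrt (real d) / 64)) + 2 * exp (- (real d / 12)))) < 1"
  shows "4 * (real m * real M) \<le> exp (t * sqrt (real m) / 10)"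
proof (cases "M = 0")
  case False
  define y where "y = t * sqrt (real d)"
  define r where "r = sqrt (real m) / sqrt (real d)"
  have r1: "1 \<le> r" using d by (simp add: r_def)
  have y0: "0 \<le> y" using t by (simp add: y_def)
  have yr: "t * sqrt (real m) = y * r" using d by (simp add: y_def r_def)
  have mr: "real m = real d * r\<^sup>2" using d by (simp add: r_def power_divide)
  have M1: "1 \<le> real M" and d1: "1 \<le> real d" using False d by auto
  have "2 * real M * ((real d)\<^sup>2 * (6 * exp (- (y / 64))))
      \<le> 2 * real M * ((real d)\<^sup>2 * (6 * exp (- (y / 64)) + 2 * exp (- (real d / 12))))"
    by (intro mult_left_mono) auto
  then have "12 * real M * (real d)\<^sup>2 * exp (- (y / 64)) < 1" using h unfolding y_def by linarith
  then have "12 * real M * (real d)\<^sup>2 * exp (- (y / 64)) * exp (y / 64) < 1 * exp (y / 64)"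
    by (intro mult_strict_right_mono) auto
  then have k: "12 * (real M * (real d)\<^sup>2) < exp (y / 64)"
    by (simp add: mult.assoc exp_add[symmetric])
  \<comment> \<open>M and d are at least 1, so exp (y / 64) exceeds 12; comparison with exp 2 <= 9
    gives y > 128.\<close>
  have "1 * 1 \<le> real M * (real d)\<^sup>2" using M1 d1 by (intro mult_mono) auto
  then have "12 < exp (y / 64)" using k by linarith
  moreover have "exp 2 \<le> (9 :: real)"
    using mult_mono[OF exp_le exp_le] by (simp add: exp_add[symmetric])
  ultimately have "exp 2 < exp (y / 64)" by linarith
  then have y128: "128 < y" by simp
  have r_exp: "r\<^sup>2 \<le> exp (2 * r)"
  proof -
    have "r \<le> exp r" using exp_ge_add_one_self[of r] by linarith
    then have "r * r \<le> exp r * exp r" using r1 by (intro mult_mono) auto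
    then show ?thesis by (simp add: power2_eq_square exp_add[symmetric])
  qed
  have "real d * 1 \<le> real d * real d" using d1 by (intro mult_left_mono) auto
  then have "real d * (r\<^sup>2 * real M) \<le> (real d)\<^sup>2 * (r\<^sup>2 * real M)"
    by (intro mult_right_mono) (auto simp: power2_eq_square)
  moreover have "4 * (real m * real M) = 4 * (real d * (r\<^sup>2 * real M))" by (simp add: mr mult_ac)
  moreover have "0 \<le> (real d)\<^sup>2 * (r\<^sup>2 * real M)" by simp
  moreover have "r\<^sup>2 * (12 * (real M * (real d)\<^sup>2)) = 12 * ((real d)\<^sup>2 * (r\<^sup>2 * real M))" by (simp add: mult_ac)
  ultimately have "4 * (real m * real M) \<le> r\<^sup>2 * (12 * (real M * (real d)\<^sup>2))" by linarith
  also have "\<dots> \<le> exp (2 * r) * exp (y / 64)"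
    using r_exp k by (intro mult_mono) auto
  also have "\<dots> = exp (2 * r + y / 64)" by (simp add: exp_add)
  \<comment> \<open>y > 128 gives 2 r <= y r / 64, and r >= 1 gives y / 64 <= y r / 64; the sum y r
    / 32 is below y r / 10.\<close>
  also have "\<dots> \<le> exp (y * r / 10)"
  proof -
    have "y * 1 \<le> y * r" using y0 r1 by (intro mult_left_mono) auto
    moreover have "128 * r \<le> y * r" using y128 r1 by (intro mult_right_mono) auto
    ultimately have "2 * r + y / 64 \<le> y * r / 10" using r1 by linarith
    then show ?thesis by simp
  qed
  finally show ?thesis unfolding yr .
qed simp

context cayley
begin

lemma balanced_eigsp:
  fixes f :: "'j \<Rightarrow> 'a \<Rightarrow> real"
  assumes E: "eigsp \<nu> \<noteq> {\<lambda>x. 0}" and J: "finite J" and t: "0 < t"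
    and h: "2 * real (card J) * (\<Sum>c\<in>unitary_dual G - {triv_class G}. (real (class_dim c))\<^sup>2 *
      (6 * exp (- (t * sqrt (real (class_dim c)) / 64)) + 2 * exp (- (real (class_dim c) / 12)))) < 1"
  shows "\<exists>m w. onb X (real_part (eigsp \<nu>)) m w \<and> (\<forall>j\<in>J. \<forall>a<m.
    \<bar>qform X (f j) (w a) (w a) - (\<Sum>x\<in>X. f j x) / real (order G)\<bar>
      \<le> t * (sqrt (\<Sum>x\<in>X. (f j x)\<^sup>2) / sqrt (real (order G))))"
proof -
  obtain v where v: "v \<in> eigsp \<nu>" "v \<noteq> (\<lambda>x. 0)"
    using E lin_sub_zero[OF eigsp_lin[of \<nu>]] by blast
  have cnjE: "(\<lambda>x. cnj (v x)) \<in> eigsp \<nu>" if "v \<in> eigsp \<nu>" for v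
    by (rule eigsp_cnj[OF eigsp_real[OF v] that])
  interpret R: function_space X \<real> "real_part (eigsp \<nu>)" by (rule real_part_space[OF eigsp_lin])
  obtain m e where e: "onb X (real_part (eigsp \<nu>)) m e" using R.ex_onb by blast
  have few: "4 * (real m * real (card J)) \<le> exp (t * sqrt (real m) / 10)"
  proof (cases "m = 0")
    case False
    define F where "F c = (real (class_dim c))\<^sup>2 *
      (6 * exp (- (t * sqrt (real (class_dim c)) / 64)) + 2 * exp (- (real (class_dim c) / 12)))"
      for c :: "(('a \<Rightarrow> complex mat) \<times> nat) set"
    have "(\<Sum>g\<in>X. v g) = 0" if "v \<in> eigsp \<nu>" for v using that by (simp add: eigsp_def)
    then obtain c where c: "c \<in> unitary_dual G - {triv_class G}" "0 < class_dim c" "class_dim c \<le> m"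
      using ex_nontrivial_class[OF eigsp_left_inv onb_real_part[OF eigsp_lin cnjE e]] False by blast
    \<comment> \<open>The summands are nonnegative, so the class found inside this eigenspace meets
      the hypothesis of \<open>dimension_bound\<close> by itself. Each eigenspace is treated
      separately, so their number does not enter.\<close>
    have "F c \<le> (\<Sum>c\<in>unitary_dual G - {triv_class G}. F c)"
      using finite_unitary_dual c(1) by (intro member_le_sum) (auto simp: F_def intro!: mult_nonneg_nonneg add_nonneg_nonneg)
    then have "2 * real (card J) * F c \<le> 2 * real (card J) * (\<Sum>c\<in>unitary_dual G - {triv_class G}. F c)"
      by (intro mult_left_mono) auto
    also have "\<dots> < 1" using h unfolding F_def .
    finally show ?thesis
      unfolding F_def by (rule dimension_bound[OF c(2,3) t])
  qed simp
  obtain w where "onb X (real_part (eigsp \<nu>)) m w \<and> (\<forall>j\<in>J. \<forall>a<m.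
    \<bar>qform X (f j) (w a) (w a) - (\<Sum>x\<in>X. f j x) / real (order G)\<bar>
      \<le> t * (sqrt (\<Sum>x\<in>X. (f j x)\<^sup>2) / sqrt (real (order G))))"
    using balanced_basis_left_invariant[OF eigsp_left_inv cnjE e J t few] by blast
  then show ?thesis by blast
qed

text \<open>Passes from functions that vanish off the carrier to the extensional functions of
  \<open>l2_space\<close>. Restriction is injective on \<open>B\<close>, since \<open>ip\<close>
  depends only on values on the carrier and separates the members of an orthonormal set.\<close>

lemma real_eigenbasis_restrict:
  assumes fB: "finite B"
    and o: "\<And>\<phi> \<psi>. \<phi> \<in> B \<Longrightarrow> \<psi> \<in> B \<Longrightarrow> ip X \<phi> \<psi> = (if \<phi> = \<psi> then 1 else 0)"
    and span: "\<And>v. (\<And>x. x \<notin> X \<Longrightarrow> v x = 0) \<Longrightarrow> v = (\<lambda>x. \<Sum>\<phi>\<in>B. ip X v \<phi> * \<phi> x)"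
    and eig: "\<And>\<phi>. \<phi> \<in> B \<Longrightarrow> (\<forall>x. \<phi> x \<in> \<real>) \<and> (\<forall>x. x \<notin> X \<longrightarrow> \<phi> x = 0) \<and> (\<exists>\<nu>. adj \<phi> = (\<lambda>x. \<nu> * \<phi> x))"
  shows "real_eigenbasis G S ((\<lambda>\<phi>. restrict \<phi> X) ` B)"
proof -
  let ?r = "\<lambda>\<phi>. restrict \<phi> X"
  have inner: "l2_inner G (?r \<phi>) (?r \<psi>) = ip X \<phi> \<psi>" for \<phi> \<psi> by (simp add: l2_inner_def ip_def)
  have inj: "inj_on ?r B"
  proof (rule inj_onI, rule ccontr)
    fix \<phi> \<psi> assume *: "\<phi> \<in> B" "\<psi> \<in> B" "?r \<phi> = ?r \<psi>" "\<phi> \<noteq> \<psi>"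
    have "ip X \<phi> \<psi> = ip X \<phi> \<phi>" unfolding inner[symmetric] *(3) ..
    then show False using o[OF *(1,2)] o[OF *(1,1)] *(4) by simp
  qed
  have ob: "l2_orthonormal_basis G (?r ` B)"
    unfolding l2_orthonormal_basis_def
  proof (intro conjI ballI)
    show "finite (?r ` B)" using fB by simp
    show "?r ` B \<subseteq> l2_space G" by (auto simp: l2_space_def)
    fix a b assume "a \<in> ?r ` B" "b \<in> ?r ` B"
    then obtain \<phi> \<psi> where *: "\<phi> \<in> B" "\<psi> \<in> B" "a = ?r \<phi>" "b = ?r \<psi>" by blast
    have "a = b \<longleftrightarrow> \<phi> = \<psi>" unfolding *(3,4) by (rule inj_on_eq_iff[OF inj *(1,2)])
    then show "l2_inner G a b = (if a = b then 1 else 0)" using o[OF *(1,2)] by (simp only: *(3,4) inner)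
  next
    fix h assume "h \<in> l2_space G"
    define h0 where "h0 = (\<lambda>x. if x \<in> X then h x else 0)"
    have "h0 = (\<lambda>x. \<Sum>\<phi>\<in>B. ip X h0 \<phi> * \<phi> x)" by (rule span) (simp add: h0_def)
    then have ex: "h0 g = (\<Sum>\<phi>\<in>B. ip X h0 \<phi> * \<phi> g)" for g by (rule fun_cong)
    have "h g = (\<Sum>\<psi>\<in>?r ` B. ip X h0 \<psi> * \<psi> g)" if g: "g \<in> X" for g
    proof -
      have "(\<Sum>\<psi>\<in>?r ` B. ip X h0 \<psi> * \<psi> g) = (\<Sum>\<phi>\<in>B. ip X h0 (?r \<phi>) * ?r \<phi> g)"
        by (simp add: sum.reindex[OF inj])
      also have "\<dots> = (\<Sum>\<phi>\<in>B. ip X h0 \<phi> * \<phi> g)" using g by (simp add: ip_def)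
      also have "\<dots> = h0 g" by (rule ex[symmetric])
      finally show ?thesis using g by (simp add: h0_def)
    qed
    then show "\<exists>c. \<forall>g\<in>X. h g = (\<Sum>\<psi>\<in>?r ` B. c \<psi> * \<psi> g)"
      by (intro exI[of _ "\<lambda>\<psi>. ip X h0 \<psi>"] ballI)
  qed
  have "real_valued_on G (?r \<phi>) \<and> cayley_eigenfunction G S (?r \<phi>)" if \<phi>: "\<phi> \<in> B" for \<phi>
  proof
    show "real_valued_on G (?r \<phi>)" using eig[OF \<phi>] by (simp add: real_valued_on_def)
    obtain \<nu> where \<nu>: "adj \<phi> = (\<lambda>x. \<nu> * \<phi> x)" using eig[OF \<phi>] by blast
    have "\<exists>g\<in>X. \<phi> g \<noteq> 0"
    proof (rule ccontr)
      assume "\<not> ?thesis"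
      then have "ip X \<phi> \<phi> = 0" by (simp add: ip_def)
      then show False using o[OF \<phi> \<phi>] by simp
    qed
    then have "\<exists>g\<in>X. ?r \<phi> g \<noteq> 0" by auto
    moreover have "cayley_adjacency G S (?r \<phi>) g = \<nu> * ?r \<phi> g" if g: "g \<in> X" for g
    proof -
      have "cayley_adjacency G S (?r \<phi>) g = adj \<phi> g"
        using g S by (auto simp: cayley_adjacency_def adj_def intro!: sum.cong)
      then show ?thesis using g by (simp add: \<nu>)
    qed
    ultimately show "cayley_eigenfunction G S (?r \<phi>)"
      unfolding cayley_eigenfunction_def by (auto simp: l2_space_def)
  qed
  then show ?thesis using ob unfolding real_eigenbasis_def by blast
qed

theorem ex_balanced_eigenbasis:
  fixes f :: "'j \<Rightarrow> 'a \<Rightarrow> real"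
  assumes J: "finite J" and t: "0 < t"
    and h: "2 * real (card J) * (\<Sum>c\<in>unitary_dual G - {triv_class G}. (real (class_dim c))\<^sup>2 *
      (6 * exp (- (t * sqrt (real (class_dim c)) / 64)) + 2 * exp (- (real (class_dim c) / 12)))) < 1"
  shows "\<exists>B. real_eigenbasis G S B \<and> (\<forall>\<phi>\<in>B. \<forall>j\<in>J.
    \<bar>(\<Sum>x\<in>X. f j x * (cmod (\<phi> x))\<^sup>2) - (\<Sum>x\<in>X. f j x) / real (order G)\<bar>
      \<le> t * (sqrt (\<Sum>x\<in>X. (f j x)\<^sup>2) / sqrt (real (order G))))"
proof -
  let ?bd = "\<lambda>j q. \<bar>q - (\<Sum>x\<in>X. f j x) / real (order G)\<bar>
      \<le> t * (sqrt (\<Sum>x\<in>X. (f j x)\<^sup>2) / sqrt (real (order G)))"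
  \<comment> \<open>Length and basis are packed into one pair, so that a single application of
    choice yields both as functions of \<nu>.\<close>
  have "\<forall>\<nu>. \<exists>z. eigsp \<nu> \<noteq> {\<lambda>x. 0} \<longrightarrow> onb X (real_part (eigsp \<nu>)) (fst z) (snd z)
      \<and> (\<forall>j\<in>J. \<forall>a<fst z. ?bd j (qform X (f j) (snd z a) (snd z a)))"
  proof
    fix \<nu>
    show "\<exists>z. eigsp \<nu> \<noteq> {\<lambda>x. 0} \<longrightarrow> onb X (real_part (eigsp \<nu>)) (fst z) (snd z)
      \<and> (\<forall>j\<in>J. \<forall>a<fst z. ?bd j (qform X (f j) (snd z a) (snd z a)))"
    proof (cases "eigsp \<nu> = {\<lambda>x. 0}")
      case False
      from balanced_eigsp[OF this J t h, of f] obtain m w where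
        "onb X (real_part (eigsp \<nu>)) m w \<and> (\<forall>j\<in>J. \<forall>a<m. ?bd j (qform X (f j) (w a) (w a)))" by blast
      then show ?thesis by (intro exI[of _ "(m, w)"]) simp
    qed simp
  qed
  from choice[OF this] obtain z where z: "\<And>\<nu>. eigsp \<nu> \<noteq> {\<lambda>x. 0} \<Longrightarrow>
      onb X (real_part (eigsp \<nu>)) (fst (z \<nu>)) (snd (z \<nu>))
      \<and> (\<forall>j\<in>J. \<forall>a<fst (z \<nu>). ?bd j (qform X (f j) (snd (z \<nu>) a) (snd (z \<nu>) a)))" by blast
  define m w where "m \<nu> = fst (z \<nu>)" and "w \<nu> = snd (z \<nu>)" for \<nu>
  have w: "onb X (real_part (eigsp \<nu>)) (m \<nu>) (w \<nu>)" if "eigsp \<nu> \<noteq> {\<lambda>x. 0}" for \<nu>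
    using z[OF that] by (simp add: m_def w_def)
  have dev: "?bd j (qform X (f j) (w \<nu> a) (w \<nu> a))" if "eigsp \<nu> \<noteq> {\<lambda>x. 0}" "j \<in> J" "a < m \<nu>" for \<nu> j a
    using z[OF that(1)] that(2,3) unfolding m_def w_def by blast
  define B where "B = insert const_fun (\<Union>\<nu>\<in>{\<nu>. eigsp \<nu> \<noteq> {\<lambda>x. 0}}. w \<nu> ` {..<m \<nu>})"
  note eb = ex_eigenbasis[where m = m and w = w, OF w, folded B_def]
  have "?bd j (\<Sum>x\<in>X. f j x * (cmod (\<phi> x))\<^sup>2)" if \<phi>: "\<phi> \<in> B" and j: "j \<in> J" for \<phi> j
  proof (cases "\<phi> = const_fun")
    case True
    have "(cmod (\<phi> x))\<^sup>2 = 1 / real (order G)" if "x \<in> X" for x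
      using that order_pos unfolding True const_fun_def by (simp add: norm_divide power_divide)
    then have "(\<Sum>x\<in>X. f j x * (cmod (\<phi> x))\<^sup>2) = (\<Sum>x\<in>X. f j x) / real (order G)"
      by (simp add: sum_divide_distrib)
    then show ?thesis using t by (simp add: sum_nonneg)
  next
    case False
    then obtain \<nu> a where *: "eigsp \<nu> \<noteq> {\<lambda>x. 0}" "a < m \<nu>" "\<phi> = w \<nu> a" using \<phi> unfolding B_def by blast
    have "(cmod (\<phi> x))\<^sup>2 = Re (\<phi> x) * Re (\<phi> x)" for x
    proof -
      have "\<phi> x \<in> \<real>" using eb(4)[OF _ \<phi>] by blast
      then have "(cmod (\<phi> x))\<^sup>2 = (Re (\<phi> x))\<^sup>2" by (simp add: cmod_power2 complex_is_Real_iff)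
      then show ?thesis by (simp only: power2_eq_square)
    qed
    then have "(\<Sum>x\<in>X. f j x * (cmod (\<phi> x))\<^sup>2) = qform X (f j) \<phi> \<phi>"
      by (simp add: qform_def mult.assoc)
    then show ?thesis using dev[OF *(1) j *(2)] unfolding *(3) by simp
  qed
  \<comment> \<open>The sums see only values on the carrier, so restriction keeps the
    bounds.\<close>
  then have "\<forall>\<phi>\<in>(\<lambda>\<phi>. restrict \<phi> X) ` B. \<forall>j\<in>J. ?bd j (\<Sum>x\<in>X. f j x * (cmod (\<phi> x))\<^sup>2)" by simp
  moreover have "real_eigenbasis G S ((\<lambda>\<phi>. restrict \<phi> X) ` B)"
    by (rule real_eigenbasis_restrict[OF eb])
  ultimately show ?thesis by blast
qed

end

section \<open>Sequences of groups and the asymptotic statement\<close>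

theorem theorem1p1:
  fixes G :: "nat \<Rightarrow> ('a, 'b) monoid_scheme"
    and S :: "nat \<Rightarrow> 'a set"
    and t :: "nat \<Rightarrow> real"
    and M :: "nat \<Rightarrow> nat"
    and f :: "nat \<Rightarrow> nat \<Rightarrow> 'a \<Rightarrow> real"
  assumes "\<And>i. group (G i)"
    and "\<And>i. finite (carrier (G i))"
    and "filterlim (\<lambda>i. order (G i)) at_top sequentially"
    and "\<And>i. S i \<subseteq> carrier (G i)"
    and "\<And>i. set_inv\<^bsub>G i\<^esub> (S i) = S i"
    and "\<And>i. 0 < t i"
    and "\<And>i. 2 * real (M i) *
           (\<Sum>c\<in>unitary_dual (G i) - {triv_class (G i)}.
              (real (class_dim c))\<^sup>2 *
              (6 * exp (- (t i * sqrt (real (class_dim c)) / 64))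
               + 2 * exp (- (real (class_dim c) / 12)))) < 1"
  shows "\<exists>B :: nat \<Rightarrow> ('a \<Rightarrow> complex) set.
    (\<forall>i. real_eigenbasis (G i) (S i) (B i)) \<and>
    (\<forall>i. \<forall>\<phi>\<in>B i. \<forall>j\<in>{1..M i}.
       \<bar>(\<integral>g. f i j g \<partial>quantum_measure (G i) \<phi>)
          - (\<Sum>g\<in>carrier (G i). f i j g) / real (order (G i))\<bar>
       \<le> t i * (l2_norm (G i) (\<lambda>g. complex_of_real (f i j g)) / sqrt (real (order (G i))))) \<and>
    (\<forall>A :: nat \<Rightarrow> nat \<Rightarrow> 'a set.
       (\<forall>i. \<forall>j\<in>{1..M i}. A i j \<subseteq> carrier (G i) \<and>
          (\<forall>g\<in>carrier (G i). f i j g = indicator (A i j) g)) \<longrightarrow>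
       (\<forall>i. \<forall>\<phi>\<in>B i. \<forall>j\<in>{1..M i}.
          \<bar>measure (quantum_measure (G i) \<phi>) (A i j) - real (card (A i j)) / real (order (G i))\<bar>
          \<le> t i * (sqrt (real (card (A i j))) / sqrt (real (order (G i))))) \<and>
       (\<forall>(\<phi> :: nat \<Rightarrow> 'a \<Rightarrow> complex) (j :: nat \<Rightarrow> nat).
          (\<forall>i. \<phi> i \<in> B i \<and> j i \<in> {1..M i}) \<and>
          (\<forall>\<^sub>F i in sequentially. A i (j i) \<noteq> {}) \<and>
          (\<lambda>i. (t i)\<^sup>2 * real (order (G i)) / real (card (A i (j i)))) \<longlonglongrightarrow> 0 \<longrightarrow>
          (\<lambda>i. measure (quantum_measure (G i) (\<phi> i)) (A i (j i))
                 / (real (card (A i (j i))) / real (order (G i)))) \<longlonglongrightarrow> 1))"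
proof -
  let ?bd = "\<lambda>i j q. \<bar>q - (\<Sum>g\<in>carrier (G i). f i j g) / real (order (G i))\<bar>
     \<le> t i * (l2_norm (G i) (\<lambda>g. complex_of_real (f i j g)) / sqrt (real (order (G i))))"
  have "\<forall>i. \<exists>B. real_eigenbasis (G i) (S i) B \<and> (\<forall>\<phi>\<in>B. \<forall>j\<in>{1..M i}.
      ?bd i j (\<integral>g. f i j g \<partial>quantum_measure (G i) \<phi>))"
  proof
    fix i
    interpret cayley "G i" "S i"
      by (intro cayley.intro fin_group.intro fin_group_axioms.intro cayley_axioms.intro assms)
    show "\<exists>B. real_eigenbasis (G i) (S i) B \<and> (\<forall>\<phi>\<in>B. \<forall>j\<in>{1..M i}.
      ?bd i j (\<integral>g. f i j g \<partial>quantum_measure (G i) \<phi>))"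
      using ex_balanced_eigenbasis[of "{1..M i}" "t i" "f i"] assms(6)[of i] assms(7)[of i]
      by (simp add: integral_quantum_measure[OF assms(2)] l2_norm_eq)
  qed
  from choice[OF this] obtain B where B: "\<And>i. real_eigenbasis (G i) (S i) (B i)"
    and bd: "\<And>i \<phi> j. \<phi> \<in> B i \<Longrightarrow> j \<in> {1..M i} \<Longrightarrow> ?bd i j (\<integral>g. f i j g \<partial>quantum_measure (G i) \<phi>)"
    by blast
  \<comment> \<open>The basis depends on \<open>f\<close> alone, so the bound for sets is a
    specialisation: integral, sum and norm of an indicator are the measure, the cardinality and its
    square root.\<close>
  have bdA: "\<bar>measure (quantum_measure (G i) \<phi>) (A i j) - real (card (A i j)) / real (order (G i))\<bar>
      \<le> t i * (sqrt (real (card (A i j))) / sqrt (real (order (G i))))"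
    if A: "\<And>i j. j \<in> {1..M i} \<Longrightarrow> A i j \<subseteq> carrier (G i) \<and> (\<forall>g\<in>carrier (G i). f i j g = indicator (A i j) g)"
      and \<phi>: "\<phi> \<in> B i" and j: "j \<in> {1..M i}" for A i \<phi> j
  proof -
    have Aij: "A i j \<subseteq> carrier (G i)" "\<And>g. g \<in> carrier (G i) \<Longrightarrow> f i j g = indicator (A i j) g"
      using A[OF j] by auto
    have fin: "finite (carrier (G i))" by (rule assms(2))
    have ind: "(\<Sum>g\<in>carrier (G i). indicator (A i j) g * h g) = (\<Sum>g\<in>A i j. h g)" for h :: "'a \<Rightarrow> real"
      using fin Aij(1) by (simp add: indicator_def if_distrib[of "\<lambda>x. x * _"] sum.If_cases Int_absorb1 cong: if_cong)
    have "(\<integral>g. f i j g \<partial>quantum_measure (G i) \<phi>) = measure (quantum_measure (G i) \<phi>) (A i j)"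
      using Aij ind by (simp add: integral_quantum_measure[OF fin] measure_quantum_measure[OF fin])
    moreover have "(\<Sum>g\<in>carrier (G i). f i j g) = real (card (A i j))"
      using Aij(2) ind[of "\<lambda>_. 1"] by simp
    moreover have "l2_norm (G i) (\<lambda>g. complex_of_real (f i j g)) = sqrt (real (card (A i j)))"
    proof -
      have "(cmod (complex_of_real (f i j g)))\<^sup>2 = indicator (A i j) g * 1" if "g \<in> carrier (G i)" for g
        using Aij(2)[OF that] by (simp add: indicator_def)
      then have "(\<Sum>g\<in>carrier (G i). (cmod (complex_of_real (f i j g)))\<^sup>2) = real (card (A i j))"
        using ind[of "\<lambda>_. 1"] by simp
      then show ?thesis by (simp add: l2_norm_eq)
    qed
    ultimately show ?thesis using bd[OF \<phi> j] by simp
  qed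
  have lim: "(\<lambda>i. measure (quantum_measure (G i) (\<phi> i)) (A i (j i))
                 / (real (card (A i (j i))) / real (order (G i)))) \<longlonglongrightarrow> 1"
    if A: "\<And>i j. j \<in> {1..M i} \<Longrightarrow> A i j \<subseteq> carrier (G i) \<and> (\<forall>g\<in>carrier (G i). f i j g = indicator (A i j) g)"
      and \<phi>: "\<And>i. \<phi> i \<in> B i \<and> j i \<in> {1..M i}"
      and ne: "\<forall>\<^sub>F i in sequentially. A i (j i) \<noteq> {}"
      and l: "(\<lambda>i. (t i)\<^sup>2 * real (order (G i)) / real (card (A i (j i)))) \<longlonglongrightarrow> 0"
    for A and \<phi> :: "nat \<Rightarrow> 'a \<Rightarrow> complex" and j :: "nat \<Rightarrow> nat"
  proof -
    let ?q = "\<lambda>i. measure (quantum_measure (G i) (\<phi> i)) (A i (j i))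
                 / (real (card (A i (j i))) / real (order (G i)))"
    have s: "(\<lambda>i. sqrt ((t i)\<^sup>2 * real (order (G i)) / real (card (A i (j i))))) \<longlonglongrightarrow> 0"
      using tendsto_real_sqrt[OF l] by simp
    \<comment> \<open>Let a be the cardinality of the set and n the group order. Division by a / n
      turns the error t sqrt (a / n) into t sqrt (n / a), the square root of the given null
      sequence; \<open>ne\<close> makes a positive eventually.\<close>
    have "\<forall>\<^sub>F i in sequentially. norm (?q i - 1) \<le> sqrt ((t i)\<^sup>2 * real (order (G i)) / real (card (A i (j i))))"
      using ne
    proof eventually_elim
      case (elim i)
      define a where "a = real (card (A i (j i)))"
      define n where "n = real (order (G i))"
      define \<mu> where "\<mu> = measure (quantum_measure (G i) (\<phi> i)) (A i (j i))"
      have "A i (j i) \<subseteq> carrier (G i)" using A \<phi> by blast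
      then have fA: "finite (A i (j i))" using assms(2) finite_subset by blast
      have a0: "0 < a" using fA elim by (simp add: a_def card_gt_0_iff)
      have n0: "0 < n" using monoid.order_gt_0_iff_finite[OF group.is_monoid[OF assms(1)]] assms(2) by (simp add: n_def)
      have "\<bar>\<mu> - a / n\<bar> \<le> t i * (sqrt a / sqrt n)"
        unfolding \<mu>_def a_def n_def using \<phi> by (intro bdA A) auto
      then have "\<bar>\<mu> - a / n\<bar> * (n / a) \<le> t i * (sqrt a / sqrt n) * (n / a)"
        using a0 n0 by (intro mult_right_mono) auto
      moreover have "\<bar>\<mu> - a / n\<bar> * (n / a) = \<bar>\<mu> / (a / n) - 1\<bar>"
      proof -
        have "\<bar>\<mu> - a / n\<bar> * (n / a) = \<bar>(\<mu> - a / n) * (n / a)\<bar>" using a0 n0 by (simp add: abs_mult)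
        also have "(\<mu> - a / n) * (n / a) = \<mu> / (a / n) - 1" using a0 n0 by (simp add: field_simps)
        finally show ?thesis .
      qed
      moreover have "t i * (sqrt a / sqrt n) * (n / a) = sqrt ((t i)\<^sup>2 * n / a)"
      proof -
        have "sqrt a / sqrt n * (n / a) = sqrt n / sqrt a"
          using real_div_sqrt[of a] real_div_sqrt[of n] a0 n0 by (simp add: field_simps)
        moreover have "sqrt ((t i)\<^sup>2 * n / a) = t i * (sqrt n / sqrt a)"
          using assms(6)[of i] by (simp add: real_sqrt_mult real_sqrt_divide)
        ultimately show ?thesis by (simp only: mult.assoc)
      qed
      ultimately show ?case unfolding \<mu>_def[symmetric] a_def[symmetric] n_def[symmetric] by simp
    qed
    from Lim_null_comparison[OF this s] show ?thesis by (rule LIM_zero_cancel)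
  qed
  show ?thesis
    by (intro exI[of _ B] conjI allI impI ballI B bd) (use bdA lim in blast)+
qed

end
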